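(* Let $(\boldsymbol{u}_h^n,p_h^n,\boldsymbol{E}_h^n,\boldsymbol{B}_h^n)\in \boldsymbol{V}_h\times Q_h\times \boldsymbol{C}_h\times \boldsymbol{D}_h$, $n=1,\dots,N$, be a solution of the discrete scheme (S1)--(S5) given in the context. Then for every $n=1,\dots,N$ $$\frac{\|\boldsymbol{u}^n_h\|^2-\|\boldsymbol{u}^{n-1}_h\|^2}{2\tau}+R_e^{-1}\|\nabla\overline{\boldsymbol{u}}^n_h\|^2+SR_m^{-2}\|\nabla_h\times\overline{\boldsymbol{B}}^n_h\|^2+SR_m^{-1}\frac{\|\boldsymbol{B}^n_h\|^2-\|\boldsymbol{B}^{n-1}_h\|^2}{2\tau}=(\boldsymbol{f}^n,\overline{\boldsymbol{u}}^n_h).$$ Consequently, there is a constant $C>0$, independent of $h$, $\tau$ and $n$, such that for $n=1,\dots,N$ $$\|\boldsymbol{u}^n_h\|^2+SR_m^{-1}\|\boldsymbol{B}^n_h\|^2+\tau\sum_{i=1}^n\left(R_e^{-1}\|\nabla\overline{\boldsymbol{u}}^i_h\|^2+2SR_m^{-2}\|\nabla_h\times\overline{\boldsymbol{B}}^i_h\|^2\right)\le \|\boldsymbol{u}^0_h\|^2+SR_m^{-1}\|\boldsymbol{B}^0_h\|^2+C\tau\sum_{i=1}^nR_e\|\boldsymbol{f}^i\|_{-1}^2 .$$ In addition, the discrete magnetic field is exactly divergence free: $\nabla\cdot\boldsymbol{B}^n_h=0$ for $n=1,\dots,N$, provided $\nabla\cdot\boldsymbol{B}^0_h=0$.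
   Context: Domain and data: $\Omega\subset\mathbb{R}^d$ ($d=2,3$) is a Lipschitz polyhedral domain, $T>0$; $R_e,R_m,S>0$ are the hydrodynamic Reynolds number, magnetic Reynolds number and coupling number; $\boldsymbol f(\cdot,t)\in \boldsymbol L^2(\Omega)$ is the body force; $\boldsymbol u_0,\boldsymbol B_0$ are the initial velocity and magnetic field, with $\nabla\cdot\boldsymbol u_0=\nabla\cdot\boldsymbol B_0=0$, and $p_0$ is the initial pressure. $(\cdot,\cdot)$ and $\|\cdot\|$ are the $L^2(\Omega)$ inner product and norm (scalar, vector or tensor valued), $\|\cdot\|_{-1}$ is the norm of $\boldsymbol H^{-1}(\Omega)$, the dual of $\boldsymbol H^1_0(\Omega)$. $\boldsymbol H_0(\mathrm{curl},\Omega)$ and $\boldsymbol H_0(\mathrm{div},\Omega)$ are the $L^2$ fields with $L^2$ curl (resp. divergence) and zero tangential trace $\boldsymbol v\times\boldsymbol n=0$ (resp. zero normal trace) on $\partial\Omega$; $L^2_0(\Omega)$ is the space of mean-zero $L^2$ functions. For $d=2$, cross products and curls have their usual two-dimensional meaning (planar $\boldsymbol u,\boldsymbol B$; scalar $\boldsymbol E,\boldsymbol j$). Discrete spaces: $\mathcal T_h$ is a conforming, shape-regular, quasi-uniform simplicial triangulation of $\Omega$ of mesh size $h$; $k\ge1$ is an integer. $\boldsymbol V_h=\{\boldsymbol v\in \boldsymbol H^1_0(\Omega):\boldsymbol v|_K\in \boldsymbol P^{k+1}(K)\ \forall K\in\mathcal T_h\}$ and $Q_h=\{q\in L^2_0(\Omega)\cap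 C(\Omega): q|_K\in P^k(K)\ \forall K\}$ (Taylor--Hood pair), assumed to satisfy the discrete inf-sup condition $\inf_{q\in Q_h\setminus0}\sup_{\boldsymbol v\in\boldsymbol V_h\setminus 0}\frac{(q,\nabla\cdot \boldsymbol v)}{\|\boldsymbol v\|_{1}\|q\|}\ge\kappa>0$ with $\kappa$ depending only on $\Omega$. $\boldsymbol D_h\subset \boldsymbol H_0(\mathrm{div},\Omega)$ is the $k$-th order Brezzi--Douglas--Marini space (piecewise $\boldsymbol P^k$), and $\boldsymbol C_h\subset\boldsymbol H_0(\mathrm{curl},\Omega)$ is the Nédélec space of the second type belonging to the same finite element de Rham sequence, i.e. the one preceding $\boldsymbol D_h$ (piecewise polynomials of degree $k+1$; for $d=2$, continuous piecewise $P^{k+1}$ scalars vanishing on $\partial\Omega$); in particular $\nabla\times\boldsymbol C_h\subset\boldsymbol D_h$. Discrete curl: for $\boldsymbol B\in\boldsymbol L^2(\Omega)$, $\nabla_h\times\boldsymbol B\in\boldsymbol C_h$ is defined by $(\nabla_h\times\boldsymbol B,\boldsymbol F)=(\boldsymbol B,\nabla\times\boldsymbol F)$ for all $\boldsymbol F\in\boldsymbol C_h$. Time discretization: $\tau=T/N$, $t_n=n\tau$, $U^n=U(\cdot,n\tau)$, $D_\tau U^n=(U^n-U^{n-1})/\tau$, $\overline U^n=(U^n+U^{n-1})/2$ for $n=1,\dots,N$ (same notation for sequences $U_h^n$). Scheme: for each $n=1,\dots,N$, $(\boldsymbol u_h^n,p_h^n,\boldsymbol E_h^n,\boldsymbol B_h^n)\in\boldsymbol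 V_h\times Q_h\times\boldsymbol C_h\times\boldsymbol D_h$ satisfies, for all $(\boldsymbol v,q,\boldsymbol F,\boldsymbol Z)\in\boldsymbol V_h\times Q_h\times\boldsymbol C_h\times\boldsymbol D_h$: (S1) $(D_\tau\boldsymbol u_h^n,\boldsymbol v)+R_e^{-1}(\nabla\overline{\boldsymbol u}_h^n,\nabla\boldsymbol v)+\frac12[(\boldsymbol u_h^{n-1}\cdot\nabla\overline{\boldsymbol u}_h^n,\boldsymbol v)-(\boldsymbol u_h^{n-1}\cdot\nabla\boldsymbol v,\overline{\boldsymbol u}_h^n)]-SR_m^{-1}((\nabla_h\times\overline{\boldsymbol B}_h^n)\times\boldsymbol B_h^{n-1},\boldsymbol v)-(p_h^n,\nabla\cdot\boldsymbol v)=(\boldsymbol f^n,\boldsymbol v)$; (S2) $(\boldsymbol j_h^n,\boldsymbol F)-R_m^{-1}(\overline{\boldsymbol B}_h^n,\nabla\times\boldsymbol F)=0$; (S3) $(D_\tau\boldsymbol B_h^n,\boldsymbol Z)+(\nabla\times\boldsymbol E_h^n,\boldsymbol Z)=0$; (S4) $(\nabla\cdot\overline{\boldsymbol u}_h^n,q)=0$; (S5) $\boldsymbol j_h^n=\boldsymbol E_h^n+\overline{\boldsymbol u}_h^n\times\boldsymbol B_h^{n-1}$. Initial values: $\boldsymbol u_h^0=\boldsymbol\Pi_V\boldsymbol u_0$, $\boldsymbol B_h^0=\boldsymbol\Pi_D\boldsymbol B_0$, where $(\boldsymbol\Pi_V\boldsymbol u,\Pi_Qp)\in\boldsymbol V_h\times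 Q_h$ is the Stokes projection: $R_e^{-1}(\nabla\boldsymbol\Pi_V\boldsymbol u,\nabla\boldsymbol v)-(\Pi_Qp,\nabla\cdot\boldsymbol v)=R_e^{-1}(\nabla\boldsymbol u,\nabla\boldsymbol v)-(p,\nabla\cdot\boldsymbol v)$ and $(\nabla\cdot\boldsymbol\Pi_V\boldsymbol u,q)=(\nabla\cdot\boldsymbol u,q)$ for all $(\boldsymbol v,q)\in\boldsymbol V_h\times Q_h$, applied at $t=0$ to $(\boldsymbol u_0,p_0)$; and $\boldsymbol\Pi_D$ is the $L^2$-orthogonal projection onto $\boldsymbol D_h^0=\{\boldsymbol Z\in\boldsymbol D_h:\nabla\cdot\boldsymbol Z=0\}$. *)

theory Defs
  imports "HOL-Analysis.Analysis"
begin

text \<open>Fields on \<open>\<Omega>\<close> are total functions on \<open>real^'n\<close> whose values outside \<open>\<Omega>\<close> are irrelevant;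
  elements of \<open>L\<^sup>2\<close>-type spaces are represented by any member of their almost-everywhere class.\<close>

section \<open>Domains and meshes\<close>

text \<open>Near each boundary point, \<open>\<Omega>\<close> is the set lying strictly above the graph of a Lipschitz function
  over the hyperplane orthogonal to some unit vector \<open>e\<close>.\<close>

definition lipschitz_boundary :: "(real^'n) set \<Rightarrow> bool" where
  "lipschitz_boundary \<Omega> \<longleftrightarrow>
     (\<forall>x\<in>frontier \<Omega>. \<exists>e r L g. norm e = 1 \<and> 0 < r \<and> L-lipschitz_on UNIV (g :: real^'n \<Rightarrow> real) \<and>
        \<Omega> \<inter> ball x r = {y \<in> ball x r. g (y - (y \<bullet> e) *\<^sub>R e) < y \<bullet> e})"

definition lipschitz_polyhedral_domain :: "(real^'n) set \<Rightarrow> bool" where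
  "lipschitz_polyhedral_domain \<Omega> \<longleftrightarrow>
     open \<Omega> \<and> connected \<Omega> \<and> \<Omega> \<noteq> {} \<and> bounded \<Omega> \<and> lipschitz_boundary \<Omega> \<and>
     (\<exists>P. finite P \<and> (\<forall>p\<in>P. polytope p) \<and> closure \<Omega> = \<Union>P)"

text \<open>Conformity (two simplices meet in a common face, possibly empty) is part of
  \<^const>\<open>triangulation\<close>.\<close>

definition simplicial_mesh :: "(real^'n) set \<Rightarrow> (real^'n) set set \<Rightarrow> bool" where
  "simplicial_mesh \<Omega> Th \<longleftrightarrow>
     triangulation Th \<and> (\<forall>K\<in>Th. int CARD('n) simplex K) \<and> \<Union>Th = closure \<Omega>"

definition inradius :: "(real^'n) set \<Rightarrow> real" where
  "inradius K = Sup {r. \<exists>x. cball x r \<subseteq> K}"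

definition mesh_size :: "(real^'n) set set \<Rightarrow> real" where
  "mesh_size Th = Max (diameter ` Th)"

definition shape_regular :: "real \<Rightarrow> (real^'n) set set \<Rightarrow> bool" where
  "shape_regular \<sigma> Th \<longleftrightarrow> (\<forall>K\<in>Th. diameter K \<le> \<sigma> * inradius K)"

definition quasi_uniform :: "real \<Rightarrow> (real^'n) set set \<Rightarrow> bool" where
  "quasi_uniform \<rho> Th \<longleftrightarrow> (\<forall>K\<in>Th. mesh_size Th \<le> \<rho> * diameter K)"

section \<open>Classical derivatives and test functions\<close>

definition partial_deriv :: "'n \<Rightarrow> (real^'n \<Rightarrow> 'b) \<Rightarrow> real^'n \<Rightarrow> 'b::real_normed_vector" where
  "partial_deriv j f x = frechet_derivative f (at x) (axis j 1)"

definition smooth :: "(real^'n \<Rightarrow> 'b::real_normed_vector) \<Rightarrow> bool" where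
  "smooth f \<longleftrightarrow> (\<forall>js x. foldr partial_deriv js f differentiable (at x))"

definition test_functions :: "(real^'n) set \<Rightarrow> (real^'n \<Rightarrow> 'b::real_normed_vector) set" where
  "test_functions \<Omega> =
     {\<phi>. smooth \<phi> \<and> compact (closure {x. \<phi> x \<noteq> 0}) \<and> closure {x. \<phi> x \<noteq> 0} \<subseteq> \<Omega>}"

text \<open>The gradient of a vector field is the array of its partial derivatives, so that the inner product
  of two gradients is the Frobenius product.\<close>

definition grad :: "(real^'n \<Rightarrow> 'b) \<Rightarrow> real^'n \<Rightarrow> ('b::real_normed_vector)^'n" where
  "grad f x = (\<chi> j. partial_deriv j f x)"

section \<open>Cross products and the classical curl in two and three dimensions\<close>

text \<open>All notions below are generic in the dimension: \<open>'e\<close> is the type of values of the electric field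
  (\<open>real^3\<close> for \<open>d = 3\<close>, \<open>real\<close> for \<open>d = 2\<close>), \<open>vv\<close> is the product of two vectors, and \<open>ev\<close> is the
  product of a value of type \<open>'e\<close> with a vector. For \<open>d = 3\<close> both are \<^const>\<open>cross3\<close>; for \<open>d = 2\<close>,
  planar vectors lie in the plane \<open>z = 0\<close> and scalars point in the \<open>z\<close> direction.\<close>

definition cross2_vv :: "real^2 \<Rightarrow> real^2 \<Rightarrow> real" where
  "cross2_vv a b = a$1 * b$2 - a$2 * b$1"

definition cross2_ev :: "real \<Rightarrow> real^2 \<Rightarrow> real^2" where
  "cross2_ev s b = vector [- s * b$2, s * b$1]"

definition curl :: "(real^'n \<Rightarrow> real^'n \<Rightarrow> 'e) \<Rightarrow> (real^'n \<Rightarrow> real^'n) \<Rightarrow> real^'n \<Rightarrow> 'e::real_normed_vector"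
  where "curl vv \<psi> x = (\<Sum>i\<in>UNIV. vv (axis i 1) (partial_deriv i \<psi> x))"

section \<open>Function spaces\<close>

definition L2 :: "(real^'n) set \<Rightarrow> (real^'n \<Rightarrow> 'b::euclidean_space) set" where
  "L2 \<Omega> = {f. f \<in> borel_measurable (lebesgue_on \<Omega>) \<and>
              integrable (lebesgue_on \<Omega>) (\<lambda>x. (norm (f x))\<^sup>2)}"

definition ip :: "(real^'n) set \<Rightarrow> (real^'n \<Rightarrow> 'b) \<Rightarrow> (real^'n \<Rightarrow> 'b::euclidean_space) \<Rightarrow> real" where
  "ip \<Omega> f g = integral\<^sup>L (lebesgue_on \<Omega>) (\<lambda>x. f x \<bullet> g x)"

definition L2norm :: "(real^'n) set \<Rightarrow> (real^'n \<Rightarrow> 'b::euclidean_space) \<Rightarrow> real" where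
  "L2norm \<Omega> f = sqrt (ip \<Omega> f f)"

definition has_weak_grad :: "(real^'n) set \<Rightarrow> (real^'n \<Rightarrow> 'b::euclidean_space) \<Rightarrow> (real^'n \<Rightarrow> 'b^'n) \<Rightarrow> bool"
  where "has_weak_grad \<Omega> u G \<longleftrightarrow> G \<in> L2 \<Omega> \<and>
     (\<forall>\<phi>\<in>test_functions \<Omega>. \<forall>j.
        integral\<^sup>L (lebesgue_on \<Omega>) (\<lambda>x. partial_deriv j \<phi> x *\<^sub>R u x) =
        - integral\<^sup>L (lebesgue_on \<Omega>) (\<lambda>x. \<phi> x *\<^sub>R (G x $ j)))"

definition wgrad :: "(real^'n) set \<Rightarrow> (real^'n \<Rightarrow> 'b::euclidean_space) \<Rightarrow> real^'n \<Rightarrow> 'b^'n" where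
  "wgrad \<Omega> u = (SOME G. has_weak_grad \<Omega> u G)"

definition has_weak_div :: "(real^'n) set \<Rightarrow> (real^'n \<Rightarrow> real^'n) \<Rightarrow> (real^'n \<Rightarrow> real) \<Rightarrow> bool" where
  "has_weak_div \<Omega> u g \<longleftrightarrow> g \<in> L2 \<Omega> \<and> (\<forall>\<phi>\<in>test_functions \<Omega>. ip \<Omega> u (grad \<phi>) = - ip \<Omega> g \<phi>)"

definition wdiv :: "(real^'n) set \<Rightarrow> (real^'n \<Rightarrow> real^'n) \<Rightarrow> real^'n \<Rightarrow> real" where
  "wdiv \<Omega> u = (SOME g. has_weak_div \<Omega> u g)"

text \<open>For \<open>d = 2\<close> this is the vector curl of a scalar field; its formal adjoint is the scalar curl of
  planar test fields.\<close>

definition has_weak_curl ::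
  "(real^'n \<Rightarrow> real^'n \<Rightarrow> 'e) \<Rightarrow> (real^'n) set \<Rightarrow> (real^'n \<Rightarrow> 'e::euclidean_space) \<Rightarrow> (real^'n \<Rightarrow> real^'n) \<Rightarrow> bool"
  where "has_weak_curl vv \<Omega> F G \<longleftrightarrow> G \<in> L2 \<Omega> \<and>
     (\<forall>\<psi>\<in>test_functions \<Omega>. ip \<Omega> F (curl vv \<psi>) = ip \<Omega> G \<psi>)"

definition wcurl ::
  "(real^'n \<Rightarrow> real^'n \<Rightarrow> 'e) \<Rightarrow> (real^'n) set \<Rightarrow> (real^'n \<Rightarrow> 'e::euclidean_space) \<Rightarrow> real^'n \<Rightarrow> real^'n"
  where "wcurl vv \<Omega> F = (SOME G. has_weak_curl vv \<Omega> F G)"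

definition H1 :: "(real^'n) set \<Rightarrow> (real^'n \<Rightarrow> 'b::euclidean_space) set" where
  "H1 \<Omega> = {u \<in> L2 \<Omega>. \<exists>G. has_weak_grad \<Omega> u G}"

definition Hdiv :: "(real^'n) set \<Rightarrow> (real^'n \<Rightarrow> real^'n) set" where
  "Hdiv \<Omega> = {u \<in> L2 \<Omega>. \<exists>g. has_weak_div \<Omega> u g}"

definition Hcurl ::
  "(real^'n \<Rightarrow> real^'n \<Rightarrow> 'e) \<Rightarrow> (real^'n) set \<Rightarrow> (real^'n \<Rightarrow> 'e::euclidean_space) set" where
  "Hcurl vv \<Omega> = {F \<in> L2 \<Omega>. \<exists>G. has_weak_curl vv \<Omega> F G}"

definition H1norm :: "(real^'n) set \<Rightarrow> (real^'n \<Rightarrow> 'b::euclidean_space) \<Rightarrow> real" where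
  "H1norm \<Omega> u = sqrt ((L2norm \<Omega> u)\<^sup>2 + (L2norm \<Omega> (wgrad \<Omega> u))\<^sup>2)"

definition H10 :: "(real^'n) set \<Rightarrow> (real^'n \<Rightarrow> 'b::euclidean_space) set" where
  "H10 \<Omega> = {u \<in> H1 \<Omega>. \<exists>\<phi>. (\<forall>m. \<phi> m \<in> test_functions \<Omega>) \<and>
     (\<lambda>m::nat. L2norm \<Omega> (\<lambda>x. u x - \<phi> m x)) \<longlonglongrightarrow> 0 \<and>
     (\<lambda>m. L2norm \<Omega> (\<lambda>x. wgrad \<Omega> u x - grad (\<phi> m) x)) \<longlonglongrightarrow> 0}"

text \<open>The normal and tangential traces on a Lipschitz boundary are the boundary functionals given by
  Green's formulas. They vanish iff the formulas hold without a boundary term for all functions that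
  are smooth up to the boundary, which are dense in \<open>H\<^sup>1(\<Omega>)\<close>.\<close>

definition H0div :: "(real^'n) set \<Rightarrow> (real^'n \<Rightarrow> real^'n) set" where
  "H0div \<Omega> = {u \<in> Hdiv \<Omega>. \<forall>\<phi>. smooth \<phi> \<longrightarrow> ip \<Omega> u (grad \<phi>) + ip \<Omega> (wdiv \<Omega> u) \<phi> = 0}"

definition H0curl ::
  "(real^'n \<Rightarrow> real^'n \<Rightarrow> 'e) \<Rightarrow> (real^'n) set \<Rightarrow> (real^'n \<Rightarrow> 'e::euclidean_space) set" where
  "H0curl vv \<Omega> =
     {F \<in> Hcurl vv \<Omega>. \<forall>\<psi>. smooth \<psi> \<longrightarrow> ip \<Omega> F (curl vv \<psi>) - ip \<Omega> (wcurl vv \<Omega> F) \<psi> = 0}"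

text \<open>The dual norm on \<open>H\<^sup>-\<^sup>1(\<Omega>)\<close> of the functional \<open>v \<mapsto> (f, v)\<close>, with \<open>H\<^sup>1\<^sub>0(\<Omega>)\<close> normed by the full
  \<open>H\<^sup>1\<close> norm.\<close>

definition Hm1norm :: "(real^'n) set \<Rightarrow> (real^'n \<Rightarrow> 'b::euclidean_space) \<Rightarrow> real" where
  "Hm1norm \<Omega> f = Sup {\<bar>ip \<Omega> f v\<bar> / H1norm \<Omega> v |v. v \<in> H10 \<Omega> \<and> H1norm \<Omega> v \<noteq> 0}"

section \<open>Finite element spaces\<close>

definition poly_space :: "nat \<Rightarrow> (real^'n \<Rightarrow> 'b::euclidean_space) set" where
  "poly_space k = {p. \<exists>c. p = (\<lambda>x. \<Sum>\<alpha> | (\<Sum>i\<in>UNIV. \<alpha> i) \<le> k. (\<Prod>i\<in>UNIV. (x $ i) ^ \<alpha> i) *\<^sub>R c \<alpha>)}"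

definition piecewise_poly :: "(real^'n) set set \<Rightarrow> nat \<Rightarrow> (real^'n \<Rightarrow> 'b::euclidean_space) set" where
  "piecewise_poly Th k = {v. \<forall>K\<in>Th. \<exists>p\<in>poly_space k. AE x in lebesgue_on K. v x = p x}"

definition TH_velocity :: "(real^'n) set \<Rightarrow> (real^'n) set set \<Rightarrow> nat \<Rightarrow> (real^'n \<Rightarrow> real^'n) set" where
  "TH_velocity \<Omega> Th k = H10 \<Omega> \<inter> piecewise_poly Th (k + 1)"

definition TH_pressure :: "(real^'n) set \<Rightarrow> (real^'n) set set \<Rightarrow> nat \<Rightarrow> (real^'n \<Rightarrow> real) set" where
  "TH_pressure \<Omega> Th k =
     {q \<in> L2 \<Omega>. integral\<^sup>L (lebesgue_on \<Omega>) q = 0 \<and> continuous_on \<Omega> q \<and> q \<in> piecewise_poly Th k}"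

definition BDM :: "(real^'n) set \<Rightarrow> (real^'n) set set \<Rightarrow> nat \<Rightarrow> (real^'n \<Rightarrow> real^'n) set" where
  "BDM \<Omega> Th k = H0div \<Omega> \<inter> piecewise_poly Th k"

text \<open>The space preceding \<open>BDM \<Omega> Th k\<close> in the de Rham sequence: Nedelec elements of the second
  type for \<open>d = 3\<close>, Lagrange elements for \<open>d = 2\<close>, where continuity and the boundary values select
  the representative and hold almost everywhere for every member of \<open>H0curl\<close> that is piecewise polynomial.\<close>

definition nedelec3 :: "(real^3) set \<Rightarrow> (real^3) set set \<Rightarrow> nat \<Rightarrow> (real^3 \<Rightarrow> real^3) set" where
  "nedelec3 \<Omega> Th k = H0curl cross3 \<Omega> \<inter> piecewise_poly Th (k + 1)"

definition nedelec2 :: "(real^2) set \<Rightarrow> (real^2) set set \<Rightarrow> nat \<Rightarrow> (real^2 \<Rightarrow> real) set" where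
  "nedelec2 \<Omega> Th k = {F \<in> H0curl cross2_vv \<Omega> \<inter> piecewise_poly Th (k + 1).
     continuous_on (closure \<Omega>) F \<and> (\<forall>x\<in>frontier \<Omega>. F x = 0)}"

definition inf_sup_condition ::
  "real \<Rightarrow> (real^'n) set \<Rightarrow> (real^'n \<Rightarrow> real^'n) set \<Rightarrow> (real^'n \<Rightarrow> real) set \<Rightarrow> bool" where
  "inf_sup_condition \<kappa> \<Omega> Vh Qh \<longleftrightarrow> (\<forall>q\<in>Qh. L2norm \<Omega> q \<noteq> 0 \<longrightarrow>
     \<kappa> \<le> Sup {ip \<Omega> q (wdiv \<Omega> v) / (H1norm \<Omega> v * L2norm \<Omega> q) |v. v \<in> Vh \<and> L2norm \<Omega> v \<noteq> 0})"

definition discrete_curl ::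
  "(real^'n \<Rightarrow> real^'n \<Rightarrow> 'e) \<Rightarrow> (real^'n) set \<Rightarrow> (real^'n \<Rightarrow> 'e::euclidean_space) set \<Rightarrow>
   (real^'n \<Rightarrow> real^'n) \<Rightarrow> real^'n \<Rightarrow> 'e" where
  "discrete_curl vv \<Omega> Ch B = (SOME J. J \<in> Ch \<and> (\<forall>F\<in>Ch. ip \<Omega> J F = ip \<Omega> B (wcurl vv \<Omega> F)))"

section \<open>Projections of the initial data\<close>

text \<open>\<open>(Pu, Pp)\<close> is the Stokes projection of \<open>(u, p)\<close>.\<close>

definition stokes_projection ::
  "(real^'n) set \<Rightarrow> (real^'n \<Rightarrow> real^'n) set \<Rightarrow> (real^'n \<Rightarrow> real) set \<Rightarrow> real \<Rightarrow>
   (real^'n \<Rightarrow> real^'n) \<Rightarrow> (real^'n \<Rightarrow> real) \<Rightarrow> (real^'n \<Rightarrow> real^'n) \<Rightarrow> (real^'n \<Rightarrow> real) \<Rightarrow> bool" where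
  "stokes_projection \<Omega> Vh Qh Rey u p Pu Pp \<longleftrightarrow> Pu \<in> Vh \<and> Pp \<in> Qh \<and>
     (\<forall>v\<in>Vh. 1 / Rey * ip \<Omega> (wgrad \<Omega> Pu) (wgrad \<Omega> v) - ip \<Omega> Pp (wdiv \<Omega> v) =
             1 / Rey * ip \<Omega> (wgrad \<Omega> u) (wgrad \<Omega> v) - ip \<Omega> p (wdiv \<Omega> v)) \<and>
     (\<forall>q\<in>Qh. ip \<Omega> (wdiv \<Omega> Pu) q = ip \<Omega> (wdiv \<Omega> u) q)"

definition div_free :: "(real^'n) set \<Rightarrow> (real^'n \<Rightarrow> real^'n) \<Rightarrow> bool" where
  "div_free \<Omega> u \<longleftrightarrow> (AE x in lebesgue_on \<Omega>. wdiv \<Omega> u x = 0)"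

text \<open>\<open>PB\<close> is the \<open>L\<^sup>2\<close>-orthogonal projection of \<open>B\<close> onto the divergence-free subspace of \<open>Dh\<close>.\<close>

definition div_free_projection ::
  "(real^'n) set \<Rightarrow> (real^'n \<Rightarrow> real^'n) set \<Rightarrow> (real^'n \<Rightarrow> real^'n) \<Rightarrow> (real^'n \<Rightarrow> real^'n) \<Rightarrow> bool" where
  "div_free_projection \<Omega> Dh B PB \<longleftrightarrow> PB \<in> Dh \<and> div_free \<Omega> PB \<and>
     (\<forall>Z\<in>Dh. div_free \<Omega> Z \<longrightarrow> ip \<Omega> PB Z = ip \<Omega> B Z)"

section \<open>The scheme\<close>

definition D\<tau> :: "real \<Rightarrow> (nat \<Rightarrow> 'a \<Rightarrow> 'b) \<Rightarrow> nat \<Rightarrow> 'a \<Rightarrow> 'b::real_vector" where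
  "D\<tau> \<tau> U n x = (1 / \<tau>) *\<^sub>R (U n x - U (n - 1) x)"

definition avg :: "(nat \<Rightarrow> 'a \<Rightarrow> 'b) \<Rightarrow> nat \<Rightarrow> 'a \<Rightarrow> 'b::real_vector" where
  "avg U n x = (1 / 2) *\<^sub>R (U n x + U (n - 1) x)"

definition convect :: "(real^'n) set \<Rightarrow> (real^'n \<Rightarrow> real^'n) \<Rightarrow> (real^'n \<Rightarrow> real^'n) \<Rightarrow> real^'n \<Rightarrow> real^'n"
  where "convect \<Omega> w u x = (\<Sum>j\<in>UNIV. (w x $ j) *\<^sub>R (wgrad \<Omega> u x $ j))"

text \<open>The current density \<open>j\<close> is not an unknown of the scheme; its defining equation (the last equation
  of the scheme) is substituted through \<open>let\<close>.\<close>

definition mhd_scheme ::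
  "(real^'n \<Rightarrow> real^'n \<Rightarrow> 'e) \<Rightarrow> ('e \<Rightarrow> real^'n \<Rightarrow> real^'n) \<Rightarrow> (real^'n) set \<Rightarrow>
   (real^'n \<Rightarrow> real^'n) set \<Rightarrow> (real^'n \<Rightarrow> real) set \<Rightarrow> (real^'n \<Rightarrow> 'e::euclidean_space) set \<Rightarrow>
   (real^'n \<Rightarrow> real^'n) set \<Rightarrow> real \<Rightarrow> real \<Rightarrow> real \<Rightarrow> real \<Rightarrow> nat \<Rightarrow> (real \<Rightarrow> real^'n \<Rightarrow> real^'n) \<Rightarrow>
   (nat \<Rightarrow> real^'n \<Rightarrow> real^'n) \<Rightarrow> (nat \<Rightarrow> real^'n \<Rightarrow> real) \<Rightarrow> (nat \<Rightarrow> real^'n \<Rightarrow> 'e) \<Rightarrow>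
   (nat \<Rightarrow> real^'n \<Rightarrow> real^'n) \<Rightarrow> bool" where
  "mhd_scheme vv ev \<Omega> Vh Qh Ch Dh Rey Rem S \<tau> N f u p E B \<longleftrightarrow> (\<forall>n\<in>{1..N}.
     u n \<in> Vh \<and> p n \<in> Qh \<and> E n \<in> Ch \<and> B n \<in> Dh \<and>
     (let j = (\<lambda>x. E n x + vv (avg u n x) (B (n - 1) x)) in
       (\<forall>v\<in>Vh.
          ip \<Omega> (D\<tau> \<tau> u n) v
          + 1 / Rey * ip \<Omega> (wgrad \<Omega> (avg u n)) (wgrad \<Omega> v)
          + 1 / 2 * (ip \<Omega> (convect \<Omega> (u (n - 1)) (avg u n)) v
                     - ip \<Omega> (convect \<Omega> (u (n - 1)) v) (avg u n))
          - S / Rem * ip \<Omega> (\<lambda>x. ev (discrete_curl vv \<Omega> Ch (avg B n) x) (B (n - 1) x)) v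
          - ip \<Omega> (p n) (wdiv \<Omega> v)
          = ip \<Omega> (f (real n * \<tau>)) v) \<and>
       (\<forall>F\<in>Ch. ip \<Omega> j F - 1 / Rem * ip \<Omega> (avg B n) (wcurl vv \<Omega> F) = 0) \<and>
       (\<forall>Z\<in>Dh. ip \<Omega> (D\<tau> \<tau> B n) Z + ip \<Omega> (wcurl vv \<Omega> (E n)) Z = 0) \<and>
       (\<forall>q\<in>Qh. ip \<Omega> (wdiv \<Omega> (avg u n)) q = 0)))"

end

theory Submission
  imports Defs "HOL-Library.Function_Algebras"
begin

text \<open>
  The energy identity comes from testing each equation of the scheme with the unknown it governs. The
  momentum equation is tested with the averaged velocity: the convective term is skew-symmetric and
  drops out, and the pressure sees only the discretely vanishing divergence. What remains is the
  Lorentz force. Ohm's law, tested with the discrete curl \<open>J\<close> of the averaged magnetic field, turns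
  its work into \<open>\<parallel>J\<parallel>\<^sup>2\<close> minus the pairing of the electric field with \<open>J\<close>; Faraday's law, tested with
  the averaged magnetic field, identifies that pairing as the rate of change of the magnetic energy.
  Both steps use only the triple product identity \<open>c \<bullet> (a \<times> b) = (c \<times> a) \<bullet> b\<close> and the antisymmetry of
  the product, so the spatial and the planar case are treated together in the locale
  \<open>cross_products\<close>. Summation over the steps, the Poincare inequality and Young's inequality give the
  stability estimate with \<open>C = 4 R\<^sup>2 + 1\<close>, where \<open>\<Omega>\<close> lies in the ball of radius \<open>R\<close> about \<open>0\<close>.

  The magnetic field stays divergence free because \<open>\<nabla> \<times> E\<close> belongs to the magnetic space: Faraday's
  law may then be tested with its own residual and holds pointwise almost everywhere, so the field
  changes by a multiple of a curl.

  The analysis behind this is of three kinds. First, weak derivatives are fixed by an arbitrary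
  choice, so linearity of \<^const>\<open>wgrad\<close>, \<^const>\<open>wdiv\<close> and \<^const>\<open>wcurl\<close>, and with it linearity of
  the finite element spaces, rests on their uniqueness almost everywhere, that is, on the
  fundamental lemma of the calculus of variations (\<open>fundamental_lemma\<close>) and explicit bump functions.
  Second, integration by parts against test functions (\<open>integration_by_parts\<close>) yields the Poincare
  inequality (\<open>poincare_H10\<close>) and shows that the weak curl of a piecewise polynomial is, inside each
  cell, the classical one (\<open>wcurl_piecewise_poly\<close>). Third, the discrete curl exists by a Riesz
  representation in a space that is finite-dimensional up to null sets (\<open>discrete_curl\<close>).
\<close>

section \<open>The space of square-integrable fields\<close>

definition subspace_of_fields :: "('a \<Rightarrow> 'b::real_vector) set \<Rightarrow> bool" where
  "subspace_of_fields V \<longleftrightarrow> (\<forall>f\<in>V. \<forall>g\<in>V. \<forall>a b. (\<lambda>x. a *\<^sub>R f x + b *\<^sub>R g x) \<in> V)"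

lemma subspace_of_fieldsD:
  "subspace_of_fields V \<Longrightarrow> f \<in> V \<Longrightarrow> g \<in> V \<Longrightarrow> (\<lambda>x. a *\<^sub>R f x + b *\<^sub>R g x) \<in> V"
  by (simp add: subspace_of_fields_def)

lemma subspace_of_fields_scaleR:
  "subspace_of_fields V \<Longrightarrow> f \<in> V \<Longrightarrow> (\<lambda>x. a *\<^sub>R f x) \<in> V"
  using subspace_of_fieldsD[of V f f a 0] by simp

lemma subspace_of_fields_sum:
  assumes V: "subspace_of_fields V" and F: "F \<in> V" and e: "\<And>s. s \<in> A \<Longrightarrow> e s \<in> V"
  shows "(\<lambda>x. F x - (\<Sum>s\<in>A. c s *\<^sub>R e s x)) \<in> V"
  using e
proof (induction A rule: infinite_finite_induct)
  case (insert s A)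
  have *: "(\<lambda>x. 1 *\<^sub>R (F x - (\<Sum>s\<in>A. c s *\<^sub>R e s x)) + (- c s) *\<^sub>R e s x) \<in> V"
    using insert by (intro subspace_of_fieldsD[OF V]) auto
  show ?case
    using * insert(1,2) by (simp add: algebra_simps)
qed (use F in simp_all)

lemma L2_measurable: "f \<in> L2 \<Omega> \<Longrightarrow> f \<in> borel_measurable (lebesgue_on \<Omega>)"
  by (simp add: L2_def)

lemma L2_integrable_power2: "f \<in> L2 \<Omega> \<Longrightarrow> integrable (lebesgue_on \<Omega>) (\<lambda>x. (norm (f x))\<^sup>2)"
  by (simp add: L2_def)

lemma norm_mult_le_sum_squares: "norm a * norm b \<le> (norm a)\<^sup>2 + (norm b)\<^sup>2"
proof -
  have "2 * (norm a * norm b) \<le> (norm a)\<^sup>2 + (norm b)\<^sup>2"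
    using sum_squares_bound[of "norm a" "norm b"] by (simp add: algebra_simps)
  moreover have "0 \<le> norm a * norm b" by simp
  ultimately show ?thesis by linarith
qed

lemma L2_product_integrable:
  fixes f :: "real^'n \<Rightarrow> 'b::euclidean_space" and g :: "real^'n \<Rightarrow> 'c::euclidean_space"
    and P :: "'b \<Rightarrow> 'c \<Rightarrow> 'd::euclidean_space"
  assumes P: "bounded_bilinear P" and f: "f \<in> L2 \<Omega>" and g: "g \<in> L2 \<Omega>"
  shows "integrable (lebesgue_on \<Omega>) (\<lambda>x. P (f x) (g x))"
proof -
  obtain K where K: "K > 0" "\<And>a b. norm (P a b) \<le> norm a * norm b * K"
    using bounded_bilinear.pos_bounded[OF P] by auto
  have "continuous_on UNIV (\<lambda>z::'b\<times>'c. P (fst z) (snd z))"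
    by (intro bounded_bilinear.continuous_on[OF P]) (auto intro!: continuous_intros)
  then have m: "(\<lambda>z. P (fst z) (snd z)) \<in> borel_measurable borel"
    by (rule borel_measurable_continuous_onI)
  have "(\<lambda>x. (f x, g x)) \<in> borel_measurable (lebesgue_on \<Omega>)"
    using f g by (intro borel_measurable_Pair L2_measurable)
  from measurable_compose[OF this m] have meas: "(\<lambda>x. P (f x) (g x)) \<in> borel_measurable (lebesgue_on \<Omega>)"
    by simp
  have int: "integrable (lebesgue_on \<Omega>) (\<lambda>x. K * ((norm (f x))\<^sup>2 + (norm (g x))\<^sup>2))"
    using f g by (intro Bochner_Integration.integrable_mult_right Bochner_Integration.integrable_add
        L2_integrable_power2)
  show ?thesis
  proof (rule Bochner_Integration.integrable_bound[OF int meas], rule always_eventually, rule allI)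
    fix x
    have "norm (P (f x) (g x)) \<le> K * (norm (f x) * norm (g x))"
      using K(2)[of "f x" "g x"] by (simp add: mult_ac)
    also have "\<dots> \<le> K * ((norm (f x))\<^sup>2 + (norm (g x))\<^sup>2)"
      using norm_mult_le_sum_squares[of "f x" "g x"] K(1) by (intro mult_left_mono) auto
    finally show "norm (P (f x) (g x)) \<le> norm (K * ((norm (f x))\<^sup>2 + (norm (g x))\<^sup>2))"
      using K(1) by simp
  qed
qed

lemmas L2_inner_integrable = L2_product_integrable[OF bounded_bilinear_inner]

lemma subspace_L2: "subspace_of_fields (L2 \<Omega> :: (real^'n \<Rightarrow> 'b::euclidean_space) set)"
  unfolding subspace_of_fields_def
proof (intro ballI allI)
  fix f g :: "real^'n \<Rightarrow> 'b" and a b :: real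
  assume f: "f \<in> L2 \<Omega>" and g: "g \<in> L2 \<Omega>"
  have "integrable (lebesgue_on \<Omega>) (\<lambda>x. a\<^sup>2 * (f x \<bullet> f x) + 2 * a * b * (f x \<bullet> g x) + b\<^sup>2 * (g x \<bullet> g x))"
    by (intro Bochner_Integration.integrable_add Bochner_Integration.integrable_mult_right
        L2_inner_integrable f g)
  moreover have "(\<lambda>x. (norm (a *\<^sub>R f x + b *\<^sub>R g x))\<^sup>2)
      = (\<lambda>x. a\<^sup>2 * (f x \<bullet> f x) + 2 * a * b * (f x \<bullet> g x) + b\<^sup>2 * (g x \<bullet> g x))"
    unfolding power2_norm_eq_inner
    by (auto simp: inner_add_left inner_add_right inner_commute power2_eq_square algebra_simps)
  moreover have "(\<lambda>x. a *\<^sub>R f x + b *\<^sub>R g x) \<in> borel_measurable (lebesgue_on \<Omega>)"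
    using L2_measurable[OF f] L2_measurable[OF g] by measurable
  ultimately show "(\<lambda>x. a *\<^sub>R f x + b *\<^sub>R g x) \<in> L2 \<Omega>"
    unfolding L2_def by simp
qed

lemmas L2_lincomb = subspace_of_fieldsD[OF subspace_L2]

lemma L2_add: "f \<in> L2 \<Omega> \<Longrightarrow> g \<in> L2 \<Omega> \<Longrightarrow> (\<lambda>x. f x + g x) \<in> L2 \<Omega>"
  using L2_lincomb[of f \<Omega> g 1 1] by simp

lemma L2_diff: "f \<in> L2 \<Omega> \<Longrightarrow> g \<in> L2 \<Omega> \<Longrightarrow> (\<lambda>x. f x - g x) \<in> L2 \<Omega>"
  using L2_lincomb[of f \<Omega> g 1 "-1"] by simp

lemma L2_linear_image:
  fixes T :: "'b::euclidean_space \<Rightarrow> 'c::euclidean_space"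
  assumes T: "bounded_linear T" and f: "f \<in> L2 \<Omega>"
  shows "(\<lambda>x. T (f x)) \<in> L2 \<Omega>"
proof -
  obtain K where K: "K > 0" "\<And>a. norm (T a) \<le> norm a * K"
    using bounded_linear.pos_bounded[OF T] by auto
  have meas: "(\<lambda>x. T (f x)) \<in> borel_measurable (lebesgue_on \<Omega>)"
    using L2_measurable[OF f] by (rule measurable_compose)
      (intro borel_measurable_continuous_onI linear_continuous_on T)
  have "(norm (T (f x)))\<^sup>2 \<le> (norm (f x))\<^sup>2 * K\<^sup>2" for x
    using power_mono[OF K(2)[of "f x"] norm_ge_zero, of 2] by (simp add: power_mult_distrib)
  then have "integrable (lebesgue_on \<Omega>) (\<lambda>x. (norm (T (f x)))\<^sup>2)"
    using meas by (intro Bochner_Integration.integrable_bound[OF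
          Bochner_Integration.integrable_mult_left[OF L2_integrable_power2[OF f], of "K\<^sup>2"]]) auto
  with meas show ?thesis by (simp add: L2_def)
qed

lemma ip_sym: "ip \<Omega> f g = ip \<Omega> g f"
  by (simp add: ip_def inner_commute)

lemma ip_ge_0: "0 \<le> ip \<Omega> f f"
  by (simp add: ip_def)

lemma power2_L2norm: "(L2norm \<Omega> f)\<^sup>2 = ip \<Omega> f f"
  by (simp add: L2norm_def ip_ge_0)

lemma L2norm_ge_0: "0 \<le> L2norm \<Omega> f"
  by (simp add: L2norm_def ip_ge_0)

lemma ip_lincomb_left:
  assumes "f \<in> L2 \<Omega>" "g \<in> L2 \<Omega>" "h \<in> L2 \<Omega>"
  shows "ip \<Omega> (\<lambda>x. a *\<^sub>R f x + b *\<^sub>R g x) h = a * ip \<Omega> f h + b * ip \<Omega> g h"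
  unfolding ip_def inner_add_left inner_scaleR_left using assms
  by (simp add: L2_inner_integrable)

lemma ip_lincomb_right:
  assumes "f \<in> L2 \<Omega>" "g \<in> L2 \<Omega>" "h \<in> L2 \<Omega>"
  shows "ip \<Omega> h (\<lambda>x. a *\<^sub>R f x + b *\<^sub>R g x) = a * ip \<Omega> h f + b * ip \<Omega> h g"
  using ip_lincomb_left[OF assms] by (simp add: ip_sym)

lemma ip_scaleR_left: "ip \<Omega> (\<lambda>x. a *\<^sub>R f x) h = a * ip \<Omega> f h"
  by (simp add: ip_def)

lemma ip_diff_left:
  assumes "f \<in> L2 \<Omega>" "g \<in> L2 \<Omega>" "h \<in> L2 \<Omega>"
  shows "ip \<Omega> (\<lambda>x. f x - g x) h = ip \<Omega> f h - ip \<Omega> g h"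
  using ip_lincomb_left[OF assms, of 1 "-1"] by simp

lemma ip_add_left:
  assumes "f \<in> L2 \<Omega>" "g \<in> L2 \<Omega>" "h \<in> L2 \<Omega>"
  shows "ip \<Omega> (\<lambda>x. f x + g x) h = ip \<Omega> f h + ip \<Omega> g h"
  using ip_lincomb_left[OF assms, of 1 1] by simp

lemma ip_diff_sum_left:
  assumes f: "f \<in> L2 \<Omega>" and h: "h \<in> L2 \<Omega>" and e: "\<And>s. s \<in> A \<Longrightarrow> e s \<in> L2 \<Omega>"
  shows "ip \<Omega> (\<lambda>x. f x - (\<Sum>s\<in>A. c s *\<^sub>R e s x)) h = ip \<Omega> f h - (\<Sum>s\<in>A. c s * ip \<Omega> (e s) h)"
  unfolding ip_def inner_diff_left inner_sum_left inner_scaleR_left using assms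
  by (simp add: L2_inner_integrable)

lemma cauchy_schwarz_L2:
  assumes f: "f \<in> L2 \<Omega>" and g: "g \<in> L2 \<Omega>"
  shows "\<bar>ip \<Omega> f g\<bar> \<le> L2norm \<Omega> f * L2norm \<Omega> g"
proof -
  have q: "0 \<le> t\<^sup>2 * ip \<Omega> f f + 2 * (s * t) * ip \<Omega> f g + s\<^sup>2 * ip \<Omega> g g" for s t
  proof -
    let ?k = "\<lambda>x. t *\<^sub>R f x + s *\<^sub>R g x"
    have "0 \<le> ip \<Omega> ?k ?k" by (rule ip_ge_0)
    also have "ip \<Omega> ?k ?k = t * (t * ip \<Omega> f f + s * ip \<Omega> f g) + s * (t * ip \<Omega> g f + s * ip \<Omega> g g)"
      by (simp only: ip_lincomb_left[OF f g L2_lincomb[OF f g]] ip_lincomb_right[OF f g f]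
          ip_lincomb_right[OF f g g])
    finally show ?thesis by (simp add: ip_sym[of \<Omega> g f] power2_eq_square algebra_simps)
  qed
  let ?a = "ip \<Omega> f f" and ?b = "ip \<Omega> f g" and ?c = "ip \<Omega> g g"
  have "?b\<^sup>2 \<le> ?a * ?c"
  proof (cases "?c = 0")
    case True
    \<comment> \<open>the quadratic form is then affine along \<open>f + s g\<close>, so its slope vanishes\<close>
    have "?b = 0"
    proof (rule ccontr)
      assume b: "?b \<noteq> 0"
      from q[of 1 "- (?a + 1) / (2 * ?b)"] True b show False
        by (simp add: field_simps)
    qed
    with True show ?thesis by simp
  next
    case False
    with ip_ge_0[of \<Omega> g] have c: "?c > 0" by simp
    from q[of "?c" "- ?b"] have "0 \<le> ?c * (?a * ?c - ?b\<^sup>2)"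
      by (simp add: power2_eq_square algebra_simps)
    with c show ?thesis by (simp add: zero_le_mult_iff)
  qed
  then have "sqrt (?b\<^sup>2) \<le> sqrt (?a * ?c)" by (rule real_sqrt_le_mono)
  then show ?thesis by (simp add: L2norm_def real_sqrt_mult)
qed

lemma L2norm_triangle:
  assumes f: "f \<in> L2 \<Omega>" and g: "g \<in> L2 \<Omega>"
  shows "L2norm \<Omega> (\<lambda>x. f x + g x) \<le> L2norm \<Omega> f + L2norm \<Omega> g"
proof (rule power2_le_imp_le)
  have "(L2norm \<Omega> (\<lambda>x. f x + g x))\<^sup>2 = ip \<Omega> f f + 2 * ip \<Omega> f g + ip \<Omega> g g"
    using ip_lincomb_left[OF f g L2_add[OF f g], of 1 1] ip_lincomb_right[OF f g f, of 1 1]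
      ip_lincomb_right[OF f g g, of 1 1]
    by (simp add: power2_L2norm ip_sym[of \<Omega> g f])
  also have "\<dots> \<le> (L2norm \<Omega> f)\<^sup>2 + 2 * (L2norm \<Omega> f * L2norm \<Omega> g) + (L2norm \<Omega> g)\<^sup>2"
    using cauchy_schwarz_L2[OF f g] by (simp add: power2_L2norm)
  finally show "(L2norm \<Omega> (\<lambda>x. f x + g x))\<^sup>2 \<le> (L2norm \<Omega> f + L2norm \<Omega> g)\<^sup>2"
    by (simp add: power2_sum)
qed (simp add: L2norm_ge_0)

lemma L2norm_scaleR: "L2norm \<Omega> (\<lambda>x. a *\<^sub>R f x) = \<bar>a\<bar> * L2norm \<Omega> f"
proof -
  have "ip \<Omega> (\<lambda>x. a *\<^sub>R f x) (\<lambda>x. a *\<^sub>R f x) = a\<^sup>2 * ip \<Omega> f f"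
    by (simp add: ip_def power2_eq_square mult.assoc)
  then show ?thesis by (simp add: L2norm_def real_sqrt_mult)
qed

lemma ip_cong_AE:
  assumes "f \<in> L2 \<Omega>" "f' \<in> L2 \<Omega>" "g \<in> L2 \<Omega>" "AE x in lebesgue_on \<Omega>. f x = f' x"
  shows "ip \<Omega> f g = ip \<Omega> f' g"
  unfolding ip_def using assms
  by (intro integral_cong_AE borel_measurable_integrable L2_inner_integrable) auto

lemma L2norm_cong_AE:
  assumes "f \<in> L2 \<Omega>" "f' \<in> L2 \<Omega>" "AE x in lebesgue_on \<Omega>. f x = f' x"
  shows "L2norm \<Omega> f = L2norm \<Omega> f'"
  unfolding L2norm_def
  using ip_cong_AE[OF assms(1,2,1,3)] ip_cong_AE[OF assms(1,2,2,3)] ip_sym[of \<Omega> f' f] by simp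

lemma AE_eq_0_if_ip_eq_0:
  assumes f: "f \<in> L2 \<Omega>" and "ip \<Omega> f f = 0"
  shows "AE x in lebesgue_on \<Omega>. f x = 0"
proof -
  have "AE x in lebesgue_on \<Omega>. f x \<bullet> f x = 0"
    using assms integral_nonneg_eq_0_iff_AE[OF L2_inner_integrable[OF f f]] by (simp add: ip_def)
  then show ?thesis by simp
qed

lemma ip_eq_0_if_AE_eq_0: "AE x in lebesgue_on \<Omega>. f x = 0 \<Longrightarrow> ip \<Omega> f g = 0"
  unfolding ip_def by (rule integral_eq_zero_AE) auto

lemma bounded_field_L2:
  fixes f :: "real^'n \<Rightarrow> 'b::euclidean_space"
  assumes \<Omega>: "\<Omega> \<in> lmeasurable" and m: "f \<in> borel_measurable (lebesgue_on \<Omega>)"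
    and b: "AE x in lebesgue_on \<Omega>. norm (f x) \<le> M"
  shows "f \<in> L2 \<Omega>"
proof -
  have "integrable (lebesgue_on \<Omega>) (\<lambda>x. (norm (f x))\<^sup>2)"
  proof (rule Bochner_Integration.integrable_bound[where f = "\<lambda>_. M\<^sup>2"])
    show "integrable (lebesgue_on \<Omega>) (\<lambda>_. M\<^sup>2)"
      using \<Omega> by (simp add: finite_measure.integrable_const finite_measure_lebesgue_on)
    show "AE x in lebesgue_on \<Omega>. norm ((norm (f x))\<^sup>2) \<le> norm (M\<^sup>2)"
      using b by eventually_elim (simp add: power_mono)
  qed (use m in measurable)
  with m show ?thesis by (simp add: L2_def)
qed

text \<open>A product of two square-integrable fields need not be square-integrable; here one factor is
  bounded, as every piecewise polynomial is.\<close>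

lemma L2_product_bounded:
  fixes f :: "real^'n \<Rightarrow> 'b::euclidean_space" and g :: "real^'n \<Rightarrow> 'c::euclidean_space"
    and P :: "'b \<Rightarrow> 'c \<Rightarrow> 'd::euclidean_space"
  assumes P: "bounded_bilinear P" and f: "f \<in> L2 \<Omega>" and g: "g \<in> L2 \<Omega>"
    and b: "AE x in lebesgue_on \<Omega>. norm (g x) \<le> M"
  shows "(\<lambda>x. P (f x) (g x)) \<in> L2 \<Omega>"
proof -
  obtain K where K: "K > 0" "\<And>a b. norm (P a b) \<le> norm a * norm b * K"
    using bounded_bilinear.pos_bounded[OF P] by auto
  have meas: "(\<lambda>x. P (f x) (g x)) \<in> borel_measurable (lebesgue_on \<Omega>)"
    by (rule borel_measurable_integrable[OF L2_product_integrable[OF P f g]])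
  have "integrable (lebesgue_on \<Omega>) (\<lambda>x. (norm (P (f x) (g x)))\<^sup>2)"
  proof (rule Bochner_Integration.integrable_bound)
    show "integrable (lebesgue_on \<Omega>) (\<lambda>x. (norm (f x))\<^sup>2 * (M * K)\<^sup>2)"
      by (intro Bochner_Integration.integrable_mult_left L2_integrable_power2[OF f])
    show "AE x in lebesgue_on \<Omega>. norm ((norm (P (f x) (g x)))\<^sup>2) \<le> norm ((norm (f x))\<^sup>2 * (M * K)\<^sup>2)"
      using b
    proof eventually_elim
      case (elim x)
      have "norm (P (f x) (g x)) \<le> norm (f x) * (norm (g x) * K)"
        using K(2)[of "f x" "g x"] by (simp add: mult_ac)
      also have "\<dots> \<le> norm (f x) * (M * K)"
        using elim K(1) by (intro mult_left_mono mult_right_mono) auto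
      finally have "(norm (P (f x) (g x)))\<^sup>2 \<le> (norm (f x) * (M * K))\<^sup>2"
        by (intro power_mono) auto
      then show ?case by (simp add: power_mult_distrib)
    qed
  qed (use meas in measurable)
  with meas show ?thesis by (simp add: L2_def)
qed

section \<open>Smooth functions\<close>

lemma partial_deriv_eq:
  "(f has_derivative f') (at x) \<Longrightarrow> partial_deriv j f x = f' (axis j 1)"
  unfolding partial_deriv_def by (metis frechet_derivative_at)

text \<open>Smoothness is coinductive: it suffices to find the function in a family of differentiable
  functions that is closed under partial differentiation.\<close>

lemma smooth_coinduct:
  assumes f: "f \<in> F"
    and F: "\<And>g x. g \<in> F \<Longrightarrow> g differentiable (at x)" "\<And>g j. g \<in> F \<Longrightarrow> partial_deriv j g \<in> F"
  shows "smooth f"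
proof -
  have "foldr partial_deriv js f \<in> F" for js
    using f F(2) by (induction js) auto
  with F(1) show ?thesis by (auto simp: smooth_def)
qed

lemma smooth_differentiable: "smooth f \<Longrightarrow> f differentiable (at x)"
  unfolding smooth_def by (metis foldr_Nil id_apply)

lemma smooth_has_derivative: "smooth f \<Longrightarrow> (f has_derivative frechet_derivative f (at x)) (at x)"
  using smooth_differentiable frechet_derivative_works by blast

lemma smooth_partial_deriv:
  assumes "smooth f" shows "smooth (partial_deriv j f)"
  unfolding smooth_def
proof (intro allI)
  fix js x
  have "foldr partial_deriv (js @ [j]) f differentiable (at x)"
    using assms unfolding smooth_def by blast
  then show "foldr partial_deriv js (partial_deriv j f) differentiable (at x)" by simp
qed

lemma smooth_continuous_on: "smooth f \<Longrightarrow> continuous_on S f"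
  by (meson differentiable_at_withinI differentiable_imp_continuous_on differentiable_on_def
      smooth_differentiable)

lemma partial_deriv_linear_image:
  assumes "bounded_linear T" "f differentiable (at x)"
  shows "partial_deriv j (\<lambda>x. T (f x)) x = T (partial_deriv j f x)"
  using partial_deriv_eq[OF bounded_linear.has_derivative[OF assms(1) assms(2)[unfolded frechet_derivative_works]]]
  by (simp add: partial_deriv_def)

lemma partial_deriv_add:
  assumes "f differentiable (at x)" "g differentiable (at x)"
  shows "partial_deriv j (\<lambda>x. f x + g x) x = partial_deriv j f x + partial_deriv j g x"
  using partial_deriv_eq[OF has_derivative_add[OF assms[unfolded frechet_derivative_works]]]
  by (simp add: partial_deriv_def)

lemma partial_deriv_bilinear:
  assumes "bounded_bilinear P" "f differentiable (at x)" "g differentiable (at x)"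
  shows "partial_deriv j (\<lambda>x. P (f x) (g x)) x = P (partial_deriv j f x) (g x) + P (f x) (partial_deriv j g x)"
  using partial_deriv_eq[OF bounded_bilinear.FDERIV[OF assms(1) assms(2,3)[unfolded frechet_derivative_works]]]
  by (simp add: partial_deriv_def add.commute)

lemma smooth_linear_image:
  fixes f :: "real^'n \<Rightarrow> 'b::real_normed_vector" and T :: "'b \<Rightarrow> 'c::real_normed_vector"
  assumes T: "bounded_linear T" and f: "smooth f"
  shows "smooth (\<lambda>x. T (f x))"
proof (rule smooth_coinduct[where F = "{\<lambda>x. T (h x) |h. smooth h}"])
  fix g :: "real^'n \<Rightarrow> 'c" and x assume "g \<in> {\<lambda>x. T (h x) |h. smooth h}"
  then show "g differentiable (at x)"
    using bounded_linear.has_derivative[OF T] smooth_has_derivative unfolding differentiable_def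
    by blast
next
  fix g :: "real^'n \<Rightarrow> 'c" and j assume "g \<in> {\<lambda>x. T (h x) |h. smooth h}"
  then obtain h where h: "g = (\<lambda>x. T (h x))" "smooth h" by auto
  then have "partial_deriv j g = (\<lambda>x. T (partial_deriv j h x))"
    using partial_deriv_linear_image[OF T smooth_differentiable] by auto
  with h smooth_partial_deriv show "partial_deriv j g \<in> {\<lambda>x. T (h x) |h. smooth h}" by blast
qed (use f in blast)

lemma smooth_add:
  fixes f g :: "real^'n \<Rightarrow> 'b::real_normed_vector"
  assumes "smooth f" "smooth g"
  shows "smooth (\<lambda>x. f x + g x)"
proof (rule smooth_coinduct[where F = "{\<lambda>x. f x + g x |f g. smooth f \<and> smooth g}"])
  fix h :: "real^'n \<Rightarrow> 'b" and x assume "h \<in> {\<lambda>x. f x + g x |f g. smooth f \<and> smooth g}"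
  then show "h differentiable (at x)"
    using smooth_differentiable by (auto intro!: derivative_intros)
next
  fix h :: "real^'n \<Rightarrow> 'b" and j assume "h \<in> {\<lambda>x. f x + g x |f g. smooth f \<and> smooth g}"
  then obtain f g where f: "h = (\<lambda>x. f x + g x)" "smooth f" "smooth g" by auto
  have "partial_deriv j h = (\<lambda>x. partial_deriv j f x + partial_deriv j g x)"
    unfolding f(1) using f(2,3) by (intro ext partial_deriv_add smooth_differentiable)
  with f smooth_partial_deriv
  show "partial_deriv j h \<in> {\<lambda>x. f x + g x |f g. smooth f \<and> smooth g}" by blast
qed (use assms in blast)

lemma partial_deriv_const: "partial_deriv j (\<lambda>x. c) x = 0"
  by (subst partial_deriv_eq[OF has_derivative_const]) simp

lemma smooth_const: "smooth (\<lambda>x. c)"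
  by (rule smooth_coinduct[where F = "{\<lambda>x. c |c. True}"])
    (auto simp: partial_deriv_const[abs_def])

lemma smooth_sum: "(\<And>s. s \<in> A \<Longrightarrow> smooth (f s)) \<Longrightarrow> smooth (\<lambda>x. \<Sum>s\<in>A. f s x)"
  by (induction A rule: infinite_finite_induct) (auto intro: smooth_const smooth_add)

lemma smooth_lincomb: "smooth f \<Longrightarrow> smooth g \<Longrightarrow> smooth (\<lambda>x. a *\<^sub>R f x + b *\<^sub>R g x)"
  by (rule smooth_add; rule smooth_linear_image[OF bounded_linear_scaleR_right])

lemma grad_conv_sum: "grad f x = (\<Sum>j\<in>UNIV. axis j (partial_deriv j f x))"
  by (simp add: vec_eq_iff grad_def axis_def if_distrib cong: if_cong)

lemma norm_axis: "norm (axis j x :: 'b::real_normed_vector^'n) = norm x"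
proof -
  have "(\<Sum>i\<in>UNIV. (norm (axis j x $ i))\<^sup>2) = (\<Sum>i\<in>UNIV. if i = j then (norm x)\<^sup>2 else 0)"
    by (rule sum.cong) (auto simp: axis_def)
  then show ?thesis by (simp add: norm_vec_def L2_set_def)
qed

lemma bounded_linear_axis: "bounded_linear (axis j :: 'b::real_normed_vector \<Rightarrow> 'b^'n)"
proof (rule bounded_linear_intro[where K = 1])
  show "norm (axis j x :: 'b^'n) \<le> norm x * 1" for x :: 'b
    by (simp add: norm_axis)
qed (simp_all add: axis_def vec_eq_iff)

lemma smooth_grad: "smooth f \<Longrightarrow> smooth (grad f)"
  unfolding grad_conv_sum[abs_def]
  by (intro smooth_sum smooth_linear_image[OF bounded_linear_axis] smooth_partial_deriv)

lemma grad_lincomb: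
  "smooth f \<Longrightarrow> smooth g \<Longrightarrow> grad (\<lambda>x. a *\<^sub>R f x + b *\<^sub>R g x) x = a *\<^sub>R grad f x + b *\<^sub>R grad g x"
  by (simp add: vec_eq_iff grad_def partial_deriv_add smooth_differentiable smooth_linear_image
      bounded_linear_scaleR_right partial_deriv_linear_image[OF bounded_linear_scaleR_right])

lemma norm_partial_deriv_le_grad: "norm (partial_deriv j f x) \<le> norm (grad f x)"
  using Finite_Cartesian_Product.norm_nth_le[of "grad f x" j] by (simp add: grad_def)

lemma has_derivative_along_axis:
  fixes g :: "real^'n \<Rightarrow> real"
  assumes "g differentiable (at (y + t *\<^sub>R axis k 1))"
  shows "((\<lambda>t. g (y + t *\<^sub>R axis k 1)) has_real_derivative partial_deriv k g (y + t *\<^sub>R axis k 1)) (at t)"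
proof -
  note g = assms[unfolded frechet_derivative_works]
  have "((\<lambda>t. y + t *\<^sub>R axis k (1::real)) has_derivative (\<lambda>h. h *\<^sub>R axis k 1)) (at t)"
    by (auto intro!: derivative_eq_intros)
  from has_derivative_compose[OF this g]
  moreover have "frechet_derivative g (at (y + t *\<^sub>R axis k 1)) (h *\<^sub>R axis k 1)
      = partial_deriv k g (y + t *\<^sub>R axis k 1) * h" for h
    using linear_scale[OF has_derivative_linear[OF g]] by (simp add: partial_deriv_def)
  ultimately show ?thesis
    by (simp add: has_field_derivative_def)
qed

text \<open>Partial derivatives commute because the double difference quotient in two coordinate directions
  is a mixed second derivative at a nearby point, for either order of differentiation.\<close>

lemma double_difference:
  fixes f :: "real^'n \<Rightarrow> real"
  assumes f: "smooth f" and s: "0 < s"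
  obtains a b where "0 < a" "a < s" "0 < b" "b < s"
    "f (x + s *\<^sub>R axis i 1 + s *\<^sub>R axis j 1) - f (x + s *\<^sub>R axis i 1) - f (x + s *\<^sub>R axis j 1) + f x
      = s * s * partial_deriv j (partial_deriv i f) (x + a *\<^sub>R axis i 1 + b *\<^sub>R axis j 1)"
proof -
  define G where "G t = f ((x + s *\<^sub>R axis j 1) + t *\<^sub>R axis i 1) - f (x + t *\<^sub>R axis i 1)" for t
  have "\<exists>a. 0 < a \<and> a < s \<and> G s - G 0 = (s - 0) *
      (partial_deriv i f ((x + s *\<^sub>R axis j 1) + a *\<^sub>R axis i 1) - partial_deriv i f (x + a *\<^sub>R axis i 1))"
    unfolding G_def by (rule MVT2[OF s]) (intro DERIV_diff has_derivative_along_axis smooth_differentiable f)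
  then obtain a where a: "0 < a" "a < s" and Ga: "G s - G 0 = s *
      (partial_deriv i f ((x + s *\<^sub>R axis j 1) + a *\<^sub>R axis i 1) - partial_deriv i f (x + a *\<^sub>R axis i 1))"
    by auto
  have "\<exists>b. 0 < b \<and> b < s \<and>
      partial_deriv i f ((x + a *\<^sub>R axis i 1) + s *\<^sub>R axis j 1) - partial_deriv i f ((x + a *\<^sub>R axis i 1) + 0 *\<^sub>R axis j 1)
      = (s - 0) * partial_deriv j (partial_deriv i f) ((x + a *\<^sub>R axis i 1) + b *\<^sub>R axis j 1)"
    by (rule MVT2[OF s]) (intro has_derivative_along_axis smooth_differentiable smooth_partial_deriv f)
  then obtain b where b: "0 < b" "b < s" and Gb:
      "partial_deriv i f ((x + a *\<^sub>R axis i 1) + s *\<^sub>R axis j 1) - partial_deriv i f (x + a *\<^sub>R axis i 1)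
      = s * partial_deriv j (partial_deriv i f) ((x + a *\<^sub>R axis i 1) + b *\<^sub>R axis j 1)"
    by auto
  show ?thesis
    using that[OF a b] Ga Gb by (simp add: G_def add.assoc add.commute add.left_commute)
qed

lemma partial_deriv_commute_real:
  fixes f :: "real^'n \<Rightarrow> real"
  assumes f: "smooth f"
  shows "partial_deriv j (partial_deriv i f) x = partial_deriv i (partial_deriv j f) x"
proof -
  define s where "s n = 1 / real (Suc n)" for n
  have s: "0 < s n" for n by (simp add: s_def)
  have s0: "s \<longlonglongrightarrow> 0" unfolding s_def by (rule LIMSEQ_Suc[OF lim_1_over_n])
  define \<Delta> where "\<Delta> i j n = f (x + s n *\<^sub>R axis i 1 + s n *\<^sub>R axis j 1) - f (x + s n *\<^sub>R axis i 1)
    - f (x + s n *\<^sub>R axis j 1) + f x" for i j n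
  have lim: "(\<lambda>n. \<Delta> i j n / (s n * s n)) \<longlonglongrightarrow> partial_deriv j (partial_deriv i f) x" for i j
  proof -
    have "\<exists>y. norm (y - x) \<le> 2 * s n \<and> \<Delta> i j n = s n * s n * partial_deriv j (partial_deriv i f) y" for n
    proof -
      obtain a b where ab: "0 < a" "a < s n" "0 < b" "b < s n"
        "\<Delta> i j n = s n * s n * partial_deriv j (partial_deriv i f) (x + a *\<^sub>R axis i 1 + b *\<^sub>R axis j 1)"
        using double_difference[OF f s, of n x i j] unfolding \<Delta>_def by blast
      have "norm (a *\<^sub>R axis i 1 + b *\<^sub>R axis j 1 :: real^'n) \<le> 2 * s n"
        using ab by (intro norm_triangle_le) (simp add: norm_axis)
      with ab(5) show ?thesis
        by (intro exI[of _ "x + a *\<^sub>R axis i 1 + b *\<^sub>R axis j 1"]) (simp add: algebra_simps)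
    qed
    then obtain y where y: "\<And>n. norm (y n - x) \<le> 2 * s n"
      "\<And>n. \<Delta> i j n = s n * s n * partial_deriv j (partial_deriv i f) (y n)" by metis
    have s2: "(\<lambda>n. 2 * s n) \<longlonglongrightarrow> 0"
      using tendsto_mult[OF tendsto_const s0, of 2] by simp
    have "(\<lambda>n. y n - x) \<longlonglongrightarrow> 0"
      by (rule Lim_null_comparison[OF always_eventually s2]) (rule allI, rule y(1))
    then have "y \<longlonglongrightarrow> x" by (simp add: LIM_zero_iff)
    moreover have "isCont (partial_deriv j (partial_deriv i f)) x"
      using smooth_continuous_on[OF smooth_partial_deriv[OF smooth_partial_deriv[OF f]], of UNIV]
      by (simp add: continuous_on_eq_continuous_at)
    ultimately have "(\<lambda>n. partial_deriv j (partial_deriv i f) (y n)) \<longlonglongrightarrow> partial_deriv j (partial_deriv i f) x"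
      by (rule isCont_tendsto_compose[rotated])
    then show ?thesis using s by (simp add: y(2) less_imp_neq[symmetric])
  qed
  have "\<Delta> i j n = \<Delta> j i n" for n by (simp add: \<Delta>_def algebra_simps)
  with lim[of i j] lim[of j i] show ?thesis
    by (metis (no_types, lifting) LIMSEQ_unique ext)
qed

section \<open>Bump functions\<close>

text \<open>Differentiating \<open>exp (- 1 / t)\<close> produces polynomials in \<open>1 / t\<close> as factors; with them the
  family is closed under differentiation, also at \<open>0\<close>, where the exponential decay dominates.\<close>

definition flat :: "real poly \<Rightarrow> real \<Rightarrow> real" where
  "flat P t = (if 0 < t then poly P (1 / t) * exp (- (1 / t)) else 0)"

definition flat_deriv :: "real poly \<Rightarrow> real poly" where
  "flat_deriv P = monom 1 2 * (P - pderiv P)"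

lemma poly_times_exp_minus_tendsto_0: "((\<lambda>y. poly P y * exp (- y)) \<longlongrightarrow> 0) (at_top :: real filter)"
proof -
  have "((\<lambda>y. \<Sum>i\<le>degree P. coeff P i * (y ^ i / exp y)) \<longlongrightarrow> (\<Sum>i\<le>degree P. coeff P i * 0)) (at_top :: real filter)"
    by (intro tendsto_sum tendsto_mult tendsto_const tendsto_power_div_exp_0)
  then show ?thesis
    by (simp add: poly_altdef sum_distrib_right exp_minus divide_inverse mult.assoc)
qed

lemma flat_has_derivative: "(flat P has_real_derivative flat (flat_deriv P) t) (at t)"
proof -
  consider "0 < t" | "t < 0" | "t = 0" by linarith
  then show ?thesis
  proof cases
    case 1
    have "((\<lambda>t. poly P (1 / t) * exp (- (1 / t))) has_real_derivative flat (flat_deriv P) t) (at t)"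
      using 1 by (auto intro!: derivative_eq_intros DERIV_chain'[OF _ poly_DERIV]
          simp: flat_def flat_deriv_def poly_monom power2_eq_square field_simps)
    then show ?thesis
      using 1 by (elim has_field_derivative_transform_within_open[where S = "{0<..}"]) (auto simp: flat_def)
  next
    case 2
    have "((\<lambda>t. 0) has_real_derivative flat (flat_deriv P) t) (at t)"
      using 2 by (simp add: flat_def)
    then show ?thesis
      using 2 by (elim has_field_derivative_transform_within_open[where S = "{..<0}"]) (auto simp: flat_def)
  next
    case 3
    have r: "((\<lambda>h. flat P h / h) \<longlongrightarrow> 0) (at_right 0)"
    proof -
      have "((\<lambda>h. poly (pCons 0 P) (inverse h) * exp (- inverse h)) \<longlongrightarrow> 0) (at_right 0)"
        by (rule filterlim_compose[OF poly_times_exp_minus_tendsto_0 filterlim_inverse_at_top_right])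
      moreover have "\<forall>\<^sub>F h in at_right 0. poly (pCons 0 P) (inverse h) * exp (- inverse h) = flat P h / h"
        unfolding eventually_at_right_field by (rule exI[of _ 1]) (auto simp: flat_def field_simps)
      ultimately show ?thesis by (rule Lim_transform_eventually)
    qed
    have l: "((\<lambda>h. flat P h / h) \<longlongrightarrow> 0) (at_left 0)"
    proof (rule Lim_transform_eventually[OF tendsto_const])
      show "\<forall>\<^sub>F h in at_left 0. 0 = flat P h / h"
        unfolding eventually_at_left_field by (rule exI[of _ "-1"]) (auto simp: flat_def)
    qed
    have "((\<lambda>h. (flat P h - flat P 0) / h) \<longlongrightarrow> 0) (at 0)"
      using filterlim_split_at[OF l r] by (simp add: flat_def)
    then show ?thesis using 3 by (simp add: has_field_derivative_iff flat_def)
  qed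
qed

inductive_set flat_algebra :: "(real^'n \<Rightarrow> real) set" where
  base: "(\<lambda>x. flat P (s * x $ i + c)) \<in> flat_algebra"
| const: "(\<lambda>x. c) \<in> flat_algebra"
| add: "f \<in> flat_algebra \<Longrightarrow> g \<in> flat_algebra \<Longrightarrow> (\<lambda>x. f x + g x) \<in> flat_algebra"
| mult: "f \<in> flat_algebra \<Longrightarrow> g \<in> flat_algebra \<Longrightarrow> (\<lambda>x. f x * g x) \<in> flat_algebra"

lemma flat_algebra_deriv:
  fixes f :: "real^'n \<Rightarrow> real"
  assumes "f \<in> flat_algebra"
  shows "(\<forall>x. f differentiable (at x)) \<and> (\<forall>j. partial_deriv j f \<in> flat_algebra)"
  using assms
proof induction
  case (base P s i c)
  have D: "((\<lambda>x. flat P (s * x $ i + c)) has_derivative (\<lambda>h. flat (flat_deriv P) (s * x $ i + c) * (s * h $ i))) (at x)" for x :: "real^'n"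
  proof -
    have 1: "((\<lambda>x. s * x $ i + c) has_derivative (\<lambda>h. s * h $ i)) (at x)"
      by (auto intro!: derivative_eq_intros bounded_linear.has_derivative[OF bounded_linear_vec_nth])
    have 2: "(flat P has_derivative (\<lambda>h. flat (flat_deriv P) (s * x $ i + c) * h)) (at (s * x $ i + c))"
      using flat_has_derivative[of P "s * x $ i + c"] by (simp add: has_field_derivative_def)
    show ?thesis by (rule has_derivative_compose[OF 1 2])
  qed
  have "partial_deriv j (\<lambda>x::real^'n. flat P (s * x $ i + c))
      = (\<lambda>x. flat (smult (if i = j then s else 0) (flat_deriv P)) (s * x $ i + c))" for j
    unfolding partial_deriv_eq[OF D] fun_eq_iff by (simp add: flat_def axis_def)
  with D show ?case by (auto simp: differentiable_def intro: flat_algebra.base)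
next
  case (const c)
  have "partial_deriv j (\<lambda>x::real^'n. c) = (\<lambda>x. 0)" for j
    by (simp add: partial_deriv_const fun_eq_iff)
  then show ?case by (auto intro: flat_algebra.const)
next
  case (add f g)
  then have "partial_deriv j (\<lambda>x. f x + g x) = (\<lambda>x. partial_deriv j f x + partial_deriv j g x)" for j
    by (simp add: partial_deriv_add fun_eq_iff)
  with add show ?case by (auto intro: flat_algebra.add)
next
  case (mult f g)
  then have "partial_deriv j (\<lambda>x. f x * g x) = (\<lambda>x. partial_deriv j f x * g x + f x * partial_deriv j g x)" for j
    by (simp add: partial_deriv_bilinear[OF bounded_bilinear_mult] fun_eq_iff)
  with mult show ?case by (auto intro!: flat_algebra.add flat_algebra.mult differentiable_mult)
qed

lemma flat_algebra_smooth: "f \<in> flat_algebra \<Longrightarrow> smooth f"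
  using flat_algebra_deriv by (blast intro: smooth_coinduct[of f flat_algebra])

lemma flat_algebra_prod: "(\<And>i. i \<in> A \<Longrightarrow> f i \<in> flat_algebra) \<Longrightarrow> (\<lambda>x. \<Prod>i\<in>A. f i x) \<in> flat_algebra"
  by (induction A rule: infinite_finite_induct) (auto intro: flat_algebra.const flat_algebra.mult)

text \<open>As \<open>m\<close> grows, these test functions increase to the indicator function of the open box.\<close>

definition bump :: "real^'n \<Rightarrow> real^'n \<Rightarrow> nat \<Rightarrow> real^'n \<Rightarrow> real" where
  "bump a b m x = (\<Prod>i\<in>UNIV. flat 1 (real (Suc m) * (x $ i - a $ i)) * flat 1 (real (Suc m) * (b $ i - x $ i)))"

lemma bump_eq_0: "x \<notin> box a b \<Longrightarrow> bump a b m x = 0"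
  unfolding bump_def by (auto simp: mem_box_cart flat_def not_less zero_less_mult_iff
      intro!: prod_zero dest: leD)

lemma smooth_bump: "smooth (bump a b m)"
proof (rule flat_algebra_smooth)
  have "(\<lambda>x. \<Prod>i\<in>UNIV. flat 1 (real (Suc m) * x $ i + (- real (Suc m) * a $ i))
      * flat 1 (- real (Suc m) * x $ i + real (Suc m) * b $ i)) \<in> flat_algebra"
    by (intro flat_algebra_prod flat_algebra.mult flat_algebra.base)
  then show "bump a b m \<in> flat_algebra"
    unfolding bump_def[abs_def] by (simp add: algebra_simps)
qed

lemma bump_test_function:
  assumes "cbox a b \<subseteq> U"
  shows "bump a b m \<in> test_functions U"
proof -
  have "closure {x. bump a b m x \<noteq> 0} \<subseteq> cbox a b"
    using bump_eq_0[of _ a b m] box_subset_cbox by (intro closure_minimal) auto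
  with assms show ?thesis
    by (auto simp: test_functions_def smooth_bump intro: compact_closure[THEN iffD2]
        bounded_subset[OF bounded_cbox] bounded_subset[OF _ closure_subset])
qed

lemma abs_bump_le_1: "\<bar>bump a b m x\<bar> \<le> 1"
proof -
  have "0 \<le> flat 1 t" "flat 1 t \<le> 1" for t by (auto simp: flat_def)
  then show ?thesis
    unfolding bump_def abs_prod by (intro prod_le_1) (auto simp: abs_mult mult_le_one)
qed

lemma bump_tendsto_indicator: "(\<lambda>m. bump a b m (x::real^'n)) \<longlonglongrightarrow> indicator (box a b) x"
proof (cases "x \<in> box a b")
  case True
  have lim: "(\<lambda>m. flat 1 (real (Suc m) * t)) \<longlonglongrightarrow> 1" if "0 < t" for t
  proof -
    have "(\<lambda>m. exp (- (1 / real (Suc m) * (1 / t)))) \<longlonglongrightarrow> exp (- (0 * (1 / t)))"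
      by (intro tendsto_intros LIMSEQ_Suc[OF lim_1_over_n])
    then show ?thesis using that by (simp add: flat_def)
  qed
  have "(\<lambda>m. bump a b m x) \<longlonglongrightarrow> (\<Prod>i\<in>(UNIV :: 'n set). 1 * 1)"
    unfolding bump_def using True by (intro tendsto_prod tendsto_mult lim) (auto simp: mem_box_cart)
  with True show ?thesis by simp
qed (simp add: bump_eq_0)

section \<open>The fundamental lemma of the calculus of variations\<close>

text \<open>The positive and the negative part of the function are densities of measures that agree on the
  intersection-stable family of boxes, hence everywhere.\<close>

lemma AE_eq_0_if_box_integrals_eq_0:
  fixes g :: "'a::euclidean_space \<Rightarrow> real"
  assumes g: "integrable lborel g" and 0: "\<And>c d. (\<integral>x. indicator (box c d) x * g x \<partial>lborel) = 0"
  shows "AE x in lborel. g x = 0"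
proof -
  define M where "M f = density lborel (\<lambda>x. ennreal (f x))" for f :: "'a \<Rightarrow> real"
  have [measurable]: "g \<in> borel_measurable borel"
    using borel_measurable_integrable[OF g] by simp
  have bi: "integrable lborel (\<lambda>x. indicator (box c d) x * max 0 (s * g x))" for c d and s :: real
  proof -
    have "integrable lborel (\<lambda>x. max 0 (s * g x))" using g by (intro integrable_max) auto
    from integrable_mult_indicator[OF _ this, of "box c d"] show ?thesis by simp
  qed
  have emb: "emeasure (M (\<lambda>x. s * g x)) (box c d) = ennreal (\<integral>x. indicator (box c d) x * max 0 (s * g x) \<partial>lborel)"
    for c d and s :: real
  proof -
    have "emeasure (M (\<lambda>x. s * g x)) (box c d) = (\<integral>\<^sup>+x. ennreal (indicator (box c d) x * max 0 (s * g x)) \<partial>lborel)"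
      unfolding M_def by (subst emeasure_density)
        (auto intro!: nn_integral_cong split: split_indicator simp: ennreal_mult' max_def ennreal_neg)
    also have "\<dots> = ennreal (\<integral>x. indicator (box c d) x * max 0 (s * g x) \<partial>lborel)"
      by (rule nn_integral_eq_integral[OF bi]) auto
    finally show ?thesis .
  qed
  have "M (\<lambda>x. 1 * g x) = M (\<lambda>x. -1 * g x)"
  proof (rule measure_eqI_generator_eq)
    let ?E = "range (\<lambda>(a, b). box a b::'a set)"
    show "Int_stable ?E" by (auto simp: Int_stable_def box_Int_box)
    show "?E \<subseteq> Pow UNIV" "sets (M (\<lambda>x. 1 * g x)) = sigma_sets UNIV ?E"
      "sets (M (\<lambda>x. -1 * g x)) = sigma_sets UNIV ?E"
      by (simp_all add: borel_eq_box M_def)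
    let ?A = "\<lambda>n::nat. box (- (real n *\<^sub>R One)) (real n *\<^sub>R One) :: 'a set"
    show "range ?A \<subseteq> ?E" "(\<Union>i. ?A i) = UNIV"
      unfolding UN_box_eq_UNIV by auto
    show "emeasure (M (\<lambda>x. 1 * g x)) (?A i) \<noteq> \<infinity>" for i
      unfolding emb by simp
    fix X assume "X \<in> ?E"
    then obtain c d where X: "X = box c d" by auto
    have "(\<integral>x. indicator (box c d) x * max 0 (1 * g x) \<partial>lborel)
        - (\<integral>x. indicator (box c d) x * max 0 (-1 * g x) \<partial>lborel)
        = (\<integral>x. indicator (box c d) x * max 0 (1 * g x) - indicator (box c d) x * max 0 (-1 * g x) \<partial>lborel)"
      using bi by (intro Bochner_Integration.integral_diff[symmetric])
    also have "\<dots> = (\<integral>x. indicator (box c d) x * g x \<partial>lborel)"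
      by (rule Bochner_Integration.integral_cong) (auto simp: max_def split: split_indicator)
    finally show "emeasure (M (\<lambda>x. 1 * g x)) X = emeasure (M (\<lambda>x. -1 * g x)) X"
      unfolding X emb by (simp add: 0)
  qed
  then have "AE x in lborel. ennreal (g x) = ennreal (- g x)"
    unfolding M_def by (subst sigma_finite_measure.density_unique_iff[OF sigma_finite_lborel, symmetric]) auto
  then show ?thesis
  proof eventually_elim
    case (elim x)
    then show ?case
      using ennreal_eq_0_iff[of "g x"] ennreal_eq_0_iff[of "- g x"] by (cases "0 \<le> g x") auto
  qed
qed

text \<open>Bump functions converge boundedly to indicators of boxes, so the integral over every box inside
  \<open>U\<close> vanishes. Since boxes that leave \<open>U\<close> are out of reach, the function is first cut off to one
  closed box in \<open>U\<close>; countably many of these cover \<open>U\<close>.\<close>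

lemma fundamental_lemma_real:
  fixes g :: "real^'n \<Rightarrow> real"
  assumes U: "open U" and g: "integrable (lebesgue_on U) g"
    and 0: "\<And>\<phi>. \<phi> \<in> test_functions U \<Longrightarrow> (\<integral>x. \<phi> x * g x \<partial>lebesgue_on U) = 0"
  shows "AE x in lebesgue_on U. g x = 0"
proof -
  have Um: "U \<in> sets lebesgue" using U by auto
  have box0: "(\<integral>x. indicator (box a b) x * g x \<partial>lebesgue_on U) = 0" if "cbox a b \<subseteq> U" for a b
  proof -
    have "(\<lambda>m. \<integral>x. bump a b m x * g x \<partial>lebesgue_on U) \<longlonglongrightarrow> (\<integral>x. indicator (box a b) x * g x \<partial>lebesgue_on U)"
    proof (rule integral_dominated_convergence[where w = "\<lambda>x. \<bar>g x\<bar>"])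
      have gm: "g \<in> borel_measurable (lebesgue_on U)" using g by auto
      have "bump a b m \<in> borel_measurable (lebesgue_on U)" for m
        using smooth_continuous_on[OF smooth_bump] Um by (rule continuous_imp_measurable_on_sets_lebesgue)
      then show "(\<lambda>x. bump a b m x * g x) \<in> borel_measurable (lebesgue_on U)" for m
        using gm by (rule borel_measurable_times)
      have "(indicator (box a b) :: real^'n \<Rightarrow> real) \<in> borel_measurable (lebesgue_on U)"
        by (intro measurable_restrict_space1 borel_measurable_indicator) auto
      then show "(\<lambda>x. indicator (box a b) x * g x) \<in> borel_measurable (lebesgue_on U)"
        using gm by (rule borel_measurable_times)
      show "integrable (lebesgue_on U) (\<lambda>x. \<bar>g x\<bar>)" using g by simp
      show "AE x in lebesgue_on U. (\<lambda>m. bump a b m x * g x) \<longlonglongrightarrow> indicator (box a b) x * g x"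
        by (intro always_eventually allI tendsto_mult bump_tendsto_indicator tendsto_const)
      show "AE x in lebesgue_on U. norm (bump a b m x * g x) \<le> \<bar>g x\<bar>" for m
        by (simp add: abs_mult mult_left_le_one_le abs_bump_le_1)
    qed
    moreover have "(\<integral>x. bump a b m x * g x \<partial>lebesgue_on U) = 0" for m
      by (rule 0[OF bump_test_function[OF that]])
    ultimately show ?thesis by (simp add: LIMSEQ_const_iff)
  qed
  have ae: "AE x in lebesgue. x \<in> cbox a b \<longrightarrow> g x = 0" if ab: "cbox a b \<subseteq> U" for a b
  proof -
    define h where "h x = indicator (box a b) x * g x" for x
    have UI: "(\<integral>x. f x * g x \<partial>lebesgue_on U) = (\<integral>x. indicator U x * (f x * g x) \<partial>lebesgue)" for f
      using Um by (subst integral_restrict_space) auto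
    have bU: "box a b \<subseteq> U" using ab box_subset_cbox by blast
    have "integrable lebesgue (\<lambda>x. indicator U x * g x)"
      using g Um by (subst (asm) integrable_restrict_space) auto
    then have "integrable lebesgue (\<lambda>x. indicator (box a b) x * (indicator U x * g x))"
      using integrable_mult_indicator[of "box a b" lebesgue "\<lambda>x. indicator U x * g x"] by simp
    moreover have "(\<lambda>x. indicator (box a b) x * (indicator U x * g x)) = h"
      using bU by (auto simp: h_def fun_eq_iff split: split_indicator)
    ultimately have hint: "integrable lebesgue h" by simp
    then have "h \<in> borel_measurable (completion lborel)" by auto
    then obtain h' where h': "h' \<in> borel_measurable lborel" "AE x in lborel. h x = h' x"
      using completion_ex_borel_measurable_real by blast
    have hh': "AE x in lebesgue. h x = h' x" using h'(2) by (rule AE_completion)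
    have h'leb: "h' \<in> borel_measurable lebesgue" using h'(1) by (rule measurable_completion)
    have "integrable lebesgue h'"
      by (rule Bochner_Integration.integrable_cong_AE_imp[OF hint h'leb hh'])
    then have h'int: "integrable lborel h'" using h'(1) integrable_completion by blast
    have "(\<integral>x. indicator (box c d) x * h' x \<partial>lborel) = 0" for c d
    proof -
      obtain e f where ef: "box a b \<inter> box c d = box e f" using box_Int_box by blast
      have "(\<integral>x. indicator (box c d) x * h' x \<partial>lborel) = (\<integral>x. indicator (box c d) x * h' x \<partial>lebesgue)"
        using h'(1) by (intro integral_completion[symmetric]) (simp add: borel_measurable_times)
      also have "\<dots> = (\<integral>x. indicator (box c d) x * h x \<partial>lebesgue)"
      proof (rule integral_cong_AE)
        have [measurable]: "h \<in> borel_measurable lebesgue" "h' \<in> borel_measurable lebesgue"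
          "(indicator (box c d) :: real^'n \<Rightarrow> real) \<in> borel_measurable lebesgue"
          using hint h'leb by (auto intro!: borel_measurable_indicator)
        show "(\<lambda>x. indicator (box c d) x * h' x) \<in> borel_measurable lebesgue"
          "(\<lambda>x. indicator (box c d) x * h x) \<in> borel_measurable lebesgue"
          by measurable
        show "AE x in lebesgue. indicator (box c d) x * h' x = indicator (box c d) x * h x"
          using hh' by eventually_elim simp
      qed
      also have "\<dots> = (\<integral>x. indicator U x * (indicator (box e f) x * g x) \<partial>lebesgue)"
        using bU unfolding ef[symmetric] h_def
        by (intro Bochner_Integration.integral_cong) (auto split: split_indicator)
      also have "\<dots> = 0"
      proof (cases "box e f = {}")
        case False
        then have "cbox e f = closure (box e f)" by (simp add: closure_box)
        also have "\<dots> \<subseteq> cbox a b"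
          unfolding ef[symmetric] using box_subset_cbox by (intro closure_minimal) auto
        finally show ?thesis using box0[of e f] ab UI[of "indicator (box e f)"] by auto
      qed simp
      finally show ?thesis .
    qed
    from AE_eq_0_if_box_integrals_eq_0[OF h'int this] have "AE x in lebesgue. h' x = 0"
      by (rule AE_completion)
    moreover have "AE x in lebesgue. x \<notin> cbox a b - box a b"
      using negligible_frontier_interval by (intro AE_not_in) (simp add: negligible_iff_null_sets)
    ultimately show ?thesis
      using hh' by eventually_elim (auto simp: h_def)
  qed
  obtain \<D> where D: "countable \<D>" "\<D> \<subseteq> Pow U" "\<And>X. X \<in> \<D> \<Longrightarrow> \<exists>a b. X = cbox a b" "\<Union>\<D> = U"
    using open_countable_Union_open_cbox[OF U] by blast
  have "AE x in lebesgue. \<forall>X\<in>\<D>. x \<in> X \<longrightarrow> g x = 0"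
    unfolding AE_ball_countable[OF D(1)]
  proof
    fix X assume "X \<in> \<D>"
    with D(2,3) obtain a b where "X = cbox a b" "cbox a b \<subseteq> U" by blast
    then show "AE x in lebesgue. x \<in> X \<longrightarrow> g x = 0" using ae by simp
  qed
  then have "AE x in lebesgue. x \<in> U \<longrightarrow> g x = 0"
    by eventually_elim (use D in blast)
  then show ?thesis using Um by (simp add: AE_restrict_space_iff)
qed

lemma fundamental_lemma:
  fixes g :: "real^'n \<Rightarrow> 'b::euclidean_space"
  assumes U: "open U" and g: "integrable (lebesgue_on U) g"
    and 0: "\<And>\<phi> b. \<phi> \<in> test_functions U \<Longrightarrow> (\<integral>x. \<phi> x * (g x \<bullet> b) \<partial>lebesgue_on U) = 0"
  shows "AE x in lebesgue_on U. g x = 0"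
proof -
  have "\<forall>b\<in>Basis. AE x in lebesgue_on U. g x \<bullet> b = 0"
  proof
    fix b :: 'b assume "b \<in> Basis"
    show "AE x in lebesgue_on U. g x \<bullet> b = 0"
      by (rule fundamental_lemma_real[OF U integrable_inner_left[OF g] 0])
  qed
  then have "AE x in lebesgue_on U. \<forall>b\<in>Basis. g x \<bullet> b = 0"
    by (simp add: AE_finite_all)
  then show ?thesis by eventually_elim (simp add: euclidean_all_zero_iff)
qed

section \<open>Weak derivatives and the function spaces\<close>

lemma test_function_smooth: "\<phi> \<in> test_functions U \<Longrightarrow> smooth \<phi>"
  by (simp add: test_functions_def)

lemma test_function_supported:
  assumes "\<phi> \<in> test_functions U" "smooth \<psi>" and sub: "{x. \<psi> x \<noteq> 0} \<subseteq> {x. \<phi> x \<noteq> 0}"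
  shows "\<psi> \<in> test_functions U"
proof -
  have "compact (closure {x. \<psi> x \<noteq> 0})"
    using assms(1) bounded_subset[OF _ closure_mono[OF sub]]
    by (auto simp: test_functions_def compact_eq_bounded_closed)
  with assms closure_mono[OF sub] show ?thesis by (auto simp: test_functions_def)
qed

lemma test_function_linear_image:
  "bounded_linear T \<Longrightarrow> \<phi> \<in> test_functions U \<Longrightarrow> (\<lambda>x. T (\<phi> x)) \<in> test_functions U"
  by (rule test_function_supported[of \<phi>])
    (auto intro: smooth_linear_image test_function_smooth simp: linear_simps)

lemma test_function_mono: "\<phi> \<in> test_functions U \<Longrightarrow> U \<subseteq> V \<Longrightarrow> \<phi> \<in> test_functions V"
  by (auto simp: test_functions_def)

lemma test_function_eq_0: "\<phi> \<in> test_functions U \<Longrightarrow> x \<notin> U \<Longrightarrow> \<phi> x = 0"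
  using closure_subset[of "{x. \<phi> x \<noteq> 0}"] by (auto simp: test_functions_def)

lemma subspace_test_functions:
  "subspace_of_fields (test_functions U :: (real^'n \<Rightarrow> 'b::real_normed_vector) set)"
  unfolding subspace_of_fields_def
proof (intro ballI allI)
  fix f g :: "real^'n \<Rightarrow> 'b" and a b :: real
  assume f: "f \<in> test_functions U" and g: "g \<in> test_functions U"
  let ?h = "\<lambda>x. a *\<^sub>R f x + b *\<^sub>R g x"
  let ?C = "closure {x. f x \<noteq> 0} \<union> closure {x. g x \<noteq> 0}"
  have C: "compact ?C" "?C \<subseteq> U" using f g by (auto simp: test_functions_def)
  have sub: "closure {x. ?h x \<noteq> 0} \<subseteq> ?C"
    unfolding closure_Un[symmetric] by (rule closure_mono) auto
  then have "compact (closure {x. ?h x \<noteq> 0})"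
    using C(1) by (meson closed_closure compact_Int_closed compact_eq_bounded_closed bounded_subset)
  with sub C f g show "?h \<in> test_functions U"
    by (auto simp: test_functions_def intro!: smooth_lincomb)
qed

locale bounded_open_domain =
  fixes \<Omega> :: "(real^'n) set"
  assumes open_domain: "open \<Omega>" and bounded_domain: "bounded \<Omega>"
begin

lemma lmeasurable_domain: "\<Omega> \<in> lmeasurable"
  by (rule lmeasurable_open[OF bounded_domain open_domain])

lemma domain_sets: "\<Omega> \<in> sets lebesgue"
  using open_domain by auto

lemma continuous_L2:
  fixes f :: "real^'n \<Rightarrow> 'b::euclidean_space"
  assumes f: "continuous_on UNIV f"
  shows "f \<in> L2 \<Omega>"
proof -
  have "compact (f ` closure \<Omega>)"
    using bounded_domain by (intro compact_continuous_image continuous_on_subset[OF f]) auto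
  then obtain M where M: "\<And>x. x \<in> closure \<Omega> \<Longrightarrow> norm (f x) \<le> M"
    using compact_imp_bounded bounded_iff by (metis imageI)
  show ?thesis
  proof (rule bounded_field_L2[OF lmeasurable_domain])
    show "f \<in> borel_measurable (lebesgue_on \<Omega>)"
      using continuous_on_subset[OF f] domain_sets by (intro continuous_imp_measurable_on_sets_lebesgue) auto
    show "AE x in lebesgue_on \<Omega>. norm (f x) \<le> M"
      using M closure_subset[of \<Omega>] by (intro AE_I2) auto
  qed
qed

lemma smooth_L2: "smooth f \<Longrightarrow> f \<in> L2 \<Omega>" for f :: "real^'n \<Rightarrow> 'b::euclidean_space"
  by (rule continuous_L2[OF smooth_continuous_on])

lemma L2_integrable: "f \<in> L2 \<Omega> \<Longrightarrow> integrable (lebesgue_on \<Omega>) f"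
  for f :: "real^'n \<Rightarrow> 'b::euclidean_space"
  using L2_product_integrable[OF bounded_bilinear_scaleR smooth_L2[OF smooth_const[of "1::real"]]]
  by simp

text \<open>The form in which the fundamental lemma is used: a square-integrable field is determined by its
  pairings with test functions, which is what the weak derivatives prescribe.\<close>

lemma AE_eq_if_ip_test_functions_eq:
  fixes f g :: "real^'n \<Rightarrow> 'b::euclidean_space"
  assumes f: "f \<in> L2 \<Omega>" and g: "g \<in> L2 \<Omega>" and eq: "\<And>\<psi>. \<psi> \<in> test_functions \<Omega> \<Longrightarrow> ip \<Omega> f \<psi> = ip \<Omega> g \<psi>"
  shows "AE x in lebesgue_on \<Omega>. f x = g x"
proof -
  have "AE x in lebesgue_on \<Omega>. f x - g x = 0"
  proof (rule fundamental_lemma[OF open_domain L2_integrable[OF L2_diff[OF f g]]])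
    fix \<phi> :: "real^'n \<Rightarrow> real" and b :: 'b
    assume "\<phi> \<in> test_functions \<Omega>"
    then have t: "(\<lambda>x. \<phi> x *\<^sub>R b) \<in> test_functions \<Omega>"
      by (rule test_function_linear_image[OF bounded_linear_scaleR_left])
    have "ip \<Omega> (\<lambda>x. f x - g x) (\<lambda>x. \<phi> x *\<^sub>R b) = 0"
      using ip_diff_left[OF f g smooth_L2[OF test_function_smooth[OF t]]] eq[OF t] by simp
    then show "(\<integral>x. \<phi> x * ((f x - g x) \<bullet> b) \<partial>lebesgue_on \<Omega>) = 0"
      by (simp add: ip_def)
  qed
  then show ?thesis by eventually_elim simp
qed

lemma weak_grad_unique:
  fixes u :: "real^'n \<Rightarrow> 'b::euclidean_space"
  assumes G: "has_weak_grad \<Omega> u G" and H: "has_weak_grad \<Omega> u H"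
  shows "AE x in lebesgue_on \<Omega>. G x = H x"
proof -
  have GL: "G \<in> L2 \<Omega>" and HL: "H \<in> L2 \<Omega>" using G H by (auto simp: has_weak_grad_def)
  have "AE x in lebesgue_on \<Omega>. G x $ j - H x $ j = 0" for j
  proof (rule fundamental_lemma[OF open_domain])
    have GLj: "(\<lambda>x. G x $ j) \<in> L2 \<Omega>" and HLj: "(\<lambda>x. H x $ j) \<in> L2 \<Omega>"
      by (rule L2_linear_image[OF bounded_linear_vec_nth GL], rule L2_linear_image[OF bounded_linear_vec_nth HL])
    show "integrable (lebesgue_on \<Omega>) (\<lambda>x. G x $ j - H x $ j)"
      by (rule L2_integrable[OF L2_diff[OF GLj HLj]])
    fix \<phi> :: "real^'n \<Rightarrow> real" and b :: 'b
    assume t: "\<phi> \<in> test_functions \<Omega>"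
    have i: "integrable (lebesgue_on \<Omega>) (\<lambda>x. \<phi> x *\<^sub>R (G x $ j))"
      "integrable (lebesgue_on \<Omega>) (\<lambda>x. \<phi> x *\<^sub>R (H x $ j))"
      using smooth_L2[OF test_function_smooth[OF t]] GLj HLj
      by (auto intro: L2_product_integrable[OF bounded_bilinear_scaleR])
    have "(\<integral>x. \<phi> x *\<^sub>R (G x $ j) \<partial>lebesgue_on \<Omega>) = (\<integral>x. \<phi> x *\<^sub>R (H x $ j) \<partial>lebesgue_on \<Omega>)"
    proof -
      have "(\<integral>x. partial_deriv j \<phi> x *\<^sub>R u x \<partial>lebesgue_on \<Omega>) = - (\<integral>x. \<phi> x *\<^sub>R (G x $ j) \<partial>lebesgue_on \<Omega>)"
        using G t unfolding has_weak_grad_def by blast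
      moreover have "(\<integral>x. partial_deriv j \<phi> x *\<^sub>R u x \<partial>lebesgue_on \<Omega>) = - (\<integral>x. \<phi> x *\<^sub>R (H x $ j) \<partial>lebesgue_on \<Omega>)"
        using H t unfolding has_weak_grad_def by blast
      ultimately show ?thesis by simp
    qed
    then have "(\<integral>x. \<phi> x *\<^sub>R (G x $ j) - \<phi> x *\<^sub>R (H x $ j) \<partial>lebesgue_on \<Omega>) \<bullet> b = 0"
      using i by simp
    then have "(\<integral>x. (\<phi> x *\<^sub>R (G x $ j) - \<phi> x *\<^sub>R (H x $ j)) \<bullet> b \<partial>lebesgue_on \<Omega>) = 0"
      using i by (subst integral_inner_left) auto
    then show "(\<integral>x. \<phi> x * ((G x $ j - H x $ j) \<bullet> b) \<partial>lebesgue_on \<Omega>) = 0"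
      by (simp add: inner_diff_left right_diff_distrib)
  qed
  then have "AE x in lebesgue_on \<Omega>. \<forall>j\<in>UNIV. G x $ j - H x $ j = 0"
    by (subst AE_finite_all) auto
  then show ?thesis by eventually_elim (simp add: vec_eq_iff)
qed

lemma has_weak_grad_lincomb:
  fixes u v :: "real^'n \<Rightarrow> 'b::euclidean_space"
  assumes u: "u \<in> L2 \<Omega>" "has_weak_grad \<Omega> u G" and v: "v \<in> L2 \<Omega>" "has_weak_grad \<Omega> v H"
  shows "has_weak_grad \<Omega> (\<lambda>x. a *\<^sub>R u x + b *\<^sub>R v x) (\<lambda>x. a *\<^sub>R G x + b *\<^sub>R H x)"
  unfolding has_weak_grad_def
proof (intro conjI ballI allI)
  have GL: "G \<in> L2 \<Omega>" and HL: "H \<in> L2 \<Omega>" using u v by (auto simp: has_weak_grad_def)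
  then show "(\<lambda>x. a *\<^sub>R G x + b *\<^sub>R H x) \<in> L2 \<Omega>" by (rule L2_lincomb)
  fix \<phi> :: "real^'n \<Rightarrow> real" and j
  assume t: "\<phi> \<in> test_functions \<Omega>"
  note sL = smooth_L2[OF test_function_smooth[OF t]]
    smooth_L2[OF smooth_partial_deriv[OF test_function_smooth[OF t]], of j]
  have i: "integrable (lebesgue_on \<Omega>) (\<lambda>x. \<phi> x *\<^sub>R (G x $ j))"
    "integrable (lebesgue_on \<Omega>) (\<lambda>x. \<phi> x *\<^sub>R (H x $ j))"
    "integrable (lebesgue_on \<Omega>) (\<lambda>x. partial_deriv j \<phi> x *\<^sub>R u x)"
    "integrable (lebesgue_on \<Omega>) (\<lambda>x. partial_deriv j \<phi> x *\<^sub>R v x)"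
    using sL u(1) v(1) L2_linear_image[OF bounded_linear_vec_nth GL, of j]
      L2_linear_image[OF bounded_linear_vec_nth HL, of j]
    by (auto intro: L2_product_integrable[OF bounded_bilinear_scaleR])
  have l: "(\<integral>x. a *\<^sub>R (p x *\<^sub>R f x) + b *\<^sub>R (p x *\<^sub>R g x) \<partial>lebesgue_on \<Omega>)
      = a *\<^sub>R (\<integral>x. p x *\<^sub>R f x \<partial>lebesgue_on \<Omega>) + b *\<^sub>R (\<integral>x. p x *\<^sub>R g x \<partial>lebesgue_on \<Omega>)"
    if "integrable (lebesgue_on \<Omega>) (\<lambda>x. p x *\<^sub>R f x)" "integrable (lebesgue_on \<Omega>) (\<lambda>x. p x *\<^sub>R g x)"
    for p :: "real^'n \<Rightarrow> real" and f g :: "real^'n \<Rightarrow> 'b"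
    using that by (simp del: scaleR_scaleR)
  have e: "p x *\<^sub>R (a *\<^sub>R y + b *\<^sub>R z) = a *\<^sub>R (p x *\<^sub>R y) + b *\<^sub>R (p x *\<^sub>R z)"
    for p :: "real^'n \<Rightarrow> real" and x and y z :: 'b
    by (simp add: algebra_simps)
  have "(\<integral>x. partial_deriv j \<phi> x *\<^sub>R (a *\<^sub>R u x + b *\<^sub>R v x) \<partial>lebesgue_on \<Omega>)
      = a *\<^sub>R (\<integral>x. partial_deriv j \<phi> x *\<^sub>R u x \<partial>lebesgue_on \<Omega>)
        + b *\<^sub>R (\<integral>x. partial_deriv j \<phi> x *\<^sub>R v x \<partial>lebesgue_on \<Omega>)"
    unfolding e by (rule l[OF i(3,4)])
  also have "\<dots> = - (a *\<^sub>R (\<integral>x. \<phi> x *\<^sub>R (G x $ j) \<partial>lebesgue_on \<Omega>) + b *\<^sub>R (\<integral>x. \<phi> x *\<^sub>R (H x $ j) \<partial>lebesgue_on \<Omega>))"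
    using u(2) v(2) t by (simp add: has_weak_grad_def)
  also have "\<dots> = - (\<integral>x. \<phi> x *\<^sub>R ((a *\<^sub>R G x + b *\<^sub>R H x) $ j) \<partial>lebesgue_on \<Omega>)"
    unfolding vector_add_component vector_scaleR_component e by (subst l[OF i(1,2)]) simp
  finally show "(\<integral>x. partial_deriv j \<phi> x *\<^sub>R (a *\<^sub>R u x + b *\<^sub>R v x) \<partial>lebesgue_on \<Omega>)
      = - (\<integral>x. \<phi> x *\<^sub>R ((a *\<^sub>R G x + b *\<^sub>R H x) $ j) \<partial>lebesgue_on \<Omega>)" .
qed

lemma H1_wgrad:
  assumes "u \<in> H1 \<Omega>" shows "has_weak_grad \<Omega> u (wgrad \<Omega> u)"
proof -
  from assms obtain w where "has_weak_grad \<Omega> u w" by (auto simp: H1_def)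
  then show ?thesis unfolding wgrad_def by (rule someI[where P = "has_weak_grad \<Omega> u"])
qed

lemma H1_L2: "u \<in> H1 \<Omega> \<Longrightarrow> u \<in> L2 \<Omega>"
  by (simp add: H1_def)

lemma wgrad_L2: "u \<in> H1 \<Omega> \<Longrightarrow> wgrad \<Omega> u \<in> L2 \<Omega>"
  using H1_wgrad by (auto simp: has_weak_grad_def)

lemma H10_H1: "u \<in> H10 \<Omega> \<Longrightarrow> u \<in> H1 \<Omega>"
  by (simp add: H10_def)

text \<open>Approximating sequences may be combined linearly; the gradient of the combination is known only
  almost everywhere, which suffices because it enters through its norm.\<close>

lemma subspace_H10: "subspace_of_fields (H10 \<Omega> :: (real^'n \<Rightarrow> 'b::euclidean_space) set)"
  unfolding subspace_of_fields_def
proof (intro ballI allI)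
  fix u v :: "real^'n \<Rightarrow> 'b" and a b :: real
  assume u: "u \<in> H10 \<Omega>" and v: "v \<in> H10 \<Omega>"
  let ?w = "\<lambda>x. a *\<^sub>R u x + b *\<^sub>R v x"
  note uv = H10_H1[OF u] H10_H1[OF v]
  have wg: "has_weak_grad \<Omega> ?w (\<lambda>x. a *\<^sub>R wgrad \<Omega> u x + b *\<^sub>R wgrad \<Omega> v x)"
    by (intro has_weak_grad_lincomb H1_L2 H1_wgrad uv)
  have w: "?w \<in> H1 \<Omega>"
    unfolding H1_def using wg L2_lincomb[OF uv[THEN H1_L2]] by auto
  obtain \<phi> where \<phi>: "\<And>m. \<phi> m \<in> test_functions \<Omega>" "(\<lambda>m. L2norm \<Omega> (\<lambda>x. u x - \<phi> m x)) \<longlonglongrightarrow> 0"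
    "(\<lambda>m. L2norm \<Omega> (\<lambda>x. wgrad \<Omega> u x - grad (\<phi> m) x)) \<longlonglongrightarrow> 0"
    using u by (auto simp: H10_def)
  obtain \<eta> where \<eta>: "\<And>m. \<eta> m \<in> test_functions \<Omega>" "(\<lambda>m. L2norm \<Omega> (\<lambda>x. v x - \<eta> m x)) \<longlonglongrightarrow> 0"
    "(\<lambda>m. L2norm \<Omega> (\<lambda>x. wgrad \<Omega> v x - grad (\<eta> m) x)) \<longlonglongrightarrow> 0"
    using v by (auto simp: H10_def)
  define \<psi> where "\<psi> m = (\<lambda>x. a *\<^sub>R \<phi> m x + b *\<^sub>R \<eta> m x)" for m
  note sm = test_function_smooth[OF \<phi>(1)] test_function_smooth[OF \<eta>(1)]
  have conv: "(\<lambda>m. L2norm \<Omega> (\<lambda>x. a *\<^sub>R f m x + b *\<^sub>R g m x)) \<longlonglongrightarrow> 0"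
    if "(\<lambda>m. L2norm \<Omega> (f m)) \<longlonglongrightarrow> 0" "(\<lambda>m. L2norm \<Omega> (g m)) \<longlonglongrightarrow> 0"
      "\<And>m. f m \<in> L2 \<Omega>" "\<And>m. g m \<in> L2 \<Omega>" for f g :: "nat \<Rightarrow> real^'n \<Rightarrow> 'c::euclidean_space"
  proof (rule Lim_null_comparison[OF always_eventually])
    show "(\<lambda>m. \<bar>a\<bar> * L2norm \<Omega> (f m) + \<bar>b\<bar> * L2norm \<Omega> (g m)) \<longlonglongrightarrow> 0"
      using tendsto_add[OF tendsto_mult[OF tendsto_const that(1)] tendsto_mult[OF tendsto_const that(2)],
          of "\<bar>a\<bar>" "\<bar>b\<bar>"] by simp
    show "\<forall>m. norm (L2norm \<Omega> (\<lambda>x. a *\<^sub>R f m x + b *\<^sub>R g m x)) \<le> \<bar>a\<bar> * L2norm \<Omega> (f m) + \<bar>b\<bar> * L2norm \<Omega> (g m)"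
    proof
      fix m
      show "norm (L2norm \<Omega> (\<lambda>x. a *\<^sub>R f m x + b *\<^sub>R g m x)) \<le> \<bar>a\<bar> * L2norm \<Omega> (f m) + \<bar>b\<bar> * L2norm \<Omega> (g m)"
        using L2norm_triangle[OF subspace_of_fields_scaleR[OF subspace_L2 that(3)[of m], of a]
            subspace_of_fields_scaleR[OF subspace_L2 that(4)[of m], of b]]
        by (simp add: L2norm_scaleR L2norm_ge_0)
    qed
  qed
  have "(\<lambda>m. L2norm \<Omega> (\<lambda>x. a *\<^sub>R (u x - \<phi> m x) + b *\<^sub>R (v x - \<eta> m x))) \<longlonglongrightarrow> 0"
    by (intro conv \<phi>(2) \<eta>(2) L2_diff H1_L2 uv smooth_L2 sm)
  then have c1: "(\<lambda>m. L2norm \<Omega> (\<lambda>x. ?w x - \<psi> m x)) \<longlonglongrightarrow> 0"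
    by (simp add: \<psi>_def algebra_simps)
  have "(\<lambda>m. L2norm \<Omega> (\<lambda>x. a *\<^sub>R (wgrad \<Omega> u x - grad (\<phi> m) x) + b *\<^sub>R (wgrad \<Omega> v x - grad (\<eta> m) x))) \<longlonglongrightarrow> 0"
    by (intro conv \<phi>(3) \<eta>(3) L2_diff wgrad_L2 uv smooth_L2 smooth_grad sm)
  moreover have "L2norm \<Omega> (\<lambda>x. a *\<^sub>R (wgrad \<Omega> u x - grad (\<phi> m) x) + b *\<^sub>R (wgrad \<Omega> v x - grad (\<eta> m) x))
      = L2norm \<Omega> (\<lambda>x. wgrad \<Omega> ?w x - grad (\<psi> m) x)" for m
  proof (rule L2norm_cong_AE)
    show "(\<lambda>x. a *\<^sub>R (wgrad \<Omega> u x - grad (\<phi> m) x) + b *\<^sub>R (wgrad \<Omega> v x - grad (\<eta> m) x)) \<in> L2 \<Omega>"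
      by (intro L2_lincomb L2_diff wgrad_L2 uv smooth_L2 smooth_grad sm)
    show "(\<lambda>x. wgrad \<Omega> ?w x - grad (\<psi> m) x) \<in> L2 \<Omega>"
      unfolding \<psi>_def by (intro L2_diff wgrad_L2 w smooth_L2 smooth_grad smooth_lincomb sm)
    show "AE x in lebesgue_on \<Omega>. a *\<^sub>R (wgrad \<Omega> u x - grad (\<phi> m) x) + b *\<^sub>R (wgrad \<Omega> v x - grad (\<eta> m) x)
        = wgrad \<Omega> ?w x - grad (\<psi> m) x"
      using weak_grad_unique[OF wg H1_wgrad[OF w]]
    proof eventually_elim
      case (elim x)
      then show ?case
        unfolding \<psi>_def by (simp only: grad_lincomb[OF sm] elim[symmetric]) (simp add: algebra_simps)
    qed
  qed
  ultimately have c2: "(\<lambda>m. L2norm \<Omega> (\<lambda>x. wgrad \<Omega> ?w x - grad (\<psi> m) x)) \<longlonglongrightarrow> 0" by simp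
  have "\<psi> m \<in> test_functions \<Omega>" for m
    unfolding \<psi>_def by (intro subspace_of_fieldsD[OF subspace_test_functions] \<phi>(1) \<eta>(1))
  with w c1 c2 show "?w \<in> H10 \<Omega>" unfolding H10_def by auto
qed

lemma weak_div_unique:
  "has_weak_div \<Omega> u g \<Longrightarrow> has_weak_div \<Omega> u h \<Longrightarrow> AE x in lebesgue_on \<Omega>. g x = h x"
  by (rule AE_eq_if_ip_test_functions_eq) (auto simp: has_weak_div_def)

lemma has_weak_div_lincomb:
  assumes "u \<in> L2 \<Omega>" "has_weak_div \<Omega> u g" "v \<in> L2 \<Omega>" "has_weak_div \<Omega> v h"
  shows "has_weak_div \<Omega> (\<lambda>x. a *\<^sub>R u x + b *\<^sub>R v x) (\<lambda>x. a *\<^sub>R g x + b *\<^sub>R h x)"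
  unfolding has_weak_div_def
proof (intro conjI ballI)
  have L: "g \<in> L2 \<Omega>" "h \<in> L2 \<Omega>" using assms by (auto simp: has_weak_div_def)
  then show "(\<lambda>x. a *\<^sub>R g x + b *\<^sub>R h x) \<in> L2 \<Omega>" by (rule L2_lincomb)
  fix \<phi> :: "real^'n \<Rightarrow> real" assume t: "\<phi> \<in> test_functions \<Omega>"
  note s = test_function_smooth[OF t]
  show "ip \<Omega> (\<lambda>x. a *\<^sub>R u x + b *\<^sub>R v x) (grad \<phi>) = - ip \<Omega> (\<lambda>x. a *\<^sub>R g x + b *\<^sub>R h x) \<phi>"
    unfolding ip_lincomb_left[OF assms(1,3) smooth_L2[OF smooth_grad[OF s]]]
      ip_lincomb_left[OF L smooth_L2[OF s]]
    using assms(2,4) t by (simp add: has_weak_div_def)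
qed

lemma Hdiv_wdiv:
  assumes "u \<in> Hdiv \<Omega>" shows "has_weak_div \<Omega> u (wdiv \<Omega> u)"
proof -
  from assms obtain w where "has_weak_div \<Omega> u w" by (auto simp: Hdiv_def)
  then show ?thesis unfolding wdiv_def by (rule someI[where P = "has_weak_div \<Omega> u"])
qed

lemma div_free_if_has_weak_div_0:
  assumes u: "has_weak_div \<Omega> u g" and g: "AE x in lebesgue_on \<Omega>. g x = 0"
  shows "div_free \<Omega> u"
proof -
  have "has_weak_div \<Omega> u (wdiv \<Omega> u)" unfolding wdiv_def using u by (rule someI[where P = "has_weak_div \<Omega> u"])
  from weak_div_unique[OF this u] g show ?thesis
    unfolding div_free_def by eventually_elim simp
qed

lemma H0div_L2: "u \<in> H0div \<Omega> \<Longrightarrow> u \<in> L2 \<Omega>"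
  by (simp add: H0div_def Hdiv_def)

lemma H0div_wdiv: "u \<in> H0div \<Omega> \<Longrightarrow> has_weak_div \<Omega> u (wdiv \<Omega> u)"
  by (simp add: H0div_def Hdiv_wdiv)

text \<open>The trace condition refers to the chosen weak divergence; any other representative serves as well.\<close>

lemma H0divI:
  assumes u: "u \<in> L2 \<Omega>" and g: "g \<in> L2 \<Omega>" and G: "\<And>\<phi>. smooth \<phi> \<Longrightarrow> ip \<Omega> u (grad \<phi>) + ip \<Omega> g \<phi> = 0"
  shows "has_weak_div \<Omega> u g" "u \<in> H0div \<Omega>"
proof -
  show w: "has_weak_div \<Omega> u g"
    unfolding has_weak_div_def using g G test_function_smooth by force
  with u have H: "u \<in> Hdiv \<Omega>" by (auto simp: Hdiv_def)
  then have "ip \<Omega> (wdiv \<Omega> u) \<phi> = ip \<Omega> g \<phi>" if "smooth \<phi>" for \<phi>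
    using weak_div_unique[OF Hdiv_wdiv[OF H] w] Hdiv_wdiv[OF H] g smooth_L2[OF that]
    by (intro ip_cong_AE) (auto simp: has_weak_div_def)
  with G H show "u \<in> H0div \<Omega>" by (simp add: H0div_def)
qed

lemma subspace_H0div: "subspace_of_fields (H0div \<Omega>)"
  unfolding subspace_of_fields_def
proof (intro ballI allI)
  fix u v a b assume u: "u \<in> H0div \<Omega>" and v: "v \<in> H0div \<Omega>"
  have L: "wdiv \<Omega> u \<in> L2 \<Omega>" "wdiv \<Omega> v \<in> L2 \<Omega>"
    using H0div_wdiv[OF u] H0div_wdiv[OF v] by (auto simp: has_weak_div_def)
  show "(\<lambda>x. a *\<^sub>R u x + b *\<^sub>R v x) \<in> H0div \<Omega>"
  proof (rule H0divI(2))
    fix \<phi> :: "real^'n \<Rightarrow> real" assume \<phi>: "smooth \<phi>"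
    have "ip \<Omega> u (grad \<phi>) + ip \<Omega> (wdiv \<Omega> u) \<phi> = 0" "ip \<Omega> v (grad \<phi>) + ip \<Omega> (wdiv \<Omega> v) \<phi> = 0"
      using u v \<phi> by (auto simp: H0div_def)
    then have "a * (ip \<Omega> u (grad \<phi>) + ip \<Omega> (wdiv \<Omega> u) \<phi>) + b * (ip \<Omega> v (grad \<phi>) + ip \<Omega> (wdiv \<Omega> v) \<phi>) = 0"
      by simp
    then show "ip \<Omega> (\<lambda>x. a *\<^sub>R u x + b *\<^sub>R v x) (grad \<phi>)
        + ip \<Omega> (\<lambda>x. a *\<^sub>R wdiv \<Omega> u x + b *\<^sub>R wdiv \<Omega> v x) \<phi> = 0"
      by (simp only: ip_lincomb_left[OF H0div_L2[OF u] H0div_L2[OF v] smooth_L2[OF smooth_grad[OF \<phi>]]]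
          ip_lincomb_left[OF L smooth_L2[OF \<phi>]]) (simp add: algebra_simps)
  qed (intro L2_lincomb H0div_L2 u v L)+
qed

end

text \<open>The two identities between the products are the ones the energy argument and the exactness
  \<open>div curl = 0\<close> rely on; they hold for the spatial products as well as for the planar ones.\<close>

locale cross_products =
  fixes vv :: "real^'n \<Rightarrow> real^'n \<Rightarrow> 'e::euclidean_space" and ev :: "'e \<Rightarrow> real^'n \<Rightarrow> real^'n"
  assumes bilinear_vv: "bounded_bilinear vv" and bilinear_ev: "bounded_bilinear ev"
    and inner_vv: "c \<bullet> vv a b = ev c a \<bullet> b" and vv_skew: "vv a b = - vv b a"
begin

lemma smooth_curl: "smooth \<psi> \<Longrightarrow> smooth (curl vv \<psi>)"
  unfolding curl_def[abs_def]
  by (rule smooth_sum)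
    (rule smooth_linear_image[OF bounded_bilinear.bounded_linear_right[OF bilinear_vv] smooth_partial_deriv])

end

locale cross_products_on_domain = cross_products vv ev + bounded_open_domain \<Omega>
  for vv :: "real^'n \<Rightarrow> real^'n \<Rightarrow> 'e::euclidean_space" and ev and \<Omega> :: "(real^'n) set"
begin

lemma weak_curl_unique:
  "has_weak_curl vv \<Omega> F G \<Longrightarrow> has_weak_curl vv \<Omega> F H \<Longrightarrow> AE x in lebesgue_on \<Omega>. G x = H x"
  by (rule AE_eq_if_ip_test_functions_eq) (auto simp: has_weak_curl_def)

lemma has_weak_curl_lincomb:
  assumes "F \<in> L2 \<Omega>" "has_weak_curl vv \<Omega> F G" "F' \<in> L2 \<Omega>" "has_weak_curl vv \<Omega> F' G'"
  shows "has_weak_curl vv \<Omega> (\<lambda>x. a *\<^sub>R F x + b *\<^sub>R F' x) (\<lambda>x. a *\<^sub>R G x + b *\<^sub>R G' x)"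
  using assms unfolding has_weak_curl_def
  by (auto intro: L2_lincomb simp: ip_lincomb_left smooth_L2 smooth_curl test_function_smooth)

lemma Hcurl_wcurl:
  assumes "F \<in> Hcurl vv \<Omega>" shows "has_weak_curl vv \<Omega> F (wcurl vv \<Omega> F)"
proof -
  from assms obtain w where "has_weak_curl vv \<Omega> F w" by (auto simp: Hcurl_def)
  then show ?thesis unfolding wcurl_def by (rule someI[where P = "has_weak_curl vv \<Omega> F"])
qed

lemma H0curl_L2: "F \<in> H0curl vv \<Omega> \<Longrightarrow> F \<in> L2 \<Omega>"
  by (simp add: H0curl_def Hcurl_def)

lemma H0curl_wcurl: "F \<in> H0curl vv \<Omega> \<Longrightarrow> has_weak_curl vv \<Omega> F (wcurl vv \<Omega> F)"
  by (simp add: H0curl_def Hcurl_wcurl)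

lemma wcurl_L2: "F \<in> H0curl vv \<Omega> \<Longrightarrow> wcurl vv \<Omega> F \<in> L2 \<Omega>"
  using H0curl_wcurl by (auto simp: has_weak_curl_def)

lemma H0curl_lincomb:
  assumes F: "F \<in> H0curl vv \<Omega>" and F': "F' \<in> H0curl vv \<Omega>"
  shows "(\<lambda>x. a *\<^sub>R F x + b *\<^sub>R F' x) \<in> H0curl vv \<Omega>" (is "?H \<in> _")
    and "AE x in lebesgue_on \<Omega>. wcurl vv \<Omega> (\<lambda>x. a *\<^sub>R F x + b *\<^sub>R F' x) x
      = a *\<^sub>R wcurl vv \<Omega> F x + b *\<^sub>R wcurl vv \<Omega> F' x"
proof -
  let ?W = "\<lambda>x. a *\<^sub>R wcurl vv \<Omega> F x + b *\<^sub>R wcurl vv \<Omega> F' x"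
  have w: "has_weak_curl vv \<Omega> ?H ?W"
    by (intro has_weak_curl_lincomb H0curl_L2 H0curl_wcurl F F')
  have H: "?H \<in> Hcurl vv \<Omega>"
    using w L2_lincomb[OF H0curl_L2[OF F] H0curl_L2[OF F']] by (auto simp: Hcurl_def)
  show ae: "AE x in lebesgue_on \<Omega>. wcurl vv \<Omega> ?H x = ?W x"
    by (rule weak_curl_unique[OF Hcurl_wcurl[OF H] w])
  have "ip \<Omega> ?H (curl vv \<psi>) - ip \<Omega> (wcurl vv \<Omega> ?H) \<psi> = 0" if \<psi>: "smooth \<psi>" for \<psi>
  proof -
    have "ip \<Omega> (wcurl vv \<Omega> ?H) \<psi> = ip \<Omega> ?W \<psi>"
      using Hcurl_wcurl[OF H] w
      by (intro ip_cong_AE[OF _ _ smooth_L2[OF \<psi>] ae]) (auto simp: has_weak_curl_def)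
    also have "\<dots> = a * ip \<Omega> (wcurl vv \<Omega> F) \<psi> + b * ip \<Omega> (wcurl vv \<Omega> F') \<psi>"
      by (intro ip_lincomb_left wcurl_L2 F F' smooth_L2 \<psi>)
    also have "\<dots> = a * ip \<Omega> F (curl vv \<psi>) + b * ip \<Omega> F' (curl vv \<psi>)"
      using F F' \<psi> by (simp add: H0curl_def)
    also have "\<dots> = ip \<Omega> ?H (curl vv \<psi>)"
      by (intro ip_lincomb_left[symmetric] H0curl_L2 F F' smooth_L2 smooth_curl \<psi>)
    finally show ?thesis by simp
  qed
  with H show "?H \<in> H0curl vv \<Omega>" by (simp add: H0curl_def)
qed

lemma subspace_H0curl: "subspace_of_fields (H0curl vv \<Omega>)"
  by (simp add: subspace_of_fields_def H0curl_lincomb)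

end

text \<open>The Hessian is symmetric and the product is antisymmetric.\<close>

lemma curl_grad:
  assumes c: "cross_products vv ev" and \<phi>: "smooth (\<phi> :: real^'n \<Rightarrow> real)"
  shows "curl vv (grad \<phi>) x = 0"
proof -
  interpret cross_products vv ev by (rule c)
  note lin = bounded_bilinear.bounded_linear_right[OF bilinear_vv]
  have "partial_deriv i (grad \<phi>) x = (\<Sum>j\<in>UNIV. partial_deriv i (partial_deriv j \<phi>) x *\<^sub>R axis j 1)" for i
  proof -
    have "(grad \<phi> has_derivative (\<lambda>h. \<Sum>j\<in>UNIV. axis j (frechet_derivative (partial_deriv j \<phi>) (at x) h))) (at x)"
      unfolding grad_conv_sum[abs_def]
      by (intro has_derivative_sum bounded_linear.has_derivative[OF bounded_linear_axis]
          smooth_has_derivative smooth_partial_deriv \<phi>)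
    from partial_deriv_eq[OF this] show ?thesis
      by (simp add: partial_deriv_def[of i "partial_deriv _ \<phi>"] axis_def vec_eq_iff if_distrib cong: if_cong)
  qed
  then have sum: "curl vv (grad \<phi>) x
      = (\<Sum>i\<in>UNIV. \<Sum>j\<in>UNIV. partial_deriv i (partial_deriv j \<phi>) x *\<^sub>R vv (axis i 1) (axis j 1))"
    (is "_ = (\<Sum>i\<in>UNIV. \<Sum>j\<in>UNIV. ?A i j)")
    by (simp add: curl_def linear_sum[OF bounded_linear.linear[OF lin]] linear_scale[OF bounded_linear.linear[OF lin]])
  have "?A i j = - ?A j i" for i j
    using vv_skew[of "axis i 1" "axis j 1"] partial_deriv_commute_real[OF \<phi>, of i j x] by simp
  then have "(\<Sum>j\<in>UNIV. \<Sum>i\<in>UNIV. ?A i j) = (\<Sum>j\<in>UNIV. \<Sum>i\<in>UNIV. - ?A j i)"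
    by (intro sum.cong refl)
  with sum.swap[of ?A UNIV UNIV] sum have "curl vv (grad \<phi>) x = - curl vv (grad \<phi>) x"
    by (simp add: sum_negf)
  then show ?thesis by (simp add: eq_neg_iff_add_eq_0 flip: scaleR_2)
qed

section \<open>Integration by parts\<close>

text \<open>Difference quotients along an axis integrate to zero because the Lebesgue measure is
  translation invariant, and they converge boundedly to the partial derivative.\<close>

lemma integral_partial_deriv_compact_support:
  fixes g :: "real^'n \<Rightarrow> real"
  assumes d: "\<And>x. g differentiable (at x)" and c: "continuous_on UNIV (partial_deriv i g)"
    and C: "compact C" and z: "\<And>x. x \<notin> C \<Longrightarrow> g x = 0"
  shows "(\<integral>x. partial_deriv i g x \<partial>lborel) = 0"
proof -
  define e where "e = (axis i 1 :: real^'n)"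
  define t where "t m = 1 / real (Suc m)" for m
  have t: "0 < t m" "t m \<le> 1" for m by (auto simp: t_def)
  have e: "norm e = 1" by (simp add: e_def norm_axis)
  define q where "q m x = (g (x + t m *\<^sub>R e) - g x) / t m" for m x
  have gc: "continuous_on UNIV g"
    using d by (simp add: continuous_at_imp_continuous_on differentiable_imp_continuous_within)
  have "integrable lborel (\<lambda>x. indicator C x *\<^sub>R g x)"
    by (rule borel_integrable_compact[OF C continuous_on_subset[OF gc]]) simp
  moreover have "(\<lambda>x. indicator C x *\<^sub>R g x) = g"
    using z by (auto simp: fun_eq_iff split: split_indicator)
  ultimately have gi: "integrable lborel g" by simp
  have shift: "integrable lborel (\<lambda>x. g (x + a))" "(\<integral>x. g (x + a) \<partial>lborel) = (\<integral>x. g x \<partial>lborel)" for a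
  proof -
    have gm: "g \<in> borel_measurable borel" using gc by (rule borel_measurable_continuous_onI)
    show "integrable lborel (\<lambda>x. g (x + a))"
      using gi integrable_distr_eq[of "(+) a" lborel borel g] gm by (simp add: lborel_distr_plus add.commute)
    show "(\<integral>x. g (x + a) \<partial>lborel) = (\<integral>x. g x \<partial>lborel)"
      using integral_distr[of "(+) a" lborel borel g] gm by (simp add: lborel_distr_plus add.commute)
  qed
  have q0: "(\<integral>x. q m x \<partial>lborel) = 0" for m
    unfolding q_def using shift gi by simp
  obtain R where R: "\<And>x. x \<in> C \<Longrightarrow> norm x \<le> R"
    using compact_imp_bounded[OF C] bounded_iff by metis
  have "compact (partial_deriv i g ` cball 0 (R + 2))"
    by (intro compact_continuous_image continuous_on_subset[OF c]) auto
  then obtain M where M: "\<And>x. x \<in> cball 0 (R + 2) \<Longrightarrow> \<bar>partial_deriv i g x\<bar> \<le> M"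
    using compact_imp_bounded bounded_iff by (metis imageI real_norm_def)
  have "(\<lambda>m. \<integral>x. q m x \<partial>lborel) \<longlonglongrightarrow> (\<integral>x. partial_deriv i g x \<partial>lborel)"
  proof (rule integral_dominated_convergence[where w = "\<lambda>x. indicator (cball 0 (R + 1)) x *\<^sub>R M"])
    show "partial_deriv i g \<in> borel_measurable lborel"
      using borel_measurable_continuous_onI[OF c] by simp
    show "q m \<in> borel_measurable lborel" for m
      unfolding q_def[abs_def] using shift(1) gi by (intro borel_measurable_integrable) auto
    show "integrable lborel (\<lambda>x. indicator (cball 0 (R + 1)) x *\<^sub>R M)"
      by (rule borel_integrable_compact) auto
    show "AE x in lborel. (\<lambda>m. q m x) \<longlonglongrightarrow> partial_deriv i g x"
    proof (rule always_eventually, rule allI)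
      fix x
      have "((\<lambda>s. g (x + s *\<^sub>R e)) has_real_derivative partial_deriv i g (x + 0 *\<^sub>R e)) (at 0)"
        unfolding e_def by (rule has_derivative_along_axis[OF d])
      then have D: "((\<lambda>h. (g (x + h *\<^sub>R e) - g x) / h) \<longlongrightarrow> partial_deriv i g x) (at 0)"
        by (simp add: has_field_derivative_iff)
      have "t \<longlonglongrightarrow> 0" unfolding t_def by (rule LIMSEQ_Suc[OF lim_1_over_n])
      then have "filterlim t (at 0) sequentially"
        using t(1) by (auto simp: filterlim_at intro!: always_eventually dest: less_imp_neq[THEN not_sym])
      from filterlim_compose[OF D this] show "(\<lambda>m. q m x) \<longlonglongrightarrow> partial_deriv i g x"
        by (simp add: q_def)
    qed
    show "AE x in lborel. norm (q m x) \<le> indicator (cball 0 (R + 1)) x *\<^sub>R M" for m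
    proof (rule always_eventually, rule allI)
      fix x
      show "norm (q m x) \<le> indicator (cball 0 (R + 1)) x *\<^sub>R M"
      proof (cases "norm x \<le> R + 1")
        case True
        have "\<exists>a. 0 < a \<and> a < t m \<and> g (x + t m *\<^sub>R e) - g (x + 0 *\<^sub>R e) = (t m - 0) * partial_deriv i g (x + a *\<^sub>R e)"
          unfolding e_def by (rule MVT2[OF t(1)]) (rule has_derivative_along_axis[OF d])
        then obtain a where a: "0 < a" "a < t m" "g (x + t m *\<^sub>R e) - g x = t m * partial_deriv i g (x + a *\<^sub>R e)"
          by auto
        have "norm (a *\<^sub>R e) \<le> 1" using a(1,2) t(2)[of m] by (simp add: e)
        then have "norm (x + a *\<^sub>R e) \<le> R + 2"
          using True norm_triangle_ineq[of x "a *\<^sub>R e"] by linarith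
        then have "\<bar>partial_deriv i g (x + a *\<^sub>R e)\<bar> \<le> M" by (intro M) simp
        moreover have "q m x = partial_deriv i g (x + a *\<^sub>R e)"
          using a(3) t(1)[of m] by (simp add: q_def)
        ultimately show ?thesis using True by simp
      next
        case False
        have "norm (t m *\<^sub>R e) \<le> 1" using t[of m] by (simp add: e)
        then have "R < norm (x + t m *\<^sub>R e)"
          using False norm_triangle_ineq4[of "x + t m *\<^sub>R e" "t m *\<^sub>R e"] by simp
        then have "x + t m *\<^sub>R e \<notin> C" "x \<notin> C" using R False by fastforce+
        then show ?thesis using False by (simp add: q_def z)
      qed
    qed
  qed
  then show ?thesis by (simp add: q0 LIMSEQ_const_iff)
qed

lemma partial_deriv_eq_0_off_support:
  assumes "closed C" "\<And>x. x \<notin> C \<Longrightarrow> g x = 0" "x \<notin> C"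
  shows "partial_deriv i g x = 0"
proof -
  have "((\<lambda>x. 0) has_derivative (\<lambda>h. 0)) (at x)" by simp
  then have "(g has_derivative (\<lambda>h. 0)) (at x)"
    by (rule has_derivative_transform_within_open[where s = "- C"]) (use assms in auto)
  then show ?thesis by (simp add: partial_deriv_eq)
qed

lemma integration_by_parts:
  fixes f \<psi> :: "real^'n \<Rightarrow> 'b::euclidean_space"
  assumes U: "open U" and f: "\<And>x. f differentiable (at x)" "continuous_on UNIV (partial_deriv i f)"
    and \<psi>: "\<psi> \<in> test_functions U"
  shows "(\<integral>x. partial_deriv i f x \<bullet> \<psi> x + f x \<bullet> partial_deriv i \<psi> x \<partial>lebesgue_on U) = 0"
proof -
  define C where "C = closure {x. \<psi> x \<noteq> 0}"
  have C: "compact C" "C \<subseteq> U" using \<psi> by (auto simp: test_functions_def C_def)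
  note s = test_function_smooth[OF \<psi>]
  have \<psi>0: "\<psi> x = 0" if "x \<notin> C" for x
    using that closure_subset[of "{x. \<psi> x \<noteq> 0}"] by (auto simp: C_def)
  let ?g = "\<lambda>x. f x \<bullet> \<psi> x"
  have pd: "partial_deriv i ?g x = partial_deriv i f x \<bullet> \<psi> x + f x \<bullet> partial_deriv i \<psi> x" for x
    by (rule partial_deriv_bilinear[OF bounded_bilinear_inner f(1) smooth_differentiable[OF s]])
  have fc: "continuous_on UNIV f"
    using f(1) by (simp add: continuous_at_imp_continuous_on differentiable_imp_continuous_within)
  have gd: "?g differentiable (at x)" for x
    using bounded_bilinear.FDERIV[OF bounded_bilinear_inner f(1)[unfolded frechet_derivative_works] smooth_has_derivative[OF s]]
    by (auto simp: differentiable_def)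
  have gc: "continuous_on UNIV (partial_deriv i ?g)"
    unfolding pd[abs_def]
    by (intro continuous_intros fc f(2) smooth_continuous_on s smooth_partial_deriv)
  have "(\<integral>x. partial_deriv i ?g x \<partial>lebesgue_on U) = (\<integral>x. indicator U x *\<^sub>R partial_deriv i ?g x \<partial>lebesgue)"
    using U by (subst integral_restrict_space) auto
  also have "(\<lambda>x. indicator U x *\<^sub>R partial_deriv i ?g x) = partial_deriv i ?g"
    using partial_deriv_eq_0_off_support[OF compact_imp_closed[OF C(1)], of ?g] \<psi>0 C(2)
    by (fastforce simp: fun_eq_iff split: split_indicator)
  also have "(\<integral>x. partial_deriv i ?g x \<partial>lebesgue) = (\<integral>x. partial_deriv i ?g x \<partial>lborel)"
    using borel_measurable_continuous_onI[OF gc] by (intro integral_completion) simp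
  also have "\<dots> = 0"
    by (rule integral_partial_deriv_compact_support[OF gd gc C(1)]) (simp add: \<psi>0)
  finally show ?thesis by (simp add: pd)
qed

section \<open>The Poincare inequality and the dual norm\<close>

context bounded_open_domain
begin

text \<open>Integrating \<open>\<partial>\<^sub>i (x\<^sub>i \<bar>\<phi>\<bar>\<^sup>2) = \<bar>\<phi>\<bar>\<^sup>2 + 2 x\<^sub>i \<phi> \<cdot> \<partial>\<^sub>i \<phi>\<close> bounds the field by its gradient.\<close>

lemma poincare_test_function:
  fixes \<phi> :: "real^'n \<Rightarrow> 'b::euclidean_space"
  assumes \<phi>: "\<phi> \<in> test_functions \<Omega>" and R: "\<And>x. x \<in> \<Omega> \<Longrightarrow> norm x \<le> R" "0 < R"
  shows "L2norm \<Omega> \<phi> \<le> 2 * R * L2norm \<Omega> (grad \<phi>)"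
proof -
  define i where "i = (undefined :: 'n)"
  let ?d = "partial_deriv i \<phi>"
  note s = test_function_smooth[OF \<phi>]
  have L: "\<phi> \<in> L2 \<Omega>" "?d \<in> L2 \<Omega>" "grad \<phi> \<in> L2 \<Omega>"
    by (intro smooth_L2 s smooth_partial_deriv smooth_grad)+
  have xi: "((\<lambda>x. x $ i) has_derivative (\<lambda>h. h $ i)) (at x)" for x :: "real^'n"
    by (rule bounded_linear.has_derivative[OF bounded_linear_vec_nth has_derivative_ident])
  have fpd: "partial_deriv i (\<lambda>x. x $ i *\<^sub>R \<phi> x) x = \<phi> x + x $ i *\<^sub>R ?d x" for x
    using partial_deriv_bilinear[OF bounded_bilinear_scaleR _ smooth_differentiable[OF s], of "\<lambda>x. x $ i" x i]
      partial_deriv_eq[OF xi, of i x] xi by (auto simp: differentiable_def)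
  have "continuous_on UNIV (\<lambda>x. \<phi> x + x $ i *\<^sub>R ?d x)"
    by (intro continuous_intros smooth_continuous_on s smooth_partial_deriv)
  then have fc: "continuous_on UNIV (partial_deriv i (\<lambda>x. x $ i *\<^sub>R \<phi> x))" unfolding fpd[abs_def] .
  have fd: "(\<lambda>x. x $ i *\<^sub>R \<phi> x) differentiable (at x)" for x
    using bounded_bilinear.FDERIV[OF bounded_bilinear_scaleR xi smooth_has_derivative[OF s]]
    by (auto simp: differentiable_def)
  let ?I = "\<lambda>x. (\<phi> x + x $ i *\<^sub>R ?d x) \<bullet> \<phi> x + x $ i *\<^sub>R \<phi> x \<bullet> ?d x"
  have I0: "(\<integral>x. ?I x \<partial>lebesgue_on \<Omega>) = 0"
    using integration_by_parts[OF open_domain fd fc \<phi>] by (simp add: fpd)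
  have Ii: "integrable (lebesgue_on \<Omega>) ?I"
    by (intro L2_integrable continuous_L2 continuous_intros smooth_continuous_on s smooth_partial_deriv)
  have pt: "\<phi> x \<bullet> \<phi> x \<le> 2 * ?I x + 4 * R\<^sup>2 * (grad \<phi> x \<bullet> grad \<phi> x)" if x: "x \<in> \<Omega>" for x
  proof -
    have "\<bar>x $ i * (\<phi> x \<bullet> ?d x)\<bar> \<le> R * (norm (\<phi> x) * norm (grad \<phi> x))"
      unfolding abs_mult
      using component_le_norm_cart[of x i] R(1)[OF x] R(2) Cauchy_Schwarz_ineq2[of "\<phi> x" "?d x"]
        mult_left_mono[OF norm_partial_deriv_le_grad[of i \<phi> x], of "norm (\<phi> x)"]
      by (intro mult_mono) auto
    moreover have "4 * (R * (norm (\<phi> x) * norm (grad \<phi> x))) \<le> (norm (\<phi> x))\<^sup>2 + 4 * R\<^sup>2 * (norm (grad \<phi> x))\<^sup>2"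
      using zero_le_power2[of "norm (\<phi> x) - 2 * R * norm (grad \<phi> x)"]
      by (simp add: power2_eq_square algebra_simps)
    moreover have "?I x = \<phi> x \<bullet> \<phi> x + 2 * (x $ i * (\<phi> x \<bullet> ?d x))"
      by (simp add: inner_add_left inner_add_right inner_commute)
    ultimately show ?thesis
      unfolding power2_norm_eq_inner by (simp add: abs_le_iff)
  qed
  have i1: "integrable (lebesgue_on \<Omega>) (\<lambda>x. 2 * ?I x)"
    by (rule Bochner_Integration.integrable_mult_right[OF Ii])
  have i2: "integrable (lebesgue_on \<Omega>) (\<lambda>x. 4 * R\<^sup>2 * (grad \<phi> x \<bullet> grad \<phi> x))"
    by (rule Bochner_Integration.integrable_mult_right[OF L2_inner_integrable[OF L(3,3)]])
  have "ip \<Omega> \<phi> \<phi> \<le> (\<integral>x. 2 * ?I x + 4 * R\<^sup>2 * (grad \<phi> x \<bullet> grad \<phi> x) \<partial>lebesgue_on \<Omega>)"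
    unfolding ip_def
    by (rule integral_mono[OF L2_inner_integrable[OF L(1,1)] Bochner_Integration.integrable_add[OF i1 i2]])
      (use pt in simp)
  also have "\<dots> = 2 * (\<integral>x. ?I x \<partial>lebesgue_on \<Omega>) + 4 * R\<^sup>2 * ip \<Omega> (grad \<phi>) (grad \<phi>)"
    unfolding ip_def Bochner_Integration.integral_add[OF i1 i2] by (simp only: integral_mult_right_zero)
  also have "\<dots> = 4 * R\<^sup>2 * ip \<Omega> (grad \<phi>) (grad \<phi>)"
    unfolding I0 by simp
  finally have "(L2norm \<Omega> \<phi>)\<^sup>2 \<le> (2 * R * L2norm \<Omega> (grad \<phi>))\<^sup>2"
    by (simp add: power2_L2norm power_mult_distrib)
  then show ?thesis
    by (rule power2_le_imp_le) (use R(2) L2norm_ge_0[of \<Omega> "grad \<phi>"] in simp)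
qed

lemma poincare_H10:
  fixes u :: "real^'n \<Rightarrow> 'b::euclidean_space"
  assumes u: "u \<in> H10 \<Omega>" and R: "\<And>x. x \<in> \<Omega> \<Longrightarrow> norm x \<le> R" "0 < R"
  shows "L2norm \<Omega> u \<le> 2 * R * L2norm \<Omega> (wgrad \<Omega> u)"
proof -
  obtain \<phi> where \<phi>: "\<And>m. \<phi> m \<in> test_functions \<Omega>" "(\<lambda>m. L2norm \<Omega> (\<lambda>x. u x - \<phi> m x)) \<longlonglongrightarrow> 0"
    "(\<lambda>m. L2norm \<Omega> (\<lambda>x. wgrad \<Omega> u x - grad (\<phi> m) x)) \<longlonglongrightarrow> 0"
    using u by (auto simp: H10_def)
  note H = H10_H1[OF u] and s = test_function_smooth[OF \<phi>(1)]
  let ?a = "\<lambda>m. L2norm \<Omega> (\<lambda>x. u x - \<phi> m x)" and ?b = "\<lambda>m. L2norm \<Omega> (\<lambda>x. wgrad \<Omega> u x - grad (\<phi> m) x)"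
  have le: "L2norm \<Omega> u \<le> ?a m + 2 * R * (?b m + L2norm \<Omega> (wgrad \<Omega> u))" for m
  proof -
    have "L2norm \<Omega> u \<le> ?a m + L2norm \<Omega> (\<phi> m)"
      using L2norm_triangle[OF L2_diff[OF H1_L2[OF H] smooth_L2[OF s]] smooth_L2[OF s], of m m] by simp
    also have "L2norm \<Omega> (\<phi> m) \<le> 2 * R * L2norm \<Omega> (grad (\<phi> m))"
      by (rule poincare_test_function[OF \<phi>(1) R])
    also have "L2norm \<Omega> (grad (\<phi> m)) \<le> ?b m + L2norm \<Omega> (wgrad \<Omega> u)"
    proof -
      have "?b m = L2norm \<Omega> (\<lambda>x. (-1) *\<^sub>R (wgrad \<Omega> u x - grad (\<phi> m) x))"
        unfolding L2norm_scaleR by simp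
      then show ?thesis
        using L2norm_triangle[OF L2_diff[OF smooth_L2[OF smooth_grad[OF s]] wgrad_L2[OF H]] wgrad_L2[OF H], of m]
        by simp
    qed
    finally show ?thesis using R(2) by simp
  qed
  have "(\<lambda>m. ?a m + 2 * R * (?b m + L2norm \<Omega> (wgrad \<Omega> u))) \<longlonglongrightarrow> 0 + 2 * R * (0 + L2norm \<Omega> (wgrad \<Omega> u))"
    by (intro tendsto_intros \<phi>)
  from LIMSEQ_le_const[OF this] le show ?thesis by auto
qed

text \<open>The supremum that defines the dual norm is bounded by the \<open>L\<^sup>2\<close> norm of the functional. It ranges over
  fields of nonzero norm only, but for the others the pairing vanishes.\<close>

lemma ip_le_dual_norm:
  fixes f :: "real^'n \<Rightarrow> 'b::euclidean_space"
  assumes f: "f \<in> L2 \<Omega>" and v: "v \<in> H10 \<Omega>"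
  shows "\<bar>ip \<Omega> f v\<bar> \<le> Hm1norm \<Omega> f * H1norm \<Omega> v"
proof -
  have le: "L2norm \<Omega> w \<le> H1norm \<Omega> w" for w :: "real^'n \<Rightarrow> 'b"
    unfolding H1norm_def by (rule real_le_rsqrt) simp
  have ge0: "0 \<le> H1norm \<Omega> w" for w :: "real^'n \<Rightarrow> 'b"
    by (simp add: H1norm_def)
  have b: "\<bar>ip \<Omega> f w\<bar> \<le> L2norm \<Omega> f * H1norm \<Omega> w" if "w \<in> H10 \<Omega>" for w
    using cauchy_schwarz_L2[OF f H1_L2[OF H10_H1[OF that]]] mult_left_mono[OF le[of w] L2norm_ge_0[of \<Omega> f]]
    by linarith
  show ?thesis
  proof (cases "H1norm \<Omega> v = 0")
    case True
    with b[OF v] show ?thesis by simp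
  next
    case False
    let ?Q = "{\<bar>ip \<Omega> f v\<bar> / H1norm \<Omega> v |v. v \<in> H10 \<Omega> \<and> H1norm \<Omega> v \<noteq> 0}"
    have "bdd_above ?Q"
    proof (rule bdd_aboveI[of _ "L2norm \<Omega> f"])
      fix q assume "q \<in> ?Q"
      then obtain w where w: "q = \<bar>ip \<Omega> f w\<bar> / H1norm \<Omega> w" "w \<in> H10 \<Omega>" "H1norm \<Omega> w \<noteq> 0" by auto
      with b[OF w(2)] ge0[of w] show "q \<le> L2norm \<Omega> f" by (simp add: divide_le_eq)
    qed
    then have "\<bar>ip \<Omega> f v\<bar> / H1norm \<Omega> v \<le> Hm1norm \<Omega> f"
      unfolding Hm1norm_def using v False by (intro cSup_upper) auto
    with False ge0[of v] show ?thesis by (simp add: divide_le_eq)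
  qed
qed

lemma young_product:
  fixes a b k :: real
  assumes "0 < k" shows "2 * (a * b) \<le> a\<^sup>2 / k + k * b\<^sup>2"
proof -
  have "0 \<le> (a - k * b)\<^sup>2 / k" using assms by simp
  also have "\<dots> = a\<^sup>2 / k + k * b\<^sup>2 - 2 * (a * b)"
    using assms by (simp add: power2_eq_square field_simps)
  finally show ?thesis by simp
qed

text \<open>Young's inequality is weighted such that, after the Poincare inequality, the gradient enters with
  exactly the viscosity that half of the dissipation can absorb.\<close>

lemma forcing_estimate:
  fixes f :: "real^'n \<Rightarrow> 'b::euclidean_space"
  assumes f: "f \<in> L2 \<Omega>" and v: "v \<in> H10 \<Omega>" and R: "\<And>x. x \<in> \<Omega> \<Longrightarrow> norm x \<le> R" "0 < R"
    and \<nu>: "0 < \<nu>"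
  shows "2 * ip \<Omega> f v \<le> 1 / \<nu> * (L2norm \<Omega> (wgrad \<Omega> v))\<^sup>2 + (4 * R\<^sup>2 + 1) * (\<nu> * (Hm1norm \<Omega> f)\<^sup>2)"
proof -
  let ?F = "Hm1norm \<Omega> f" and ?G = "L2norm \<Omega> (wgrad \<Omega> v)" and ?c = "4 * R\<^sup>2 + 1"
  have c: "?c > 0" by (simp add: add_nonneg_pos)
  have "(L2norm \<Omega> v)\<^sup>2 \<le> (2 * R * ?G)\<^sup>2"
    using poincare_H10[OF v R] L2norm_ge_0 by (intro power_mono) auto
  then have H: "(H1norm \<Omega> v)\<^sup>2 \<le> ?c * ?G\<^sup>2"
    unfolding H1norm_def by (simp add: power_mult_distrib algebra_simps)
  have "2 * ip \<Omega> f v \<le> 2 * (?F * H1norm \<Omega> v)"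
    using ip_le_dual_norm[OF f v] by simp
  also have "\<dots> \<le> (H1norm \<Omega> v)\<^sup>2 / (\<nu> * ?c) + ?c * \<nu> * ?F\<^sup>2"
    using young_product[of "\<nu> * ?c" "H1norm \<Omega> v" ?F] \<nu> c by (simp only: mult_pos_pos mult_ac)
  also have "(H1norm \<Omega> v)\<^sup>2 / (\<nu> * ?c) \<le> ?c * ?G\<^sup>2 / (\<nu> * ?c)"
    using H \<nu> c by (intro divide_right_mono) auto
  also have "?c * ?G\<^sup>2 / (\<nu> * ?c) = 1 / \<nu> * ?G\<^sup>2"
    using c by simp
  finally show ?thesis by (simp add: mult.assoc)
qed

end

section \<open>Polynomials\<close>

lemma finite_multi_indices: "finite {\<alpha> :: 'n::finite \<Rightarrow> nat. (\<Sum>i\<in>UNIV. \<alpha> i) \<le> k}"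
proof (rule finite_subset)
  have "\<alpha> i \<le> k" if "(\<Sum>i\<in>UNIV. \<alpha> i) \<le> k" for \<alpha> :: "'n \<Rightarrow> nat" and i
    using that member_le_sum[of i UNIV \<alpha>] by simp
  then show "{\<alpha> :: 'n \<Rightarrow> nat. (\<Sum>i\<in>UNIV. \<alpha> i) \<le> k} \<subseteq> PiE UNIV (\<lambda>_. {..k})"
    by (auto simp: PiE_def)
qed (simp add: finite_PiE)

lemma poly_spaceE:
  assumes "p \<in> poly_space k"
  obtains c where "p = (\<lambda>x. \<Sum>\<alpha> | (\<Sum>i\<in>UNIV. \<alpha> i) \<le> k. (\<Prod>i\<in>UNIV. (x $ i) ^ \<alpha> i) *\<^sub>R c \<alpha>)"
  using assms by (auto simp: poly_space_def)

lemma subspace_poly_space: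
  "subspace_of_fields (poly_space k :: (real^'n \<Rightarrow> 'b::euclidean_space) set)"
  unfolding subspace_of_fields_def
proof (intro ballI allI)
  fix p q :: "real^'n \<Rightarrow> 'b" and a b :: real
  assume "p \<in> poly_space k" "q \<in> poly_space k"
  then obtain c d
    where "p = (\<lambda>x. \<Sum>\<alpha> | (\<Sum>i\<in>UNIV. \<alpha> i) \<le> k. (\<Prod>i\<in>UNIV. (x $ i) ^ \<alpha> i) *\<^sub>R c \<alpha>)"
      "q = (\<lambda>x. \<Sum>\<alpha> | (\<Sum>i\<in>UNIV. \<alpha> i) \<le> k. (\<Prod>i\<in>UNIV. (x $ i) ^ \<alpha> i) *\<^sub>R d \<alpha>)"
    by (auto simp: poly_space_def)
  then have "(\<lambda>x. a *\<^sub>R p x + b *\<^sub>R q x)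
      = (\<lambda>x. \<Sum>\<alpha> | (\<Sum>i\<in>UNIV. \<alpha> i) \<le> k. (\<Prod>i\<in>UNIV. (x $ i) ^ \<alpha> i) *\<^sub>R (a *\<^sub>R c \<alpha> + b *\<^sub>R d \<alpha>))"
    by (simp add: scaleR_sum_right sum.distrib[symmetric] algebra_simps)
  then show "(\<lambda>x. a *\<^sub>R p x + b *\<^sub>R q x) \<in> poly_space k"
    unfolding poly_space_def by (intro CollectI exI[of _ "\<lambda>\<alpha>. a *\<^sub>R c \<alpha> + b *\<^sub>R d \<alpha>"])
qed

lemma monomial_poly_space:
  assumes "(\<Sum>i\<in>UNIV. \<alpha> i) \<le> k"
  shows "(\<lambda>x. (\<Prod>i\<in>UNIV. (x $ i) ^ \<alpha> i) *\<^sub>R c) \<in> poly_space k"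
proof -
  have "(\<Prod>i\<in>UNIV. (x $ i) ^ \<alpha> i) *\<^sub>R c
      = (\<Sum>\<beta> | (\<Sum>i\<in>UNIV. \<beta> i) \<le> k. (\<Prod>i\<in>UNIV. (x $ i) ^ \<beta> i) *\<^sub>R (if \<beta> = \<alpha> then c else 0))" for x
    using assms by (simp add: if_distrib sum.delta'[OF finite_multi_indices] sum.delta[OF finite_multi_indices] cong: if_cong)
  then show ?thesis
    unfolding poly_space_def by (intro CollectI exI[of _ "\<lambda>\<beta>. if \<beta> = \<alpha> then c else 0"] ext)
qed

lemma zero_poly_space: "(\<lambda>x. 0) \<in> poly_space k"
  using monomial_poly_space[of "\<lambda>i. 0" k 0] by simp

lemma poly_space_sum: "(\<And>s. s \<in> A \<Longrightarrow> p s \<in> poly_space k) \<Longrightarrow> (\<lambda>x. \<Sum>s\<in>A. p s x) \<in> poly_space k"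
proof (induction A rule: infinite_finite_induct)
  case (insert s A)
  then show ?case
    using subspace_of_fieldsD[OF subspace_poly_space, of "p s" k "\<lambda>x. \<Sum>s\<in>A. p s x" 1 1] by simp
qed (simp_all add: zero_poly_space)

lemma poly_space_linear_image:
  assumes T: "bounded_linear T" and p: "p \<in> poly_space k"
  shows "(\<lambda>x. T (p x)) \<in> poly_space k"
proof -
  obtain c where p: "p = (\<lambda>x. \<Sum>\<alpha> | (\<Sum>i\<in>UNIV. \<alpha> i) \<le> k. (\<Prod>i\<in>UNIV. (x $ i) ^ \<alpha> i) *\<^sub>R c \<alpha>)"
    by (rule poly_spaceE[OF p])
  have "(\<lambda>x. T (p x)) = (\<lambda>x. \<Sum>\<alpha> | (\<Sum>i\<in>UNIV. \<alpha> i) \<le> k. (\<Prod>i\<in>UNIV. (x $ i) ^ \<alpha> i) *\<^sub>R T (c \<alpha>))"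
    unfolding p by (simp add: linear_sum[OF bounded_linear.linear[OF T]] linear_scale[OF bounded_linear.linear[OF T]])
  then show ?thesis
    unfolding poly_space_def by (intro CollectI exI[of _ "\<lambda>\<alpha>. T (c \<alpha>)"])
qed

lemma monomial_has_derivative:
  fixes x :: "real^'n"
  shows "((\<lambda>x. \<Prod>i\<in>UNIV. (x $ i) ^ \<alpha> i) has_derivative
    (\<lambda>h. \<Sum>i\<in>UNIV. (real (\<alpha> i) * (h $ i * (x $ i) ^ (\<alpha> i - 1))) * (\<Prod>l\<in>UNIV - {i}. (x $ l) ^ \<alpha> l))) (at x)"
proof (rule has_derivative_prod)
  fix i :: 'n
  have "((\<lambda>x. x $ i) has_derivative (\<lambda>h. h $ i)) (at x)"
    by (rule bounded_linear.has_derivative[OF bounded_linear_vec_nth has_derivative_ident])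
  from has_derivative_power[OF this, of "\<alpha> i"]
  show "((\<lambda>x. x $ i ^ \<alpha> i) has_derivative (\<lambda>h. real (\<alpha> i) * (h $ i * (x $ i) ^ (\<alpha> i - 1)))) (at x)"
    by (simp add: mult_ac)
qed

lemma poly_space_deriv:
  fixes p :: "real^'n \<Rightarrow> 'b::euclidean_space"
  assumes "p \<in> poly_space k"
  shows "p differentiable (at x)" "partial_deriv j p \<in> poly_space (k - 1)"
proof -
  let ?M = "{\<alpha> :: 'n \<Rightarrow> nat. (\<Sum>i\<in>UNIV. \<alpha> i) \<le> k}"
  obtain c where p: "p = (\<lambda>x. \<Sum>\<alpha>\<in>?M. (\<Prod>i\<in>UNIV. (x $ i) ^ \<alpha> i) *\<^sub>R c \<alpha>)"
    by (rule poly_spaceE[OF assms])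
  let ?D = "\<lambda>x h. \<Sum>\<alpha>\<in>?M. (\<Sum>i\<in>UNIV. (real (\<alpha> i) * (h $ i * (x $ i) ^ (\<alpha> i - 1))) * (\<Prod>l\<in>UNIV - {i}. (x $ l) ^ \<alpha> l)) *\<^sub>R c \<alpha>"
  have D: "(p has_derivative ?D x) (at x)" for x
    unfolding p by (intro has_derivative_sum has_derivative_scaleR_left monomial_has_derivative)
  then show "p differentiable (at x)" by (auto simp: differentiable_def)
  have "partial_deriv j p = (\<lambda>x. \<Sum>\<alpha>\<in>?M. (\<Prod>i\<in>UNIV. (x $ i) ^ (\<alpha>(j := \<alpha> j - 1)) i) *\<^sub>R (real (\<alpha> j) *\<^sub>R c \<alpha>))"
  proof
    fix x
    have "(\<Sum>i\<in>UNIV. (real (\<alpha> i) * (axis j 1 $ i * (x $ i) ^ (\<alpha> i - 1))) * (\<Prod>l\<in>UNIV - {i}. (x $ l) ^ \<alpha> l))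
        = (\<Prod>i\<in>UNIV. (x $ i) ^ (\<alpha>(j := \<alpha> j - 1)) i) * real (\<alpha> j)" for \<alpha> :: "'n \<Rightarrow> nat"
    proof -
      have "(\<Sum>i\<in>UNIV. (real (\<alpha> i) * (axis j 1 $ i * (x $ i) ^ (\<alpha> i - 1))) * (\<Prod>l\<in>UNIV - {i}. (x $ l) ^ \<alpha> l))
          = (\<Sum>i\<in>UNIV. if i = j then (real (\<alpha> j) * (x $ j) ^ (\<alpha> j - 1)) * (\<Prod>l\<in>UNIV - {j}. (x $ l) ^ \<alpha> l) else 0)"
        by (rule sum.cong) (auto simp: axis_def)
      moreover have "(\<Prod>i\<in>UNIV. (x $ i) ^ (\<alpha>(j := \<alpha> j - 1)) i)
          = (x $ j) ^ (\<alpha> j - 1) * (\<Prod>l\<in>UNIV - {j}. (x $ l) ^ \<alpha> l)"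
        by (subst prod.remove[of UNIV j]) auto
      ultimately show ?thesis by simp
    qed
    then show "partial_deriv j p x = (\<Sum>\<alpha>\<in>?M. (\<Prod>i\<in>UNIV. (x $ i) ^ (\<alpha>(j := \<alpha> j - 1)) i) *\<^sub>R (real (\<alpha> j) *\<^sub>R c \<alpha>))"
      unfolding partial_deriv_eq[OF D] by simp
  qed
  also have "\<dots> \<in> poly_space (k - 1)"
  proof (rule poly_space_sum)
    fix \<alpha> :: "'n \<Rightarrow> nat" assume \<alpha>: "\<alpha> \<in> ?M"
    show "(\<lambda>x. (\<Prod>i\<in>UNIV. (x $ i) ^ (\<alpha>(j := \<alpha> j - 1)) i) *\<^sub>R (real (\<alpha> j) *\<^sub>R c \<alpha>)) \<in> poly_space (k - 1)"
    proof (cases "\<alpha> j = 0")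
      case False
      have "(\<Sum>i\<in>UNIV. \<alpha> i) = \<alpha> j + (\<Sum>i\<in>UNIV - {j}. \<alpha> i)"
        by (rule sum.remove) auto
      moreover have "(\<Sum>i\<in>UNIV. (\<alpha>(j := \<alpha> j - 1)) i) = (\<alpha> j - 1) + (\<Sum>i\<in>UNIV - {j}. \<alpha> i)"
        by (subst sum.remove[of UNIV j]) auto
      ultimately have "(\<Sum>i\<in>UNIV. (\<alpha>(j := \<alpha> j - 1)) i) \<le> k - 1" using \<alpha> False by simp
      then show ?thesis by (rule monomial_poly_space)
    qed (simp add: zero_poly_space)
  qed
  finally show "partial_deriv j p \<in> poly_space (k - 1)" .
qed

lemma poly_space_smooth: "p \<in> poly_space k \<Longrightarrow> smooth p"
  by (rule smooth_coinduct[where F = "\<Union>k. poly_space k"]) (auto intro: poly_space_deriv)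

section \<open>Piecewise polynomials on a mesh\<close>

lemma subspace_piecewise_poly:
  "subspace_of_fields (piecewise_poly Th k :: (real^'n \<Rightarrow> 'b::euclidean_space) set)"
  unfolding subspace_of_fields_def
proof (intro ballI allI)
  fix u v :: "real^'n \<Rightarrow> 'b" and a b :: real
  assume u: "u \<in> piecewise_poly Th k" and v: "v \<in> piecewise_poly Th k"
  show "(\<lambda>x. a *\<^sub>R u x + b *\<^sub>R v x) \<in> piecewise_poly Th k"
    unfolding piecewise_poly_def
  proof (intro CollectI ballI)
    fix K assume "K \<in> Th"
    with u v obtain p q where p: "p \<in> poly_space k" "AE x in lebesgue_on K. u x = p x"
      and q: "q \<in> poly_space k" "AE x in lebesgue_on K. v x = q x"
      unfolding piecewise_poly_def by blast
    have "AE x in lebesgue_on K. a *\<^sub>R u x + b *\<^sub>R v x = a *\<^sub>R p x + b *\<^sub>R q x"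
      using p(2) q(2) by eventually_elim simp
    then show "\<exists>p\<in>poly_space k. AE x in lebesgue_on K. a *\<^sub>R u x + b *\<^sub>R v x = p x"
      by (rule bexI[OF _ subspace_of_fieldsD[OF subspace_poly_space p(1) q(1)]])
  qed
qed

lemma subspace_of_fields_Int:
  "subspace_of_fields V \<Longrightarrow> subspace_of_fields W \<Longrightarrow> subspace_of_fields (V \<inter> W)"
  by (simp add: subspace_of_fields_def)

lemma simplicial_mesh_finite: "simplicial_mesh \<Omega> Th \<Longrightarrow> finite Th"
  by (simp add: simplicial_mesh_def triangulation_def)

lemma simplicial_mesh_cell:
  assumes "simplicial_mesh \<Omega> Th" "K \<in> Th"
  shows "compact K" "convex K" "K \<in> sets lebesgue" "K \<subseteq> closure \<Omega>"
proof -
  have K: "int CARD('a) simplex K" using assms by (auto simp: simplicial_mesh_def)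
  from compact_simplex[OF K] show "compact K" .
  then show "K \<in> sets lebesgue" by (simp add: compact_imp_closed)
  from convex_simplex[OF K] show "convex K" .
  show "K \<subseteq> closure \<Omega>" using assms by (auto simp: simplicial_mesh_def)
qed

lemma AE_lebesgue_onI_mesh:
  assumes mesh: "simplicial_mesh \<Omega> Th" and \<Omega>: "open \<Omega>"
    and P: "\<And>K. K \<in> Th \<Longrightarrow> AE x in lebesgue_on K. P K x"
  shows "AE x in lebesgue_on \<Omega>. \<forall>K\<in>Th. x \<in> K \<longrightarrow> P K x"
proof -
  have "AE x in lebesgue. x \<in> K \<longrightarrow> P K x" if "K \<in> Th" for K
    using P[OF that] simplicial_mesh_cell(3)[OF mesh that] by (simp add: AE_restrict_space_iff)
  then have "AE x in lebesgue. \<forall>K\<in>Th. x \<in> K \<longrightarrow> P K x"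
    using simplicial_mesh_finite[OF mesh] by (simp add: AE_finite_all)
  then have "AE x in lebesgue. x \<in> \<Omega> \<longrightarrow> (\<forall>K\<in>Th. x \<in> K \<longrightarrow> P K x)"
    by eventually_elim simp
  moreover have "\<Omega> \<in> sets lebesgue" using \<Omega> by auto
  ultimately show ?thesis by (simp add: AE_restrict_space_iff)
qed

lemma simplicial_mesh_covers: "simplicial_mesh \<Omega> Th \<Longrightarrow> x \<in> \<Omega> \<Longrightarrow> \<exists>K\<in>Th. x \<in> K"
  using closure_subset[of \<Omega>] by (auto simp: simplicial_mesh_def)

text \<open>This is why the trilinear Lorentz and Ohm terms are integrable.\<close>

lemma piecewise_poly_bounded:
  fixes v :: "real^'n \<Rightarrow> 'b::euclidean_space"
  assumes mesh: "simplicial_mesh \<Omega> Th" and \<Omega>: "open \<Omega>" and v: "v \<in> piecewise_poly Th k"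
  obtains M where "AE x in lebesgue_on \<Omega>. norm (v x) \<le> M"
proof -
  have "\<exists>B. AE x in lebesgue_on K. norm (v x) \<le> B" if K: "K \<in> Th" for K
  proof -
    obtain p where p: "p \<in> poly_space k" "AE x in lebesgue_on K. v x = p x"
      using v K unfolding piecewise_poly_def by blast
    have "compact (p ` K)"
      by (intro compact_continuous_image smooth_continuous_on[OF poly_space_smooth[OF p(1)]]
          simplicial_mesh_cell[OF mesh K])
    then obtain B where B: "\<And>x. x \<in> K \<Longrightarrow> norm (p x) \<le> B"
      using compact_imp_bounded bounded_iff by (metis imageI)
    have "AE x in lebesgue_on K. x \<in> K" by (intro AE_I2) simp
    with p(2) have "AE x in lebesgue_on K. norm (v x) \<le> B"
      by eventually_elim (simp add: B)
    then show ?thesis by blast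
  qed
  then obtain B where B: "\<And>K. K \<in> Th \<Longrightarrow> AE x in lebesgue_on K. norm (v x) \<le> B K" by metis
  have "AE x in lebesgue_on \<Omega>. x \<in> \<Omega>" by (intro AE_I2) simp
  moreover have "AE x in lebesgue_on \<Omega>. \<forall>K\<in>Th. x \<in> K \<longrightarrow> norm (v x) \<le> B K"
    by (rule AE_lebesgue_onI_mesh[OF mesh \<Omega> B])
  ultimately have "AE x in lebesgue_on \<Omega>. norm (v x) \<le> (\<Sum>K\<in>Th. \<bar>B K\<bar>)"
  proof eventually_elim
    case (elim x)
    with simplicial_mesh_covers[OF mesh] obtain K where K: "K \<in> Th" "norm (v x) \<le> B K" by blast
    note K(2)
    also have "B K \<le> \<bar>B K\<bar>" by simp
    also have "\<dots> \<le> (\<Sum>K\<in>Th. \<bar>B K\<bar>)"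
      using simplicial_mesh_finite[OF mesh] K(1) by (intro member_le_sum) auto
    finally show ?case .
  qed
  then show ?thesis by (rule that)
qed

text \<open>A cell lies in \<open>closure \<Omega>\<close>, which might in general fill slits of \<open>\<Omega>\<close>. A Lipschitz boundary
  excludes this: points just below the graph are exterior points.\<close>

lemma interior_closure_lipschitz:
  fixes \<Omega> :: "(real^'n) set"
  assumes \<Omega>: "open \<Omega>" and lip: "lipschitz_boundary \<Omega>"
  shows "interior (closure \<Omega>) \<subseteq> \<Omega>"
proof
  fix x assume x: "x \<in> interior (closure \<Omega>)"
  show "x \<in> \<Omega>"
  proof (rule ccontr)
    assume nx: "x \<notin> \<Omega>"
    with x interior_subset[of "closure \<Omega>"] \<Omega> have "x \<in> frontier \<Omega>"
      by (auto simp: frontier_def interior_open)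
    with lip obtain e r L g where e: "norm e = 1" and r: "0 < r" and g: "L-lipschitz_on UNIV (g :: real^'n \<Rightarrow> real)"
      and eq: "\<Omega> \<inter> ball x r = {y \<in> ball x r. g (y - (y \<bullet> e) *\<^sub>R e) < y \<bullet> e}"
      unfolding lipschitz_boundary_def by blast
    have le: "x \<bullet> e \<le> g (x - (x \<bullet> e) *\<^sub>R e)" 
    proof (rule ccontr)
      assume "\<not> ?thesis"
      then have "x \<in> {y \<in> ball x r. g (y - (y \<bullet> e) *\<^sub>R e) < y \<bullet> e}" using r by simp
      then have "x \<in> \<Omega>" unfolding eq[symmetric] by simp
      with nx show False by simp
    qed
    obtain r' where r': "r' > 0" "ball x r' \<subseteq> closure \<Omega>"
      using x by (meson mem_interior)
    \<comment> \<open>a point below \<open>x\<close> that is close enough for both neighbourhoods\<close>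
    define s where "s = min r r' / 2"
    have s: "0 < s" "s < r" "s < r'" using r r' by (auto simp: s_def)
    define y where "y = x - s *\<^sub>R e"
    have ee: "e \<bullet> e = 1" using e by (simp add: norm_eq_1)
    have y: "y \<bullet> e = x \<bullet> e - s" by (simp add: y_def inner_diff_left ee)
    have yx: "y - (y \<bullet> e) *\<^sub>R e = x - (x \<bullet> e) *\<^sub>R e" by (simp add: y) (simp add: y_def algebra_simps)
    have dy: "dist x y = s" using s e by (simp add: y_def dist_norm)
    define W where "W = ball x r \<inter> {z. z \<bullet> e < g (z - (z \<bullet> e) *\<^sub>R e)}"
    have "continuous_on UNIV (\<lambda>z. g (z - (z \<bullet> e) *\<^sub>R e))"
      by (rule continuous_on_compose2[OF lipschitz_on_continuous_on[OF g]]) (auto intro!: continuous_intros)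
    then have "open W"
      unfolding W_def by (intro open_Int open_ball open_Collect_less continuous_intros)
    moreover have "W \<inter> \<Omega> = {}" 
    proof -
      have False if "z \<in> W" "z \<in> \<Omega>" for z
      proof -
        have "z \<in> \<Omega> \<inter> ball x r" using that by (simp add: W_def)
        then have "g (z - (z \<bullet> e) *\<^sub>R e) < z \<bullet> e" unfolding eq by simp
        with that(1) show False by (simp add: W_def)
      qed
      then show ?thesis by blast
    qed
    ultimately have "W \<inter> closure \<Omega> = {}" by (simp add: open_Int_closure_eq_empty)
    moreover have "y \<in> W" unfolding W_def using le s dy by (simp add: yx) (simp add: y)
    moreover have "y \<in> closure \<Omega>" using r'(2) s dy by auto
    ultimately show False by blast
  qed
qed

section \<open>The curl maps the electric space into the magnetic space\<close>

lemma L2_subset: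
  fixes f :: "real^'n \<Rightarrow> 'b::euclidean_space"
  assumes f: "f \<in> L2 \<Omega>" and U: "U \<subseteq> \<Omega>" "U \<in> sets lebesgue" and \<Omega>: "\<Omega> \<in> sets lebesgue"
  shows "f \<in> L2 U"
proof -
  have "f \<in> borel_measurable (lebesgue_on U)"
    using measurable_restrict_mono[OF L2_measurable[OF f] U(1)] .
  moreover have "integrable (lebesgue_on U) (\<lambda>x. (norm (f x))\<^sup>2)"
  proof -
    have "integrable lebesgue (\<lambda>x. indicator \<Omega> x *\<^sub>R (norm (f x))\<^sup>2)"
      using L2_integrable_power2[OF f] \<Omega> by (simp add: integrable_restrict_space)
    from integrable_mult_indicator[OF U(2) this]
    have "integrable lebesgue (\<lambda>x. indicator U x *\<^sub>R (norm (f x))\<^sup>2)"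
      by (rule Bochner_Integration.integrable_cong[THEN iffD1, rotated 2])
        (use U(1) in \<open>auto split: split_indicator\<close>)
    then show ?thesis using U(2) by (simp add: integrable_restrict_space)
  qed
  ultimately show ?thesis by (simp add: L2_def)
qed

lemma ip_supported:
  assumes U: "U \<subseteq> \<Omega>" "U \<in> sets lebesgue" and \<Omega>: "\<Omega> \<in> sets lebesgue" and 0: "\<And>x. x \<notin> U \<Longrightarrow> g x = 0"
  shows "ip \<Omega> f g = ip U f g"
proof -
  have "ip \<Omega> f g = (\<integral>x. indicator \<Omega> x *\<^sub>R (f x \<bullet> g x) \<partial>lebesgue)"
    unfolding ip_def using \<Omega> by (subst integral_restrict_space) auto
  also have "\<dots> = (\<integral>x. indicator U x *\<^sub>R (f x \<bullet> g x) \<partial>lebesgue)"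
    using U 0 by (intro Bochner_Integration.integral_cong) (auto split: split_indicator)
  also have "\<dots> = ip U f g"
    unfolding ip_def using U by (subst integral_restrict_space) auto
  finally show ?thesis .
qed

context cross_products
begin

text \<open>The classical formal adjoint of \<^term>\<open>curl vv\<close>: the vector curl of a scalar field in the plane,
  the curl itself in space. The sign comes from integration by parts.\<close>

definition adjoint_curl :: "(real^'n \<Rightarrow> 'e) \<Rightarrow> real^'n \<Rightarrow> real^'n" where
  "adjoint_curl p x = - (\<Sum>i\<in>UNIV. ev (partial_deriv i p x) (axis i 1))"

lemmas bounded_linear_ev = bounded_bilinear.bounded_linear_left[OF bilinear_ev]

lemma adjoint_curl_poly_space:
  assumes "p \<in> poly_space (Suc k)" shows "adjoint_curl p \<in> poly_space k"
proof -
  have "(\<lambda>x. \<Sum>i\<in>UNIV. ev (partial_deriv i p x) (axis i 1)) \<in> poly_space k"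
    using poly_space_deriv(2)[OF assms]
    by (intro poly_space_sum poly_space_linear_image[OF bounded_linear_ev]) simp
  from subspace_of_fields_scaleR[OF subspace_poly_space this, of "-1"]
  show ?thesis by (simp add: adjoint_curl_def[abs_def])
qed

lemma adjoint_curl_smooth:
  assumes "smooth p" shows "smooth (adjoint_curl p)"
  unfolding adjoint_curl_def[abs_def]
  by (rule smooth_linear_image[OF bounded_linear_minus[OF bounded_linear_ident]])
    (rule smooth_sum, rule smooth_linear_image[OF bounded_linear_ev smooth_partial_deriv[OF assms]])

lemma ip_adjoint_curl:
  assumes U: "bounded_open_domain U" and p: "smooth p" and \<psi>: "\<psi> \<in> test_functions U"
  shows "ip U p (curl vv \<psi>) = ip U (adjoint_curl p) \<psi>"
proof -
  interpret U: bounded_open_domain U by (rule U)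
  let ?f = "\<lambda>i x. ev (p x) (axis i 1)" and ?f' = "\<lambda>i x. ev (partial_deriv i p x) (axis i 1)"
  note s = test_function_smooth[OF \<psi>]
  have fs: "smooth (?f i)" "smooth (?f' i)" for i
    by (rule smooth_linear_image[OF bounded_linear_ev p],
        rule smooth_linear_image[OF bounded_linear_ev smooth_partial_deriv[OF p]])
  have pd: "partial_deriv i (?f i) = ?f' i" for i
    by (rule ext, rule partial_deriv_linear_image[OF bounded_linear_ev smooth_differentiable[OF p]])
  have int: "integrable (lebesgue_on U) (\<lambda>x. ?f i x \<bullet> partial_deriv i \<psi> x)"
    "integrable (lebesgue_on U) (\<lambda>x. ?f' i x \<bullet> \<psi> x)" for i
    by (intro L2_inner_integrable U.smooth_L2 fs s smooth_partial_deriv)+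
  have ibp: "(\<integral>x. ?f i x \<bullet> partial_deriv i \<psi> x \<partial>lebesgue_on U) = - (\<integral>x. ?f' i x \<bullet> \<psi> x \<partial>lebesgue_on U)" for i
    using integration_by_parts[OF U.open_domain smooth_differentiable[OF fs(1)]
        smooth_continuous_on[OF smooth_partial_deriv[OF fs(1)]] \<psi>, of i i] int[of i]
    by (simp add: pd)
  have "ip U p (curl vv \<psi>) = (\<integral>x. (\<Sum>i\<in>UNIV. ?f i x \<bullet> partial_deriv i \<psi> x) \<partial>lebesgue_on U)"
    unfolding ip_def curl_def inner_sum_right inner_vv ..
  also have "\<dots> = (\<Sum>i\<in>UNIV. - (\<integral>x. ?f' i x \<bullet> \<psi> x \<partial>lebesgue_on U))"
    by (simp add: int ibp)
  also have "\<dots> = - (\<integral>x. (\<Sum>i\<in>UNIV. ?f' i x \<bullet> \<psi> x) \<partial>lebesgue_on U)"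
    by (simp add: int sum_negf)
  also have "\<dots> = ip U (adjoint_curl p) \<psi>"
    unfolding ip_def adjoint_curl_def by (simp add: inner_sum_left)
  finally show ?thesis .
qed

lemma curl_supported:
  assumes \<psi>: "\<psi> \<in> test_functions U" and x: "x \<notin> U"
  shows "curl vv \<psi> x = 0"
proof -
  let ?C = "closure {x. \<psi> x \<noteq> 0}"
  have xC: "x \<notin> ?C" using \<psi> x by (auto simp: test_functions_def)
  have "\<psi> y = 0" if "y \<notin> ?C" for y
    using that closure_subset[of "{x. \<psi> x \<noteq> 0}"] by auto
  then have "partial_deriv i \<psi> x = 0" for i
    by (rule partial_deriv_eq_0_off_support[OF closed_closure _ xC])
  then show ?thesis by (simp add: curl_def bounded_bilinear.zero_right[OF bilinear_vv])
qed

end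

context cross_products_on_domain
begin

text \<open>Inside a cell the weak curl of a piecewise polynomial is its classical curl, by testing with
  functions supported in the cell.\<close>

lemma wcurl_piecewise_poly:
  assumes mesh: "simplicial_mesh \<Omega> Th" and lip: "lipschitz_boundary \<Omega>"
    and E: "E \<in> H0curl vv \<Omega>" "E \<in> piecewise_poly Th (Suc k)"
  shows "wcurl vv \<Omega> E \<in> piecewise_poly Th k"
  unfolding piecewise_poly_def
proof (intro CollectI ballI)
  fix K assume K: "K \<in> Th"
  note cell = simplicial_mesh_cell[OF mesh K]
  obtain p where p: "p \<in> poly_space (Suc k)" "AE x in lebesgue_on K. E x = p x"
    using E(2) K unfolding piecewise_poly_def by blast
  define U where "U = interior K"
  interpret U: bounded_open_domain U
    unfolding U_def using compact_imp_bounded[OF cell(1)]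
    by unfold_locales (auto intro: bounded_subset interior_subset)
  have U\<Omega>: "U \<subseteq> \<Omega>"
    unfolding U_def using interior_mono[OF cell(4)] interior_closure_lipschitz[OF open_domain lip] by blast
  note sub = U\<Omega> U.domain_sets domain_sets
  note sp = poly_space_smooth[OF p(1)]
  have EU: "AE x in lebesgue_on U. E x = p x"
  proof -
    have "AE x in lebesgue. x \<in> K \<longrightarrow> E x = p x"
      using p(2) cell(3) by (simp add: AE_restrict_space_iff)
    then have "AE x in lebesgue. x \<in> U \<longrightarrow> E x = p x"
      by eventually_elim (use interior_subset in \<open>auto simp: U_def\<close>)
    then show ?thesis using U.domain_sets by (simp add: AE_restrict_space_iff)
  qed
  have "AE x in lebesgue_on U. wcurl vv \<Omega> E x = adjoint_curl p x"
  proof (rule U.AE_eq_if_ip_test_functions_eq)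
    show "wcurl vv \<Omega> E \<in> L2 U" by (rule L2_subset[OF wcurl_L2[OF E(1)] sub])
    show "adjoint_curl p \<in> L2 U" by (rule U.smooth_L2[OF adjoint_curl_smooth[OF sp]])
    fix \<psi> :: "real^'n \<Rightarrow> real^'n" assume \<psi>: "\<psi> \<in> test_functions U"
    have "ip U (wcurl vv \<Omega> E) \<psi> = ip \<Omega> (wcurl vv \<Omega> E) \<psi>"
      using test_function_eq_0[OF \<psi>] by (intro ip_supported[symmetric] sub)
    also have "\<dots> = ip \<Omega> E (curl vv \<psi>)"
      using H0curl_wcurl[OF E(1)] test_function_mono[OF \<psi> U\<Omega>] by (simp add: has_weak_curl_def)
    also have "\<dots> = ip U E (curl vv \<psi>)"
      using curl_supported[OF \<psi>] by (intro ip_supported sub)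
    also have "\<dots> = ip U p (curl vv \<psi>)"
      by (rule ip_cong_AE[OF L2_subset[OF H0curl_L2[OF E(1)] sub] U.smooth_L2[OF sp]
          U.smooth_L2[OF smooth_curl[OF test_function_smooth[OF \<psi>]]] EU])
    also have "\<dots> = ip U (adjoint_curl p) \<psi>"
      by (rule ip_adjoint_curl[OF U.bounded_open_domain_axioms sp \<psi>])
    finally show "ip U (wcurl vv \<Omega> E) \<psi> = ip U (adjoint_curl p) \<psi>" .
  qed
  then have "AE x in lebesgue. x \<in> U \<longrightarrow> wcurl vv \<Omega> E x = adjoint_curl p x"
    using U.domain_sets by (simp add: AE_restrict_space_iff)
  moreover have "AE x in lebesgue. x \<notin> frontier K"
    using negligible_convex_frontier[OF cell(2)] by (intro AE_not_in) (simp add: negligible_iff_null_sets)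
  ultimately have "AE x in lebesgue. x \<in> K \<longrightarrow> wcurl vv \<Omega> E x = adjoint_curl p x"
    by eventually_elim (use closure_subset in \<open>auto simp: U_def frontier_def\<close>)
  then have "AE x in lebesgue_on K. wcurl vv \<Omega> E x = adjoint_curl p x"
    using cell(3) by (simp add: AE_restrict_space_iff)
  with adjoint_curl_poly_space[OF p(1)]
  show "\<exists>q\<in>poly_space k. AE x in lebesgue_on K. wcurl vv \<Omega> E x = q x" by blast
qed

text \<open>The trace condition of \<^const>\<open>H0curl\<close>, applied to gradients, is the one of \<^const>\<open>H0div\<close> for the
  curl, since \<open>curl grad = 0\<close>.\<close>

lemma wcurl_div_free:
  assumes E: "E \<in> H0curl vv \<Omega>"
  shows "has_weak_div \<Omega> (wcurl vv \<Omega> E) (\<lambda>x. 0)" "wcurl vv \<Omega> E \<in> H0div \<Omega>"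
proof -
  have "ip \<Omega> (wcurl vv \<Omega> E) (grad \<phi>) + ip \<Omega> (\<lambda>x. 0) \<phi> = 0" if \<phi>: "smooth \<phi>"
    for \<phi> :: "real^'n \<Rightarrow> real"
  proof -
    have "ip \<Omega> (wcurl vv \<Omega> E) (grad \<phi>) = ip \<Omega> E (curl vv (grad \<phi>))"
      using E smooth_grad[OF \<phi>] by (simp add: H0curl_def)
    also have "\<dots> = 0"
      unfolding ip_def curl_grad[OF cross_products_axioms \<phi>] by simp
    finally show ?thesis by (simp add: ip_def)
  qed
  from H0divI[OF wcurl_L2[OF E] smooth_L2[OF smooth_const] this]
  show "has_weak_div \<Omega> (wcurl vv \<Omega> E) (\<lambda>x. 0)" "wcurl vv \<Omega> E \<in> H0div \<Omega>" by auto
qed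

end

section \<open>Existence of the discrete curl\<close>

definition orthonormal :: "(real^'n) set \<Rightarrow> (real^'n \<Rightarrow> 'b::euclidean_space) set \<Rightarrow> bool" where
  "orthonormal \<Omega> S \<longleftrightarrow> (\<forall>s\<in>S. \<forall>t\<in>S. ip \<Omega> s t = of_bool (s = t))"

text \<open>The classical finite-dimensional argument, with a bound on the size of orthonormal sets in place
  of the dimension: a functional that vanishes on null fields is represented by its expansion along a
  maximal orthonormal set.\<close>

lemma riesz_finite_rank:
  fixes V :: "(real^'n \<Rightarrow> 'b::euclidean_space) set" and L :: "(real^'n \<Rightarrow> 'b) \<Rightarrow> real"
  assumes V: "subspace_of_fields V" "V \<subseteq> L2 \<Omega>" "f0 \<in> V"
    and bound: "\<And>S. finite S \<Longrightarrow> S \<subseteq> V \<Longrightarrow> orthonormal \<Omega> S \<Longrightarrow> card S \<le> m"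
    and lin: "\<And>F F' a b. F \<in> V \<Longrightarrow> F' \<in> V \<Longrightarrow> L (\<lambda>x. a *\<^sub>R F x + b *\<^sub>R F' x) = a * L F + b * L F'"
    and null: "\<And>F. F \<in> V \<Longrightarrow> ip \<Omega> F F = 0 \<Longrightarrow> L F = 0"
  shows "\<exists>J\<in>V. \<forall>F\<in>V. ip \<Omega> J F = L F"
proof -
  define P where "P n \<longleftrightarrow> (\<exists>S. finite S \<and> S \<subseteq> V \<and> orthonormal \<Omega> S \<and> card S = n)" for n
  have "P 0" unfolding P_def by (intro exI[of _ "{}"]) (simp add: orthonormal_def)
  moreover have "\<forall>n. P n \<longrightarrow> n \<le> m" unfolding P_def using bound by auto
  ultimately obtain n where n: "P n" "\<And>l. P l \<Longrightarrow> l \<le> n"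
    using Nat.ex_has_greatest_nat[of P 0 m] by auto
  then obtain S where S: "finite S" "S \<subseteq> V" "orthonormal \<Omega> S" "card S = n" by (auto simp: P_def)
  have SL: "s \<in> L2 \<Omega>" if "s \<in> S" for s using that S(2) V(2) by blast
  have Lsum: "L (\<lambda>x. F x - (\<Sum>s\<in>A. c s *\<^sub>R s x)) = L F - (\<Sum>s\<in>A. c s * L s)"
    if "finite A" "A \<subseteq> S" "F \<in> V" for F A c
    using that
  proof (induction A rule: finite_induct)
    case (insert s A)
    have R: "(\<lambda>x. F x - (\<Sum>s\<in>A. c s *\<^sub>R s x)) \<in> V"
      using insert S(2) by (intro subspace_of_fields_sum[OF V(1)]) auto
    have "L (\<lambda>x. 1 *\<^sub>R (F x - (\<Sum>s\<in>A. c s *\<^sub>R s x)) + (- c s) *\<^sub>R s x)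
        = 1 * L (\<lambda>x. F x - (\<Sum>s\<in>A. c s *\<^sub>R s x)) + (- c s) * L s"
      using insert S(2) by (intro lin R) auto
    then show ?case using insert by (simp add: algebra_simps)
  qed simp
  have rest: "ip \<Omega> (\<lambda>x. F x - (\<Sum>s\<in>S. ip \<Omega> F s *\<^sub>R s x)) (\<lambda>x. F x - (\<Sum>s\<in>S. ip \<Omega> F s *\<^sub>R s x)) = 0"
    if F: "F \<in> V" for F
  proof (rule ccontr)
    define R where "R = (\<lambda>x. F x - (\<Sum>s\<in>S. ip \<Omega> F s *\<^sub>R s x))"
    assume "ip \<Omega> (\<lambda>x. F x - (\<Sum>s\<in>S. ip \<Omega> F s *\<^sub>R s x)) (\<lambda>x. F x - (\<Sum>s\<in>S. ip \<Omega> F s *\<^sub>R s x)) \<noteq> 0"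
    then have R0: "ip \<Omega> R R \<noteq> 0" by (simp add: R_def)
    have RV: "R \<in> V" unfolding R_def using S(2) F by (intro subspace_of_fields_sum[OF V(1)]) auto
    have orth: "ip \<Omega> R t = 0" if "t \<in> S" for t
    proof -
      have "ip \<Omega> R t = ip \<Omega> F t - (\<Sum>s\<in>S. ip \<Omega> F s * ip \<Omega> s t)"
        unfolding R_def using F V(2) SL that by (intro ip_diff_sum_left) auto
      also have "(\<Sum>s\<in>S. ip \<Omega> F s * ip \<Omega> s t) = (\<Sum>s\<in>S. if s = t then ip \<Omega> F t else 0)"
        using S(3) that by (intro sum.cong) (auto simp: orthonormal_def)
      finally show ?thesis using that S(1) by simp
    qed
    \<comment> \<open>a remainder that is not null could be normalised and added to the maximal set\<close>
    define e where "e = (\<lambda>x. (1 / L2norm \<Omega> R) *\<^sub>R R x)"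
    have eV: "e \<in> V" unfolding e_def by (rule subspace_of_fields_scaleR[OF V(1) RV])
    have n0: "L2norm \<Omega> R \<noteq> 0" using R0 by (simp add: L2norm_def)
    have ee: "ip \<Omega> e e = 1"
    proof -
      have "ip \<Omega> e e = 1 / L2norm \<Omega> R * (1 / L2norm \<Omega> R * ip \<Omega> R R)"
        unfolding e_def ip_scaleR_left ip_sym[of \<Omega> R "\<lambda>x. (1 / L2norm \<Omega> R) *\<^sub>R R x"] ..
      then show ?thesis using n0 power2_L2norm[of \<Omega> R, symmetric] by (simp add: power2_eq_square)
    qed
    have es: "ip \<Omega> e t = 0" "ip \<Omega> t e = 0" if "t \<in> S" for t
      using orth[OF that] by (simp_all add: e_def ip_scaleR_left ip_sym[of \<Omega> t])
    have "e \<notin> S" using es(1)[of e] ee by auto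
    moreover have "orthonormal \<Omega> (insert e S)"
      unfolding orthonormal_def
    proof (intro ballI)
      fix s t assume "s \<in> insert e S" "t \<in> insert e S"
      then consider "s = e" "t = e" | "s = e" "t \<in> S" | "s \<in> S" "t = e" | "s \<in> S" "t \<in> S" by blast
      then show "ip \<Omega> s t = of_bool (s = t)"
      proof cases
        case 1
        then show ?thesis by (simp add: ee)
      next
        case 2
        then show ?thesis using es(1)[OF 2(2)] \<open>e \<notin> S\<close> by auto
      next
        case 3
        then show ?thesis using es(2)[OF 3(1)] \<open>e \<notin> S\<close> by auto
      next
        case 4
        then show ?thesis using S(3) by (simp add: orthonormal_def)
      qed
    qed
    ultimately have "P (Suc n)"
      unfolding P_def using S eV by (intro exI[of _ "insert e S"]) auto
    with n(2) show False by fastforce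
  qed
  define J where "J = (\<lambda>x. 0 *\<^sub>R f0 x - (\<Sum>s\<in>S. (- L s) *\<^sub>R s x))"
  have JV: "J \<in> V"
    unfolding J_def using S(2) by (intro subspace_of_fields_sum[OF V(1) subspace_of_fields_scaleR[OF V(1,3)]]) auto
  have "ip \<Omega> J F = L F" if F: "F \<in> V" for F
  proof -
    have FL: "F \<in> L2 \<Omega>" using F V(2) by blast
    have "L (\<lambda>x. F x - (\<Sum>s\<in>S. ip \<Omega> F s *\<^sub>R s x)) = 0"
      using S(2) F by (intro null rest subspace_of_fields_sum[OF V(1)]) auto
    then have "L F = (\<Sum>s\<in>S. ip \<Omega> F s * L s)" using Lsum[OF S(1) _ F] by simp
    moreover have "ip \<Omega> J F = ip \<Omega> (\<lambda>x. 0 *\<^sub>R f0 x) F - (\<Sum>s\<in>S. (- L s) * ip \<Omega> s F)"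
      unfolding J_def using V SL FL
      by (intro ip_diff_sum_left subspace_of_fields_scaleR[OF subspace_L2]) auto
    moreover have "ip \<Omega> (\<lambda>x. 0 *\<^sub>R f0 x) F = 0" by (simp add: ip_def)
    ultimately show ?thesis by (simp add: sum_negf ip_sym[of \<Omega> F] mult.commute)
  qed
  with JV show ?thesis by blast
qed

lemma vector_space_fields: "vector_space (\<lambda>(c::real) (f :: 'a \<Rightarrow> 'b::real_vector) x. c *\<^sub>R f x)"
  by unfold_locales (auto simp: fun_eq_iff algebra_simps)

lemma sum_fun_apply: "(\<Sum>s\<in>A. f s) x = (\<Sum>s\<in>A. f s x)" for f :: "'s \<Rightarrow> 'a \<Rightarrow> 'b::comm_monoid_add"
  by (induction A rule: infinite_finite_induct) auto

text \<open>Orthonormal fields are linearly independent, also after changing them on null sets.\<close>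

lemma card_orthonormal_le:
  fixes S G :: "(real^'n \<Rightarrow> 'b::euclidean_space) set"
  assumes G: "finite G" and S: "finite S" "S \<subseteq> L2 \<Omega>" "orthonormal \<Omega> S"
    and span: "\<And>f. f \<in> S \<Longrightarrow> \<exists>g\<in>module.span (\<lambda>c f x. c *\<^sub>R f x) G. AE x in lebesgue_on \<Omega>. f x = g x"
  shows "card S \<le> card G"
proof -
  interpret F: vector_space "\<lambda>(c::real) (f :: real^'n \<Rightarrow> 'b) x. c *\<^sub>R f x"
    by (rule vector_space_fields)
  obtain r where r: "\<And>f. f \<in> S \<Longrightarrow> r f \<in> F.span G" "\<And>f. f \<in> S \<Longrightarrow> AE x in lebesgue_on \<Omega>. f x = r f x"
  proof -
    have "\<forall>f\<in>S. \<exists>g. g \<in> F.span G \<and> (AE x in lebesgue_on \<Omega>. f x = g x)" using span by blast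
    from bchoice[OF this] show ?thesis using that by blast
  qed
  have o: "ip \<Omega> s t = of_bool (s = t)" if "s \<in> S" "t \<in> S" for s t
    using S(3) that by (simp add: orthonormal_def)
  have inj: "inj_on r S"
  proof (rule inj_onI)
    fix s t assume st: "s \<in> S" "t \<in> S" "r s = r t"
    have "AE x in lebesgue_on \<Omega>. s x = t x"
      using r(2)[OF st(1)] r(2)[OF st(2)] by eventually_elim (simp add: st(3))
    then have "ip \<Omega> s s = ip \<Omega> t s"
      using st(1,2) S(2) by (auto intro: ip_cong_AE[of s \<Omega> t s])
    then show "s = t" using o[of s s] o[of t s] st by (auto split: if_splits)
  qed
  have "F.independent (r ` S)"
    unfolding F.independent_explicit_finite_subsets
  proof (intro allI impI ballI)
    fix T u v
    assume T: "T \<subseteq> r ` S" "finite T" and sum: "(\<Sum>v\<in>T. (\<lambda>x. u v *\<^sub>R v x)) = 0" and v: "v \<in> T"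
    obtain A where A: "A \<subseteq> S" "T = r ` A" using T(1) by (auto simp: subset_image_iff)
    obtain s where s: "s \<in> A" "v = r s" using v A by auto
    have fA: "finite A" using A S(1) finite_subset by blast
    have "AE x in lebesgue_on \<Omega>. \<forall>f\<in>A. f x = r f x"
      using r(2) A(1) fA by (subst AE_finite_all) auto
    then have "AE x in lebesgue_on \<Omega>. 0 *\<^sub>R s x - (\<Sum>f\<in>A. u (r f) *\<^sub>R f x) = 0"
    proof eventually_elim
      case (elim x)
      have "(\<Sum>f\<in>A. u (r f) *\<^sub>R f x) = (\<Sum>f\<in>A. u (r f) *\<^sub>R r f x)" using elim by simp
      also have "\<dots> = (\<Sum>v\<in>T. u v *\<^sub>R v x)"
        unfolding A(2) using inj A(1) by (subst sum.reindex) (auto intro: inj_on_subset)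
      also have "\<dots> = 0" using fun_cong[OF sum, of x] by (simp add: sum_fun_apply)
      finally show ?case by simp
    qed
    then have "ip \<Omega> (\<lambda>x. 0 *\<^sub>R s x - (\<Sum>f\<in>A. u (r f) *\<^sub>R f x)) s = 0" by (rule ip_eq_0_if_AE_eq_0)
    moreover have "ip \<Omega> (\<lambda>x. 0 *\<^sub>R s x - (\<Sum>f\<in>A. u (r f) *\<^sub>R f x)) s
        = ip \<Omega> (\<lambda>x. 0 *\<^sub>R s x) s - (\<Sum>f\<in>A. u (r f) * ip \<Omega> f s)"
      using A(1) s(1) S(2) by (intro ip_diff_sum_left subspace_of_fields_scaleR[OF subspace_L2]) auto
    moreover have "(\<Sum>f\<in>A. u (r f) * ip \<Omega> f s) = (\<Sum>f\<in>A. if f = s then u (r s) else 0)"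
      using A(1) s(1) by (intro sum.cong) (auto simp: o subset_iff)
    moreover have "ip \<Omega> (\<lambda>x. 0 *\<^sub>R s x) s = 0" by (simp add: ip_def)
    ultimately show "u v = 0" using s fA by simp
  qed
  moreover have "r ` S \<subseteq> F.span G" using r(1) by auto
  ultimately have "card (r ` S) \<le> card G" using F.independent_span_bound[OF G] by blast
  then show ?thesis by (simp add: card_image[OF inj])
qed

text \<open>Assigning every point to one of the cells that contain it makes the monomials on single cells a
  finite generating set, up to null sets.\<close>

lemma piecewise_poly_finite_rank:
  assumes mesh: "simplicial_mesh (\<Omega> :: (real^'n) set) Th" and \<Omega>: "open \<Omega>"
  shows "\<exists>m. \<forall>S :: (real^'n \<Rightarrow> 'b::euclidean_space) set.
    finite S \<and> S \<subseteq> L2 \<Omega> \<and> S \<subseteq> piecewise_poly Th k \<and> orthonormal \<Omega> S \<longrightarrow> card S \<le> m"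
proof -
  interpret F: vector_space "\<lambda>(c::real) (f :: real^'n \<Rightarrow> 'b) x. c *\<^sub>R f x"
    by (rule vector_space_fields)
  define cell where "cell x = (SOME K. K \<in> Th \<and> x \<in> K)" for x :: "real^'n"
  have cell: "cell x \<in> Th" "x \<in> cell x" if "x \<in> \<Omega>" for x
  proof -
    have "\<exists>K. K \<in> Th \<and> x \<in> K" using simplicial_mesh_covers[OF mesh that] by blast
    then have "cell x \<in> Th \<and> x \<in> cell x" unfolding cell_def by (rule someI_ex)
    then show "cell x \<in> Th" "x \<in> cell x" by auto
  qed
  let ?M = "{\<alpha> :: 'n \<Rightarrow> nat. (\<Sum>i\<in>UNIV. \<alpha> i) \<le> k}"
  define g where "g = (\<lambda>(K, \<alpha>, b) x. if cell x = K then (\<Prod>i\<in>UNIV. (x $ i) ^ \<alpha> i) *\<^sub>R (b :: 'b) else 0)"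
  define G where "G = g ` (Th \<times> ?M \<times> Basis)"
  have G: "finite G"
    unfolding G_def by (intro finite_imageI finite_cartesian_product simplicial_mesh_finite[OF mesh]
        finite_multi_indices finite_Basis)
  have span_sum: "(\<lambda>x. \<Sum>s\<in>A. f s x) \<in> F.span G" if "\<And>s. s \<in> A \<Longrightarrow> f s \<in> F.span G"
    for A :: "'s set" and f :: "'s \<Rightarrow> real^'n \<Rightarrow> 'b"
  proof -
    have "(\<Sum>s\<in>A. f s) \<in> F.span G" using that by (rule F.span_sum)
    also have "(\<Sum>s\<in>A. f s) = (\<lambda>x. \<Sum>s\<in>A. f s x)" by (simp add: fun_eq_iff sum_fun_apply)
    finally show ?thesis .
  qed
  have "\<exists>w\<in>F.span G. AE x in lebesgue_on \<Omega>. v x = w x" if v: "v \<in> piecewise_poly Th k" for v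
  proof -
    have "\<forall>K\<in>Th. \<exists>c. AE x in lebesgue_on K. v x = (\<Sum>\<alpha>\<in>?M. (\<Prod>i\<in>UNIV. (x $ i) ^ \<alpha> i) *\<^sub>R c \<alpha>)"
      using v unfolding piecewise_poly_def poly_space_def by blast
    from bchoice[OF this] obtain c where c: "\<And>K. K \<in> Th \<Longrightarrow>
        AE x in lebesgue_on K. v x = (\<Sum>\<alpha>\<in>?M. (\<Prod>i\<in>UNIV. (x $ i) ^ \<alpha> i) *\<^sub>R c K \<alpha>)" by blast
    define w where "w = (\<lambda>x. \<Sum>K\<in>Th. \<Sum>\<alpha>\<in>?M. \<Sum>b\<in>Basis. (c K \<alpha> \<bullet> b) *\<^sub>R g (K, \<alpha>, b) x)"
    have "g (K, \<alpha>, b) \<in> F.span G" if "K \<in> Th" "\<alpha> \<in> ?M" "b \<in> Basis" for K \<alpha> b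
      using that by (intro F.span_base) (auto simp: G_def)
    then have "w \<in> F.span G"
      unfolding w_def by (intro span_sum F.span_scale) auto
    moreover have "AE x in lebesgue_on \<Omega>. v x = w x"
    proof -
      have "AE x in lebesgue_on \<Omega>. x \<in> \<Omega>" by (intro AE_I2) simp
      moreover have "AE x in lebesgue_on \<Omega>. \<forall>K\<in>Th. x \<in> K \<longrightarrow>
          v x = (\<Sum>\<alpha>\<in>?M. (\<Prod>i\<in>UNIV. (x $ i) ^ \<alpha> i) *\<^sub>R c K \<alpha>)"
        by (rule AE_lebesgue_onI_mesh[OF mesh \<Omega> c])
      ultimately show ?thesis
      proof eventually_elim
        case (elim x)
        have "w x = (\<Sum>K\<in>Th. if K = cell x then (\<Sum>\<alpha>\<in>?M. (\<Prod>i\<in>UNIV. (x $ i) ^ \<alpha> i) *\<^sub>R c (cell x) \<alpha>) else 0)"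
          unfolding w_def
        proof (rule sum.cong[OF refl])
          fix K
          have "(\<Sum>b\<in>Basis. (c K \<alpha> \<bullet> b) *\<^sub>R (\<Prod>i\<in>UNIV. (x $ i) ^ \<alpha> i) *\<^sub>R b)
              = (\<Prod>i\<in>UNIV. (x $ i) ^ \<alpha> i) *\<^sub>R (\<Sum>b\<in>Basis. (c K \<alpha> \<bullet> b) *\<^sub>R b)" for \<alpha>
            by (simp add: scaleR_sum_right mult.commute)
          then show "(\<Sum>\<alpha>\<in>?M. \<Sum>b\<in>Basis. (c K \<alpha> \<bullet> b) *\<^sub>R g (K, \<alpha>, b) x)
              = (if K = cell x then (\<Sum>\<alpha>\<in>?M. (\<Prod>i\<in>UNIV. (x $ i) ^ \<alpha> i) *\<^sub>R c (cell x) \<alpha>) else 0)"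
            by (auto simp: g_def euclidean_representation)
        qed
        also have "\<dots> = v x"
          using elim cell[of x] simplicial_mesh_finite[OF mesh] by simp
        finally show ?case by simp
      qed
    qed
    ultimately show ?thesis by blast
  qed
  then have "card S \<le> card G"
    if "finite S" "S \<subseteq> L2 \<Omega>" "S \<subseteq> piecewise_poly Th k" "orthonormal \<Omega> S" for S :: "(real^'n \<Rightarrow> 'b) set"
    using that by (intro card_orthonormal_le[OF G]) auto
  then show ?thesis by blast
qed

text \<open>The functional \<open>F \<mapsto> (B, \<nabla> \<times> F)\<close> is well defined up to null sets because the weak curl is unique
  almost everywhere; so the chosen discrete curl has its defining property.\<close>

lemma (in cross_products_on_domain) discrete_curl:
  assumes mesh: "simplicial_mesh \<Omega> Th" and Ch: "subspace_of_fields Ch" "Ch \<subseteq> H0curl vv \<Omega> \<inter> piecewise_poly Th k" "F0 \<in> Ch"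
    and B: "B \<in> L2 \<Omega>"
  shows "discrete_curl vv \<Omega> Ch B \<in> Ch"
    and "F \<in> Ch \<Longrightarrow> ip \<Omega> (discrete_curl vv \<Omega> Ch B) F = ip \<Omega> B (wcurl vv \<Omega> F)"
proof -
  have L: "Ch \<subseteq> L2 \<Omega>" using Ch(2) H0curl_L2 by blast
  have H: "F \<in> H0curl vv \<Omega>" if "F \<in> Ch" for F using that Ch(2) by blast
  obtain m where m: "\<forall>S :: (real^'n \<Rightarrow> 'e) set. finite S \<and> S \<subseteq> L2 \<Omega> \<and> S \<subseteq> piecewise_poly Th k \<and>
      orthonormal \<Omega> S \<longrightarrow> card S \<le> m"
    using piecewise_poly_finite_rank[OF mesh open_domain, of k] by (rule exE)
  have "\<exists>J\<in>Ch. \<forall>F\<in>Ch. ip \<Omega> J F = ip \<Omega> B (wcurl vv \<Omega> F)"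
  proof (rule riesz_finite_rank[OF Ch(1) L Ch(3)])
    fix S assume "finite S" "S \<subseteq> Ch" "orthonormal \<Omega> S"
    with L Ch(2) show "card S \<le> m" by (intro m[rule_format]) auto
  next
    fix F F' a b assume F: "F \<in> Ch" "F' \<in> Ch"
    have "ip \<Omega> B (wcurl vv \<Omega> (\<lambda>x. a *\<^sub>R F x + b *\<^sub>R F' x))
        = ip \<Omega> (\<lambda>x. a *\<^sub>R wcurl vv \<Omega> F x + b *\<^sub>R wcurl vv \<Omega> F' x) B"
      unfolding ip_sym[of \<Omega> B]
      by (rule ip_cong_AE[OF wcurl_L2[OF H0curl_lincomb(1)] L2_lincomb[OF wcurl_L2 wcurl_L2] B H0curl_lincomb(2)];
          rule H; rule F)
    also have "\<dots> = a * ip \<Omega> B (wcurl vv \<Omega> F) + b * ip \<Omega> B (wcurl vv \<Omega> F')"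
      unfolding ip_sym[of \<Omega> B]
      by (rule ip_lincomb_left[OF wcurl_L2 wcurl_L2 B]; rule H; rule F)
    finally show "ip \<Omega> B (wcurl vv \<Omega> (\<lambda>x. a *\<^sub>R F x + b *\<^sub>R F' x))
        = a * ip \<Omega> B (wcurl vv \<Omega> F) + b * ip \<Omega> B (wcurl vv \<Omega> F')" .
  next
    fix F assume F: "F \<in> Ch" "ip \<Omega> F F = 0"
    have F0: "AE x in lebesgue_on \<Omega>. F x = 0"
      using F L by (intro AE_eq_0_if_ip_eq_0) auto
    have "has_weak_curl vv \<Omega> F (\<lambda>x. 0)"
      unfolding has_weak_curl_def using smooth_L2[OF smooth_const] ip_eq_0_if_AE_eq_0[OF F0]
      by (auto simp: ip_def)
    from weak_curl_unique[OF H0curl_wcurl[OF H[OF F(1)]] this]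
    show "ip \<Omega> B (wcurl vv \<Omega> F) = 0"
      unfolding ip_sym[of \<Omega> B] by (rule ip_eq_0_if_AE_eq_0)
  qed
  then have "\<exists>J. J \<in> Ch \<and> (\<forall>F\<in>Ch. ip \<Omega> J F = ip \<Omega> B (wcurl vv \<Omega> F))" by blast
  then have D: "discrete_curl vv \<Omega> Ch B \<in> Ch \<and> (\<forall>F\<in>Ch. ip \<Omega> (discrete_curl vv \<Omega> Ch B) F = ip \<Omega> B (wcurl vv \<Omega> F))"
    unfolding discrete_curl_def by (rule someI_ex)
  then show "discrete_curl vv \<Omega> Ch B \<in> Ch" by blast
  show "F \<in> Ch \<Longrightarrow> ip \<Omega> (discrete_curl vv \<Omega> Ch B) F = ip \<Omega> B (wcurl vv \<Omega> F)" using D by blast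
qed

section \<open>The energy law\<close>

lemma cross_products_3: "cross_products cross3 cross3"
proof (rule cross_products.intro)
  show "bounded_bilinear cross3" "bounded_bilinear cross3"
    using bilinear_cross by (simp_all add: bilinear_conv_bounded_bilinear)
  show "c \<bullet> cross3 a b = cross3 c a \<bullet> b" for a b c :: "real^3"
    by (simp add: cross3_def inner_vec_def sum_3 algebra_simps)
  show "cross3 a b = - cross3 b a" for a b :: "real^3"
    by (rule cross_skew)
qed

lemma cross_products_2: "cross_products cross2_vv cross2_ev"
proof (rule cross_products.intro)
  have "bilinear cross2_vv"
    by (auto simp: bilinear_def cross2_vv_def algebra_simps intro!: linearI)
  then show "bounded_bilinear cross2_vv" by (simp add: bilinear_conv_bounded_bilinear)
  have "bilinear cross2_ev"
    by (auto simp: bilinear_def cross2_ev_def vec_eq_iff forall_2 algebra_simps intro!: linearI)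
  then show "bounded_bilinear cross2_ev" by (simp add: bilinear_conv_bounded_bilinear)
  show "c \<bullet> cross2_vv a b = cross2_ev c a \<bullet> b" for a b and c :: real
    by (simp add: cross2_vv_def cross2_ev_def inner_vec_def sum_2 algebra_simps)
  show "cross2_vv a b = - cross2_vv b a" for a b
    by (simp add: cross2_vv_def)
qed

lemma avg_mem: "subspace_of_fields V \<Longrightarrow> U n \<in> V \<Longrightarrow> U (n - 1) \<in> V \<Longrightarrow> avg U n \<in> V"
  using subspace_of_fieldsD[of V "U n" "U (n - 1)" "1 / 2" "1 / 2"]
  by (simp add: avg_def[abs_def] scaleR_add_right)

lemma D\<tau>_mem: "subspace_of_fields V \<Longrightarrow> U n \<in> V \<Longrightarrow> U (n - 1) \<in> V \<Longrightarrow> D\<tau> \<tau> U n \<in> V"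
  using subspace_of_fieldsD[of V "U n" "U (n - 1)" "1 / \<tau>" "- (1 / \<tau>)"]
  by (simp add: D\<tau>_def[abs_def] scaleR_diff_right)

text \<open>The midpoint rule makes the discrete time derivative exact on squares: \<open>(a - b) \<bullet> (a + b) = \<bar>a\<bar>\<^sup>2 - \<bar>b\<bar>\<^sup>2\<close>.\<close>

lemma ip_D\<tau>_avg:
  assumes U: "U n \<in> L2 \<Omega>" "U (n - 1) \<in> L2 \<Omega>"
  shows "ip \<Omega> (D\<tau> \<tau> U n) (avg U n) = ((L2norm \<Omega> (U n))\<^sup>2 - (L2norm \<Omega> (U (n - 1)))\<^sup>2) / (2 * \<tau>)"
proof -
  have A: "avg U n = (\<lambda>x. (1 / 2) *\<^sub>R U n x + (1 / 2) *\<^sub>R U (n - 1) x)"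
    and D: "D\<tau> \<tau> U n = (\<lambda>x. (1 / \<tau>) *\<^sub>R U n x + (- (1 / \<tau>)) *\<^sub>R U (n - 1) x)"
    by (simp_all add: avg_def D\<tau>_def fun_eq_iff algebra_simps)
  have "ip \<Omega> (D\<tau> \<tau> U n) (avg U n) = 1 / \<tau> * ip \<Omega> (U n) (avg U n) + - (1 / \<tau>) * ip \<Omega> (U (n - 1)) (avg U n)"
    unfolding D by (rule ip_lincomb_left[OF U avg_mem[OF subspace_L2 U]])
  also have "ip \<Omega> (U n) (avg U n) = 1 / 2 * ip \<Omega> (U n) (U n) + 1 / 2 * ip \<Omega> (U n) (U (n - 1))"
    unfolding A by (rule ip_lincomb_right[OF U U(1)])
  also have "ip \<Omega> (U (n - 1)) (avg U n) = 1 / 2 * ip \<Omega> (U (n - 1)) (U n) + 1 / 2 * ip \<Omega> (U (n - 1)) (U (n - 1))"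
    unfolding A by (rule ip_lincomb_right[OF U U(2)])
  finally show ?thesis
    unfolding ip_sym[of \<Omega> "U (n - 1)" "U n"] power2_L2norm
    by (simp add: add_divide_distrib diff_divide_distrib)
qed

text \<open>The electric space is only required to be a subspace of piecewise polynomials in \<open>H\<^sub>0(curl)\<close>; this
  covers Nedelec elements in space and Lagrange elements in the plane. The degree is
  one above that of the magnetic space, so that taking the curl leads into the latter.\<close>

locale mhd_solution = cross_products_on_domain vv ev \<Omega>
  for vv :: "real^'n \<Rightarrow> real^'n \<Rightarrow> 'e::euclidean_space" and ev and \<Omega> :: "(real^'n) set" +
  fixes Th k Ch Rey Rem S \<tau> N f u p E B
  assumes lipschitz: "lipschitz_boundary \<Omega>"
    and mesh: "simplicial_mesh \<Omega> Th"
    and Ch: "subspace_of_fields Ch" "Ch \<subseteq> H0curl vv \<Omega> \<inter> piecewise_poly Th (Suc k)"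
    and positive: "0 < Rey" "0 < Rem" "0 < S" "0 < \<tau>"
    and initial: "u 0 \<in> TH_velocity \<Omega> Th k" "B 0 \<in> BDM \<Omega> Th k"
    and scheme: "mhd_scheme vv ev \<Omega> (TH_velocity \<Omega> Th k) (TH_pressure \<Omega> Th k) Ch (BDM \<Omega> Th k)
      Rey Rem S \<tau> N f u p E B"
begin

abbreviation "J n \<equiv> discrete_curl vv \<Omega> Ch (avg B n)"

lemma subspace_velocity: "subspace_of_fields (TH_velocity \<Omega> Th k)"
  unfolding TH_velocity_def by (intro subspace_of_fields_Int subspace_H10 subspace_piecewise_poly)

lemma subspace_BDM: "subspace_of_fields (BDM \<Omega> Th k)"
  unfolding BDM_def by (intro subspace_of_fields_Int subspace_H0div subspace_piecewise_poly)

lemma velocity_L2: "v \<in> TH_velocity \<Omega> Th k \<Longrightarrow> v \<in> L2 \<Omega>"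
  by (simp add: TH_velocity_def H10_H1 H1_L2)

lemma BDM_L2: "Z \<in> BDM \<Omega> Th k \<Longrightarrow> Z \<in> L2 \<Omega>"
  by (simp add: BDM_def H0div_L2)

lemma Ch_L2: "F \<in> Ch \<Longrightarrow> F \<in> L2 \<Omega>"
  using Ch(2) H0curl_L2 by blast

lemma iterates:
  assumes "n \<le> N"
  shows "u n \<in> TH_velocity \<Omega> Th k" "B n \<in> BDM \<Omega> Th k"
  using assms scheme initial unfolding mhd_scheme_def by (cases "n = 0"; simp)+

lemma step:
  assumes "n \<in> {1..N}"
  shows "p n \<in> TH_pressure \<Omega> Th k" "E n \<in> Ch"
    and "v \<in> TH_velocity \<Omega> Th k \<Longrightarrow>
      ip \<Omega> (D\<tau> \<tau> u n) v + 1 / Rey * ip \<Omega> (wgrad \<Omega> (avg u n)) (wgrad \<Omega> v)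
      + 1 / 2 * (ip \<Omega> (convect \<Omega> (u (n - 1)) (avg u n)) v - ip \<Omega> (convect \<Omega> (u (n - 1)) v) (avg u n))
      - S / Rem * ip \<Omega> (\<lambda>x. ev (J n x) (B (n - 1) x)) v - ip \<Omega> (p n) (wdiv \<Omega> v) = ip \<Omega> (f (real n * \<tau>)) v"
    and "F \<in> Ch \<Longrightarrow> ip \<Omega> (\<lambda>x. E n x + vv (avg u n x) (B (n - 1) x)) F
      - 1 / Rem * ip \<Omega> (avg B n) (wcurl vv \<Omega> F) = 0"
    and "Z \<in> BDM \<Omega> Th k \<Longrightarrow> ip \<Omega> (D\<tau> \<tau> B n) Z + ip \<Omega> (wcurl vv \<Omega> (E n)) Z = 0"
    and "q \<in> TH_pressure \<Omega> Th k \<Longrightarrow> ip \<Omega> (wdiv \<Omega> (avg u n)) q = 0"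
  using scheme assms unfolding mhd_scheme_def Let_def by blast+

lemma pred_iterates:
  assumes "n \<in> {1..N}"
  shows "u n \<in> TH_velocity \<Omega> Th k" "B n \<in> BDM \<Omega> Th k"
    "u (n - 1) \<in> TH_velocity \<Omega> Th k" "B (n - 1) \<in> BDM \<Omega> Th k"
  using assms iterates[of n] iterates[of "n - 1"] by auto

lemma avg_velocity: "n \<in> {1..N} \<Longrightarrow> avg u n \<in> TH_velocity \<Omega> Th k"
  by (intro avg_mem subspace_velocity pred_iterates)

lemma avg_magnetic: "n \<in> {1..N} \<Longrightarrow> avg B n \<in> BDM \<Omega> Th k"
  by (intro avg_mem subspace_BDM pred_iterates)

lemma J:
  assumes n: "n \<in> {1..N}"
  shows "J n \<in> Ch" "F \<in> Ch \<Longrightarrow> ip \<Omega> (J n) F = ip \<Omega> (avg B n) (wcurl vv \<Omega> F)"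
  by (rule discrete_curl[OF mesh Ch step(2)[OF n] BDM_L2[OF avg_magnetic[OF n]]], assumption?)+

text \<open>By the triple product identity, the work of the Lorentz force is opposite to the pairing of
  \<open>avg u \<times> B\<close> with \<open>J\<close>; Ohm's law and Faraday's law express that pairing through the magnetic
  dissipation and the change of magnetic energy.\<close>

theorem energy_identity:
  assumes n: "n \<in> {1..N}"
  shows "((L2norm \<Omega> (u n))\<^sup>2 - (L2norm \<Omega> (u (n - 1)))\<^sup>2) / (2 * \<tau>)
      + 1 / Rey * (L2norm \<Omega> (wgrad \<Omega> (avg u n)))\<^sup>2
      + S / Rem\<^sup>2 * (L2norm \<Omega> (J n))\<^sup>2
      + S / Rem * (((L2norm \<Omega> (B n))\<^sup>2 - (L2norm \<Omega> (B (n - 1)))\<^sup>2) / (2 * \<tau>))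
      = ip \<Omega> (f (real n * \<tau>)) (avg u n)"
proof -
  note it = pred_iterates[OF n] and a = avg_velocity[OF n] and b = avg_magnetic[OF n]
  have JC: "J n \<in> Ch" by (rule J(1)[OF n])
  let ?du = "((L2norm \<Omega> (u n))\<^sup>2 - (L2norm \<Omega> (u (n - 1)))\<^sup>2) / (2 * \<tau>)"
    and ?dB = "((L2norm \<Omega> (B n))\<^sup>2 - (L2norm \<Omega> (B (n - 1)))\<^sup>2) / (2 * \<tau>)"
    and ?X = "ip \<Omega> (\<lambda>x. vv (avg u n x) (B (n - 1) x)) (J n)"
  have p0: "ip \<Omega> (p n) (wdiv \<Omega> (avg u n)) = 0"
    using step(6)[OF n step(1)[OF n]] by (simp add: ip_sym)
  have lorentz: "ip \<Omega> (\<lambda>x. ev (J n x) (B (n - 1) x)) (avg u n) = - ?X"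
  proof -
    have "ev (J n x) (B (n - 1) x) \<bullet> avg u n x = - (vv (avg u n x) (B (n - 1) x) \<bullet> J n x)" for x
      unfolding inner_vv[symmetric] vv_skew[of "B (n - 1) x"] by (simp add: inner_commute)
    then show ?thesis unfolding ip_def by simp
  qed
  have "ip \<Omega> (D\<tau> \<tau> u n) (avg u n) = ?du"
    by (rule ip_D\<tau>_avg) (intro velocity_L2 it)+
  with step(3)[OF n a] p0 lorentz have 1: "?du + 1 / Rey * (L2norm \<Omega> (wgrad \<Omega> (avg u n)))\<^sup>2 + S / Rem * ?X
      = ip \<Omega> (f (real n * \<tau>)) (avg u n)"
    by (simp add: power2_L2norm)
  have "?X = 1 / Rem * (L2norm \<Omega> (J n))\<^sup>2 - ip \<Omega> (E n) (J n)"
  proof -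
    obtain M where M: "AE x in lebesgue_on \<Omega>. norm (B (n - 1) x) \<le> M"
      using piecewise_poly_bounded[OF mesh open_domain, of "B (n - 1)" k] it(4) by (auto simp: BDM_def)
    have "(\<lambda>x. vv (avg u n x) (B (n - 1) x)) \<in> L2 \<Omega>"
      by (rule L2_product_bounded[OF bilinear_vv velocity_L2[OF a] BDM_L2[OF it(4)] M])
    from ip_add_left[OF Ch_L2[OF step(2)[OF n]] this Ch_L2[OF JC]]
    show ?thesis using step(4)[OF n JC] J(2)[OF n JC] by (simp add: power2_L2norm)
  qed
  moreover have "ip \<Omega> (E n) (J n) = - ?dB"
  proof -
    have "ip \<Omega> (D\<tau> \<tau> B n) (avg B n) = ?dB"
      by (rule ip_D\<tau>_avg) (intro BDM_L2 it)+
    then show ?thesis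
      using step(5)[OF n b] J(2)[OF n step(2)[OF n]] by (simp add: ip_sym)
  qed
  ultimately have "S / Rem * ?X = S / Rem * (1 / Rem * (L2norm \<Omega> (J n))\<^sup>2 + ?dB)" by simp
  also have "\<dots> = S / Rem\<^sup>2 * (L2norm \<Omega> (J n))\<^sup>2 + S / Rem * ?dB"
    by (simp add: distrib_left power2_eq_square)
  finally show ?thesis using 1 by simp
qed

text \<open>Twice the energy identity dissipates \<open>2 / Rey\<close> times the squared gradient; the forcing consumes half
  of it and the other half stays on the left.\<close>

theorem energy_estimate:
  assumes R: "\<And>x. x \<in> \<Omega> \<Longrightarrow> norm x \<le> R" "0 < R" and f: "\<And>n. n \<in> {1..N} \<Longrightarrow> f (real n * \<tau>) \<in> L2 \<Omega>"
    and "n \<le> N"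
  shows "(L2norm \<Omega> (u n))\<^sup>2 + S / Rem * (L2norm \<Omega> (B n))\<^sup>2
      + \<tau> * (\<Sum>i=1..n. 1 / Rey * (L2norm \<Omega> (wgrad \<Omega> (avg u i)))\<^sup>2 + 2 * S / Rem\<^sup>2 * (L2norm \<Omega> (J i))\<^sup>2)
    \<le> (L2norm \<Omega> (u 0))\<^sup>2 + S / Rem * (L2norm \<Omega> (B 0))\<^sup>2
      + (4 * R\<^sup>2 + 1) * \<tau> * (\<Sum>i=1..n. Rey * (Hm1norm \<Omega> (f (real i * \<tau>)))\<^sup>2)"
  using \<open>n \<le> N\<close>
proof (induction n)
  case (Suc n)
  then have n: "Suc n \<in> {1..N}" by simp
  let ?e = "\<lambda>n. (L2norm \<Omega> (u n))\<^sup>2 + S / Rem * (L2norm \<Omega> (B n))\<^sup>2"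
    and ?G = "1 / Rey * (L2norm \<Omega> (wgrad \<Omega> (avg u (Suc n))))\<^sup>2" and ?K = "S / Rem\<^sup>2 * (L2norm \<Omega> (J (Suc n)))\<^sup>2"
    and ?f = "f (real (Suc n) * \<tau>)"
  let ?F = "Rey * (Hm1norm \<Omega> ?f)\<^sup>2"
  have force: "2 * ip \<Omega> ?f (avg u (Suc n)) \<le> ?G + (4 * R\<^sup>2 + 1) * ?F"
    using avg_velocity[OF n] by (intro forcing_estimate f[OF n] R positive) (auto simp: TH_velocity_def)
  have "(?e (Suc n) - ?e n) / (2 * \<tau>) + ?G + ?K = ip \<Omega> ?f (avg u (Suc n))"
    using energy_identity[OF n] by (simp add: diff_divide_distrib add_divide_distrib right_diff_distrib)
  then have "?e (Suc n) - ?e n = \<tau> * (2 * ip \<Omega> ?f (avg u (Suc n)) - 2 * ?G - 2 * ?K)"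
    using positive(4) by (simp add: field_simps)
  also have "\<dots> \<le> \<tau> * ((4 * R\<^sup>2 + 1) * ?F - ?G - 2 * ?K)"
    using force positive(4) by (intro mult_left_mono) auto
  finally have "?e (Suc n) + \<tau> * (?G + 2 * ?K) \<le> ?e n + (4 * R\<^sup>2 + 1) * \<tau> * ?F"
    by (simp add: algebra_simps)
  with Suc show ?case
    by (simp add: distrib_left mult.assoc)
qed simp

text \<open>The discrete Faraday law is tested with its own residual, which is admissible because the curl of
  the electric field lies in the magnetic space; so it holds pointwise, and the magnetic field
  changes by a curl.\<close>

theorem magnetic_div_free:
  assumes "div_free \<Omega> (B 0)" and "n \<le> N"
  shows "div_free \<Omega> (B n)"
  using \<open>n \<le> N\<close>
proof (induction n)
  case (Suc n)
  then have n: "Suc n \<in> {1..N}" by simp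
  note it = pred_iterates[OF n, simplified]
  let ?W = "wcurl vv \<Omega> (E (Suc n))" and ?D = "D\<tau> \<tau> B (Suc n)"
  have EC: "E (Suc n) \<in> H0curl vv \<Omega>" "E (Suc n) \<in> piecewise_poly Th (Suc k)"
    using step(2)[OF n] Ch(2) by auto
  have W: "?W \<in> BDM \<Omega> Th k"
    unfolding BDM_def using wcurl_div_free(2)[OF EC(1)] wcurl_piecewise_poly[OF mesh lipschitz EC] by simp
  have D: "?D \<in> BDM \<Omega> Th k" by (intro D\<tau>_mem subspace_BDM) (use it in auto)
  let ?X = "\<lambda>x. ?D x + ?W x"
  have X: "?X \<in> BDM \<Omega> Th k"
    using subspace_of_fieldsD[OF subspace_BDM D W, of 1 1] by simp
  have "ip \<Omega> ?X ?X = 0"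
    using step(5)[OF n X] ip_add_left[OF BDM_L2[OF D] BDM_L2[OF W] BDM_L2[OF X]] by simp
  then have X0: "AE x in lebesgue_on \<Omega>. ?X x = 0" by (rule AE_eq_0_if_ip_eq_0[OF BDM_L2[OF X]])
  \<comment> \<open>the new field almost everywhere, solved from the pointwise Faraday law\<close>
  let ?Y = "\<lambda>x. 1 *\<^sub>R B n x + (- \<tau>) *\<^sub>R ?W x"
  have Bn: "has_weak_div \<Omega> (B n) (wdiv \<Omega> (B n))" "B n \<in> L2 \<Omega>"
    using it(4) H0div_wdiv H0div_L2 by (auto simp: BDM_def)
  have wY: "has_weak_div \<Omega> ?Y (\<lambda>x. 1 *\<^sub>R wdiv \<Omega> (B n) x + (- \<tau>) *\<^sub>R 0)"
    by (rule has_weak_div_lincomb[OF Bn(2,1) BDM_L2[OF W] wcurl_div_free(1)[OF EC(1)]])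
  have eq: "AE x in lebesgue_on \<Omega>. B (Suc n) x = ?Y x"
    using X0
  proof eventually_elim
    case (elim x)
    then have "\<tau> *\<^sub>R ((1 / \<tau>) *\<^sub>R (B (Suc n) x - B n x) + ?W x) = 0" by (simp add: D\<tau>_def)
    then show ?case using positive(4) by (simp add: scaleR_add_right algebra_simps)
  qed
  have "has_weak_div \<Omega> (B (Suc n)) (\<lambda>x. 1 *\<^sub>R wdiv \<Omega> (B n) x + (- \<tau>) *\<^sub>R 0)"
    unfolding has_weak_div_def
  proof (intro conjI ballI)
    show "(\<lambda>x. 1 *\<^sub>R wdiv \<Omega> (B n) x + (- \<tau>) *\<^sub>R 0) \<in> L2 \<Omega>" using wY by (simp add: has_weak_div_def)
    fix \<phi> :: "real^'n \<Rightarrow> real" assume \<phi>: "\<phi> \<in> test_functions \<Omega>"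
    have "ip \<Omega> (B (Suc n)) (grad \<phi>) = ip \<Omega> ?Y (grad \<phi>)"
      by (rule ip_cong_AE[OF BDM_L2[OF it(2)] L2_lincomb[OF Bn(2) BDM_L2[OF W]]
            smooth_L2[OF smooth_grad[OF test_function_smooth[OF \<phi>]]] eq])
    then show "ip \<Omega> (B (Suc n)) (grad \<phi>) = - ip \<Omega> (\<lambda>x. 1 *\<^sub>R wdiv \<Omega> (B n) x + (- \<tau>) *\<^sub>R 0) \<phi>"
      using wY \<phi> by (simp add: has_weak_div_def)
  qed
  moreover have "AE x in lebesgue_on \<Omega>. 1 *\<^sub>R wdiv \<Omega> (B n) x + (- \<tau>) *\<^sub>R 0 = 0"
    using Suc by (simp add: div_free_def)
  ultimately show ?case by (rule div_free_if_has_weak_div_0)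
qed (use assms in simp)

end

section \<open>The stability theorem in two and three dimensions\<close>

lemma bounded_open_domain_polyhedral: "lipschitz_polyhedral_domain \<Omega> \<Longrightarrow> bounded_open_domain \<Omega>"
  by (simp add: lipschitz_polyhedral_domain_def bounded_open_domain_def)

lemma (in cross_products) subspace_Nedelec:
  assumes "bounded_open_domain \<Omega>"
  shows "subspace_of_fields (H0curl vv \<Omega> \<inter> piecewise_poly Th k)"
proof -
  interpret bounded_open_domain \<Omega> by (rule assms)
  interpret cross_products_on_domain vv ev \<Omega> ..
  show ?thesis by (intro subspace_of_fields_Int subspace_H0curl subspace_piecewise_poly)
qed

lemma subspace_nedelec3:
  assumes "bounded_open_domain \<Omega>" shows "subspace_of_fields (nedelec3 \<Omega> Th k)"
  unfolding nedelec3_def by (rule cross_products.subspace_Nedelec[OF cross_products_3 assms])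

lemma subspace_nedelec2:
  assumes "bounded_open_domain \<Omega>" shows "subspace_of_fields (nedelec2 \<Omega> Th k)"
proof -
  have "nedelec2 \<Omega> Th k = (H0curl cross2_vv \<Omega> \<inter> piecewise_poly Th (k + 1))
      \<inter> {F. continuous_on (closure \<Omega>) F \<and> (\<forall>x\<in>frontier \<Omega>. F x = 0)}"
    by (auto simp: nedelec2_def)
  moreover have "subspace_of_fields {F :: real^2 \<Rightarrow> real. continuous_on (closure \<Omega>) F \<and> (\<forall>x\<in>frontier \<Omega>. F x = 0)}"
    unfolding subspace_of_fields_def by (auto intro!: continuous_intros)
  ultimately show ?thesis
    using cross_products.subspace_Nedelec[OF cross_products_2 assms] by (simp only: subspace_of_fields_Int)
qed

lemma mhd_stability:
  fixes \<Omega> :: "(real^'n) set" and ev :: "'e::euclidean_space \<Rightarrow> real^'n \<Rightarrow> real^'n"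
  assumes cp: "cross_products vv ev" and \<Omega>: "lipschitz_polyhedral_domain \<Omega>"
    and R: "\<And>x. x \<in> \<Omega> \<Longrightarrow> norm x \<le> R" "0 < R"
    and \<tau>: "1 \<le> N" "\<tau> = T / real N" and pos: "0 < Rey" "0 < Rem" "0 < S" "0 < T"
    and mesh: "simplicial_mesh \<Omega> Th"
    and spaces: "Vh = TH_velocity \<Omega> Th k" "Qh = TH_pressure \<Omega> Th k" "Dh = BDM \<Omega> Th k"
    and f: "\<forall>t\<in>{0..T}. f t \<in> L2 \<Omega>"
    and init: "\<exists>Pp. stokes_projection \<Omega> Vh Qh Rey u0 p0 (u 0) Pp" "div_free_projection \<Omega> Dh B0 (B 0)"
    and scheme: "mhd_scheme vv ev \<Omega> Vh Qh Ch Dh Rey Rem S \<tau> N f u p E B"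
    and Ch: "subspace_of_fields Ch" "Ch \<subseteq> H0curl vv \<Omega> \<inter> piecewise_poly Th (Suc k)"
  shows "(\<forall>n\<in>{1..N}.
            ((L2norm \<Omega> (u n))\<^sup>2 - (L2norm \<Omega> (u (n - 1)))\<^sup>2) / (2 * \<tau>)
            + 1 / Rey * (L2norm \<Omega> (wgrad \<Omega> (avg u n)))\<^sup>2
            + S / Rem\<^sup>2 * (L2norm \<Omega> (discrete_curl vv \<Omega> Ch (avg B n)))\<^sup>2
            + S / Rem * (((L2norm \<Omega> (B n))\<^sup>2 - (L2norm \<Omega> (B (n - 1)))\<^sup>2) / (2 * \<tau>))
            = ip \<Omega> (f (real n * \<tau>)) (avg u n)) \<and>
         (\<forall>n\<in>{1..N}.
            (L2norm \<Omega> (u n))\<^sup>2 + S / Rem * (L2norm \<Omega> (B n))\<^sup>2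
            + \<tau> * (\<Sum>i=1..n. 1 / Rey * (L2norm \<Omega> (wgrad \<Omega> (avg u i)))\<^sup>2
                 + 2 * S / Rem\<^sup>2 * (L2norm \<Omega> (discrete_curl vv \<Omega> Ch (avg B i)))\<^sup>2)
            \<le> (L2norm \<Omega> (u 0))\<^sup>2 + S / Rem * (L2norm \<Omega> (B 0))\<^sup>2
              + (4 * R\<^sup>2 + 1) * \<tau> * (\<Sum>i=1..n. Rey * (Hm1norm \<Omega> (f (real i * \<tau>)))\<^sup>2)) \<and>
         (div_free \<Omega> (B 0) \<longrightarrow> (\<forall>n\<in>{1..N}. div_free \<Omega> (B n)))"
proof -
  interpret cross_products vv ev by (rule cp)
  interpret bounded_open_domain \<Omega> by (rule bounded_open_domain_polyhedral[OF \<Omega>])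
  interpret mhd_solution vv ev \<Omega> Th k Ch Rey Rem S \<tau> N f u p E B
  proof
    show "lipschitz_boundary \<Omega>" using \<Omega> by (simp add: lipschitz_polyhedral_domain_def)
    show "0 < \<tau>" using pos \<tau> by simp
    show "u 0 \<in> TH_velocity \<Omega> Th k" "B 0 \<in> BDM \<Omega> Th k"
      using init by (auto simp: stokes_projection_def div_free_projection_def spaces)
    show "mhd_scheme vv ev \<Omega> (TH_velocity \<Omega> Th k) (TH_pressure \<Omega> Th k) Ch (BDM \<Omega> Th k) Rey Rem S \<tau> N f u p E B"
      using scheme by (simp add: spaces)
  qed (fact mesh Ch pos)+
  have fn: "f (real n * \<tau>) \<in> L2 \<Omega>" if "n \<in> {1..N}" for n
  proof -
    have "0 < \<tau>" using pos \<tau> by simp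
    then have "real n * \<tau> \<le> real N * \<tau>" using that by (intro mult_right_mono) auto
    moreover have "real N * \<tau> = T" using \<tau> by simp
    ultimately have "real n * \<tau> \<in> {0..T}" using \<open>0 < \<tau>\<close> by simp
    with f show ?thesis by blast
  qed
  show ?thesis
    using energy_identity energy_estimate[OF R fn] magnetic_div_free by auto
qed

theorem theorem2p1:
  shows "(\<forall>(\<Omega> :: (real^3) set) \<sigma> \<rho> \<kappa>. lipschitz_polyhedral_domain \<Omega> \<and> 0 < \<sigma> \<and> 0 < \<rho> \<and> 0 < \<kappa> \<longrightarrow>
      (\<exists>C>0. \<forall>Rey Rem S T k N Th Vh Qh Ch Dh \<tau> f u0 p0 B0 u p E B.
         0 < Rey \<and> 0 < Rem \<and> 0 < S \<and> 0 < T \<and> 1 \<le> k \<and> 1 \<le> N \<and> \<tau> = T / real N \<and>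
         simplicial_mesh \<Omega> Th \<and> shape_regular \<sigma> Th \<and> quasi_uniform \<rho> Th \<and>
         Vh = TH_velocity \<Omega> Th k \<and> Qh = TH_pressure \<Omega> Th k \<and> Ch = nedelec3 \<Omega> Th k \<and> Dh = BDM \<Omega> Th k \<and>
         inf_sup_condition \<kappa> \<Omega> Vh Qh \<and>
         (\<forall>t\<in>{0..T}. f t \<in> L2 \<Omega>) \<and>
         u0 \<in> H1 \<Omega> \<and> div_free \<Omega> u0 \<and> p0 \<in> L2 \<Omega> \<and> B0 \<in> Hdiv \<Omega> \<and> div_free \<Omega> B0 \<and>
         (\<exists>Pp. stokes_projection \<Omega> Vh Qh Rey u0 p0 (u 0) Pp) \<and> div_free_projection \<Omega> Dh B0 (B 0) \<and>
         mhd_scheme cross3 cross3 \<Omega> Vh Qh Ch Dh Rey Rem S \<tau> N f u p E B \<longrightarrow>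
         (\<forall>n\<in>{1..N}.
            ((L2norm \<Omega> (u n))\<^sup>2 - (L2norm \<Omega> (u (n - 1)))\<^sup>2) / (2 * \<tau>)
            + 1 / Rey * (L2norm \<Omega> (wgrad \<Omega> (avg u n)))\<^sup>2
            + S / Rem\<^sup>2 * (L2norm \<Omega> (discrete_curl cross3 \<Omega> Ch (avg B n)))\<^sup>2
            + S / Rem * (((L2norm \<Omega> (B n))\<^sup>2 - (L2norm \<Omega> (B (n - 1)))\<^sup>2) / (2 * \<tau>))
            = ip \<Omega> (f (real n * \<tau>)) (avg u n)) \<and>
         (\<forall>n\<in>{1..N}.
            (L2norm \<Omega> (u n))\<^sup>2 + S / Rem * (L2norm \<Omega> (B n))\<^sup>2
            + \<tau> * (\<Sum>i=1..n. 1 / Rey * (L2norm \<Omega> (wgrad \<Omega> (avg u i)))\<^sup>2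
                 + 2 * S / Rem\<^sup>2 * (L2norm \<Omega> (discrete_curl cross3 \<Omega> Ch (avg B i)))\<^sup>2)
            \<le> (L2norm \<Omega> (u 0))\<^sup>2 + S / Rem * (L2norm \<Omega> (B 0))\<^sup>2
              + C * \<tau> * (\<Sum>i=1..n. Rey * (Hm1norm \<Omega> (f (real i * \<tau>)))\<^sup>2)) \<and>
         (div_free \<Omega> (B 0) \<longrightarrow> (\<forall>n\<in>{1..N}. div_free \<Omega> (B n)))))
    \<and>
    (\<forall>(\<Omega> :: (real^2) set) \<sigma> \<rho> \<kappa>. lipschitz_polyhedral_domain \<Omega> \<and> 0 < \<sigma> \<and> 0 < \<rho> \<and> 0 < \<kappa> \<longrightarrow>
      (\<exists>C>0. \<forall>Rey Rem S T k N Th Vh Qh Ch Dh \<tau> f u0 p0 B0 u p E B.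
         0 < Rey \<and> 0 < Rem \<and> 0 < S \<and> 0 < T \<and> 1 \<le> k \<and> 1 \<le> N \<and> \<tau> = T / real N \<and>
         simplicial_mesh \<Omega> Th \<and> shape_regular \<sigma> Th \<and> quasi_uniform \<rho> Th \<and>
         Vh = TH_velocity \<Omega> Th k \<and> Qh = TH_pressure \<Omega> Th k \<and> Ch = nedelec2 \<Omega> Th k \<and> Dh = BDM \<Omega> Th k \<and>
         inf_sup_condition \<kappa> \<Omega> Vh Qh \<and>
         (\<forall>t\<in>{0..T}. f t \<in> L2 \<Omega>) \<and>
         u0 \<in> H1 \<Omega> \<and> div_free \<Omega> u0 \<and> p0 \<in> L2 \<Omega> \<and> B0 \<in> Hdiv \<Omega> \<and> div_free \<Omega> B0 \<and>
         (\<exists>Pp. stokes_projection \<Omega> Vh Qh Rey u0 p0 (u 0) Pp) \<and> div_free_projection \<Omega> Dh B0 (B 0) \<and>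
         mhd_scheme cross2_vv cross2_ev \<Omega> Vh Qh Ch Dh Rey Rem S \<tau> N f u p E B \<longrightarrow>
         (\<forall>n\<in>{1..N}.
            ((L2norm \<Omega> (u n))\<^sup>2 - (L2norm \<Omega> (u (n - 1)))\<^sup>2) / (2 * \<tau>)
            + 1 / Rey * (L2norm \<Omega> (wgrad \<Omega> (avg u n)))\<^sup>2
            + S / Rem\<^sup>2 * (L2norm \<Omega> (discrete_curl cross2_vv \<Omega> Ch (avg B n)))\<^sup>2
            + S / Rem * (((L2norm \<Omega> (B n))\<^sup>2 - (L2norm \<Omega> (B (n - 1)))\<^sup>2) / (2 * \<tau>))
            = ip \<Omega> (f (real n * \<tau>)) (avg u n)) \<and>
         (\<forall>n\<in>{1..N}.
            (L2norm \<Omega> (u n))\<^sup>2 + S / Rem * (L2norm \<Omega> (B n))\<^sup>2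
            + \<tau> * (\<Sum>i=1..n. 1 / Rey * (L2norm \<Omega> (wgrad \<Omega> (avg u i)))\<^sup>2
                 + 2 * S / Rem\<^sup>2 * (L2norm \<Omega> (discrete_curl cross2_vv \<Omega> Ch (avg B i)))\<^sup>2)
            \<le> (L2norm \<Omega> (u 0))\<^sup>2 + S / Rem * (L2norm \<Omega> (B 0))\<^sup>2
              + C * \<tau> * (\<Sum>i=1..n. Rey * (Hm1norm \<Omega> (f (real i * \<tau>)))\<^sup>2)) \<and>
         (div_free \<Omega> (B 0) \<longrightarrow> (\<forall>n\<in>{1..N}. div_free \<Omega> (B n)))))"
proof (intro conjI allI impI, goal_cases)
  case (1 \<Omega> \<sigma> \<rho> \<kappa>)
  then have \<Omega>: "lipschitz_polyhedral_domain \<Omega>" by blast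
  note dom = bounded_open_domain_polyhedral[OF \<Omega>]
  obtain R where R: "\<And>x. x \<in> \<Omega> \<Longrightarrow> norm x \<le> R" "0 < R"
    using bounded_open_domain.bounded_domain[OF dom] by (auto simp: bounded_pos)
  have Ch: "nedelec3 \<Omega> Th k \<subseteq> H0curl cross3 \<Omega> \<inter> piecewise_poly Th (Suc k)" for Th k
    by (auto simp: nedelec3_def)
  show ?case
  proof (intro exI[of _ "4 * R\<^sup>2 + 1"] conjI[of "0 < 4 * R\<^sup>2 + 1"] allI impI, goal_cases)
    case 1
    show ?case by (simp add: add_nonneg_pos)
  next
    case 2
    then show ?case
      by (elim conjE) (rule mhd_stability[OF cross_products_3 \<Omega> R], assumption+,
          simp_all only: subspace_nedelec3[OF dom] Ch)
  qed
next
  case (2 \<Omega> \<sigma> \<rho> \<kappa>)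
  then have \<Omega>: "lipschitz_polyhedral_domain \<Omega>" by blast
  note dom = bounded_open_domain_polyhedral[OF \<Omega>]
  obtain R where R: "\<And>x. x \<in> \<Omega> \<Longrightarrow> norm x \<le> R" "0 < R"
    using bounded_open_domain.bounded_domain[OF dom] by (auto simp: bounded_pos)
  have Ch: "nedelec2 \<Omega> Th k \<subseteq> H0curl cross2_vv \<Omega> \<inter> piecewise_poly Th (Suc k)" for Th k
    by (auto simp: nedelec2_def)
  show ?case
  proof (intro exI[of _ "4 * R\<^sup>2 + 1"] conjI[of "0 < 4 * R\<^sup>2 + 1"] allI impI, goal_cases)
    case 1
    show ?case by (simp add: add_nonneg_pos)
  next
    case 2
    then show ?case
      by (elim conjE) (rule mhd_stability[OF cross_products_2 \<Omega> R], assumption+,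
          simp_all only: subspace_nedelec2[OF dom] Ch)
  qed
qed

end
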